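(* Let $C$ be a nonempty compact and stable convex subset of a locally convex real Hausdorff vector space $X$, let $d$ be a distance on $\mathrm{Ext}\,C$ continuous on $\mathrm{Ext}\,C\times \mathrm{Ext}\,C$ with respect to the natural topology (the one induced by $X$), and let $p\in[1,\infty)$. Then $d_{*p}$ and $D_p$ are continuous on $C\times C$ with respect to the natural topology.
   Context: $\mathrm{Ext}\,C$ is the set of extreme points of $C$. A convex set $C$ is stable when the midpoint map $C\times C\to C$, $(x,y)\mapsto (x+y)/2$, is open (relative topologies). $X^*$ is the set of continuous real linear forms on $X$; $\mathcal{P}(E)$ is the set of Radon probability measures on $E$. For $x,y\in C$, $\mathcal{P}_{(x,y)}$ is the set of $\pi\in\mathcal{P}(\mathrm{Ext}\,C\times \mathrm{Ext}\,C)$ with $\iint f(z)\,d\pi(z,z_* )=f(x)$ and $\iint f(z_* )\,d\pi(z,z_* )=f(y)$ for all $f\in X^*$. Define $$d_{*p}(x,y)=\Big(\inf_{\pi\in\mathcal{P}_{(x,y)}}\iint d(z,z_* )^p\,d\pi(z,z_* )\Big)^{1/p},$$ $$D_p(x,y)=\inf\Big\{\sum_{j=1}^N d_{*p}(z_j,z_{j+1}):\ N\ge 1,\ z_1=x,\ z_{N+1}=y,\ z_j\in C\Big\}.$$ *)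

theory Defs
  imports "HOL-Probability.Probability"
begin

text \<open>Locally convex Hausdorff real topological vector spaces.  Joint continuity of scalar
  multiplication is phrased with filters, in the style of the library class
  \<open>topological_monoid_add\<close>, because a class axiom cannot mention the product topology
  on \<open>real \<times> 'a\<close>; likewise convexity of \<open>V\<close> has to be unfolded there.\<close>

class locally_convex_t2_space = real_vector + topological_ab_group_add + t2_space +
  assumes tendsto_scaleR_Pair:
    "LIM x (nhds r \<times>\<^sub>F nhds a). fst x *\<^sub>R snd x :> nhds (r *\<^sub>R a)"
  and locally_convex_at_0:
    "open U \<Longrightarrow> 0 \<in> U \<Longrightarrow> \<exists>V. open V \<and> 0 \<in> V \<and> V \<subseteq> U \<and>
       (\<forall>x\<in>V. \<forall>y\<in>V. \<forall>u\<ge>0. \<forall>v\<ge>0. u + v = 1 \<longrightarrow> u *\<^sub>R x + v *\<^sub>R y \<in> V)"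

lemma locally_convex_at_0_convex:
  fixes U :: "'a::locally_convex_t2_space set"
  assumes "open U" "0 \<in> U"
  shows "\<exists>V. open V \<and> 0 \<in> V \<and> convex V \<and> V \<subseteq> U"
  using locally_convex_at_0[OF assms] unfolding convex_def by blast

instance real_normed_vector < locally_convex_t2_space
proof
  fix r :: real and a :: 'a
  show "LIM x (nhds r \<times>\<^sub>F nhds a). fst x *\<^sub>R snd x :> nhds (r *\<^sub>R a)"
    unfolding nhds_prod[symmetric]
    by (intro tendsto_intros)
      (use tendsto_fst[OF filterlim_ident, of "(r, a)"] tendsto_snd[OF filterlim_ident, of "(r, a)"]
        in simp_all)
next
  fix U :: "'a set"
  assume "open U" "0 \<in> U"
  then obtain e where "e > 0" "ball 0 e \<subseteq> U"
    by (auto simp: open_contains_ball)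
  then show "\<exists>V. open V \<and> 0 \<in> V \<and> V \<subseteq> U \<and>
      (\<forall>x\<in>V. \<forall>y\<in>V. \<forall>u\<ge>0. \<forall>v\<ge>0. u + v = 1 \<longrightarrow> u *\<^sub>R x + v *\<^sub>R y \<in> V)"
    using convex_ball[of "0::'a" e] unfolding convex_def
    by (intro exI[of _ "ball 0 e"]) (auto simp del: mem_ball simp: centre_in_ball)
qed

definition Ext :: "'a::real_vector set \<Rightarrow> 'a set" where
  "Ext C = {x. x extreme_point_of C}"

definition stable_convex :: "'a::{real_vector, topological_space} set \<Rightarrow> bool" where
  "stable_convex C \<longleftrightarrow> convex C \<and>
     open_map (top_of_set (C \<times> C)) (top_of_set C) (\<lambda>(x, y). midpoint x y)"

definition continuous_dual :: "('a::{real_vector, topological_space} \<Rightarrow> real) set" where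
  "continuous_dual = {f. linear f \<and> continuous_on UNIV f}"

text \<open>The space \<open>E\<close> carries the subspace topology; its Borel sigma-algebra is the trace
  on \<open>E\<close> of the ambient one, and its compact subsets are the ambient compact sets
  contained in \<open>E\<close>.\<close>

definition radon_prob :: "'a::t2_space set \<Rightarrow> 'a measure set" where
  "radon_prob E = {M. prob_space M \<and> sets M = sets (restrict_space borel E) \<and>
     (\<forall>A\<in>sets M. emeasure M A = (SUP K\<in>{K. compact K \<and> K \<subseteq> A}. emeasure M K))}"

definition couplings :: "'a::locally_convex_t2_space set \<Rightarrow> 'a \<Rightarrow> 'a \<Rightarrow> ('a \<times> 'a) measure set" where
  "couplings C x y = {\<pi> \<in> radon_prob (Ext C \<times> Ext C).
     \<forall>f\<in>continuous_dual. (\<integral>w. f (fst w) \<partial>\<pi>) = f x \<and> (\<integral>w. f (snd w) \<partial>\<pi>) = f y}"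

text \<open>The infimum is taken in the reals, over Bochner integrals.  For \<open>C\<close> compact and
  stable, \<open>Ext C\<close> is compact, so the integrands are bounded and the couplings exist by
  Choquet theory: neither the convention for non-integrable functions nor the one for
  the infimum of the empty set plays a role.\<close>

definition d_star ::
  "'a::locally_convex_t2_space set \<Rightarrow> ('a \<Rightarrow> 'a \<Rightarrow> real) \<Rightarrow> real \<Rightarrow> 'a \<Rightarrow> 'a \<Rightarrow> real" where
  "d_star C d p x y =
     (INF \<pi>\<in>couplings C x y. \<integral>w. d (fst w) (snd w) powr p \<partial>\<pi>) powr (1 / p)"

definition D_chain ::
  "'a::locally_convex_t2_space set \<Rightarrow> ('a \<Rightarrow> 'a \<Rightarrow> real) \<Rightarrow> real \<Rightarrow> 'a \<Rightarrow> 'a \<Rightarrow> real" where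
  "D_chain C d p x y = Inf {(\<Sum>j=1..N. d_star C d p (z j) (z (j + 1))) | (N::nat) (z::nat \<Rightarrow> 'a).
     1 \<le> N \<and> z 1 = x \<and> z (N + 1) = y \<and> (\<forall>j\<in>{1..N + 1}. z j \<in> C)}"

end

theory Submission
  imports Defs
begin

text \<open>Put \<open>K = C \<times> C\<close>, whose extreme points form the compact metrizable set \<open>Ext C \<times> Ext C\<close>, and let
  \<open>min_cost\<close> at a point of \<open>K\<close> be the infimum of \<open>\<integral> c d\<pi>\<close>, for \<open>c = d\<^sup>p\<close>, over the probability
  measures \<open>\<pi>\<close> on \<open>Ext K\<close> with that barycenter; then \<open>d\<^sub>*\<close> is its \<open>p\<close>-th root.  By the Riesz
  representation theorem measures may be replaced by positive normalized functionals on
  \<open>C(Ext K)\<close>; these form a compact set, so \<open>min_cost\<close> is convex and lower semicontinuous.  Only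
  Dirac measures represent an extreme point, so \<open>min_cost\<close> is close to \<open>c\<close> near \<open>Ext K\<close>.  As the
  midpoint map is open, the upper semicontinuous envelope of \<open>min_cost\<close> is midpoint convex, and
  being bounded it is convex.  Cutting a representing functional of \<open>k\<close> into pieces with
  barycenters near \<open>Ext K\<close> bounds the envelope at \<open>k\<close> by the cost of that functional, which is
  upper semicontinuity.  By the Krein--Milman theorem \<open>d\<^sub>*\<close> vanishes on the diagonal, and the
  triangle inequality for \<open>D\<close> transfers continuity from \<open>d\<^sub>*\<close> to \<open>D\<close>.\<close>

text \<open>Compactness of the representing functionals gives only lower semicontinuity: points near
  \<open>k\<close> might have no representing functional close to a given one of \<open>k\<close>.
  Stability must exclude this, but it speaks of midpoints of points and not of functionals. The
  upper envelope is the function on \<open>K\<close> through which it can act: openness of the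
  midpoint map says that each point of \<open>K\<close> near a midpoint is itself a midpoint of
  points near the two ends, and convexity of \<open>min_cost\<close> turns this into an inequality
  for the envelope. The envelope is not known to be continuous at that stage, so boundedness has to
  carry the passage from midpoints to all convex combinations. On \<open>Ext K\<close> the envelope
  is controlled by uniqueness of the representing functional, and the decomposition spreads this
  control over \<open>K\<close>. The ambient space need not be metrizable; the distance on the
  compact set \<open>Ext C\<close> supplies continuous functions that are positive exactly on a
  given open set, and from these both the measures and the partitions of unity are built.\<close>

lemma tendsto_scaleR_lcs:
  fixes a :: "'a::locally_convex_t2_space"
  assumes "(f \<longlongrightarrow> r) F" "(g \<longlongrightarrow> a) F"
  shows "((\<lambda>x. f x *\<^sub>R g x) \<longlongrightarrow> r *\<^sub>R a) F"
  using filterlim_compose[OF tendsto_scaleR_Pair filterlim_Pair[OF assms]] by simp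

lemma continuous_on_scaleR_lcs [continuous_intros]:
  fixes g :: "_ \<Rightarrow> 'a::locally_convex_t2_space"
  assumes "continuous_on S f" "continuous_on S g"
  shows "continuous_on S (\<lambda>x. f x *\<^sub>R g x)"
  using assms unfolding continuous_on_def by (auto intro: tendsto_scaleR_lcs)

section \<open>The product of two locally convex spaces\<close>

lemma tendsto_fst_nhds: "(fst \<longlongrightarrow> fst c) (nhds c)"
  and tendsto_snd_nhds: "(snd \<longlongrightarrow> snd c) (nhds c)"
  using tendsto_fst[OF filterlim_ident, of c] tendsto_snd[OF filterlim_ident, of c] by simp_all

instance prod :: (topological_monoid_add, topological_monoid_add) topological_monoid_add
proof
  fix a b :: "'a \<times> 'b"
  have "((\<lambda>x. (fst (fst x) + fst (snd x), snd (fst x) + snd (snd x))) \<longlongrightarrow>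
      (fst a + fst b, snd a + snd b)) (nhds a \<times>\<^sub>F nhds b)"
    by (intro tendsto_Pair tendsto_add filterlim_compose[OF tendsto_fst_nhds]
        filterlim_compose[OF tendsto_snd_nhds] filterlim_fst filterlim_snd)
  then show "LIM x (nhds a \<times>\<^sub>F nhds b). fst x + snd x :> nhds (a + b)"
    by (simp add: plus_prod_def)
qed

instance prod :: (topological_comm_monoid_add, topological_comm_monoid_add) topological_comm_monoid_add ..

instance prod :: (topological_group_add, topological_group_add) topological_group_add
proof
  fix a :: "'a \<times> 'b"
  show "(uminus \<longlongrightarrow> - a) (nhds a)"
    using tendsto_Pair[OF tendsto_minus[OF tendsto_fst_nhds] tendsto_minus[OF tendsto_snd_nhds], of a]
    by (simp add: uminus_prod_def[symmetric])
qed

instance prod :: (topological_ab_group_add, topological_ab_group_add) topological_ab_group_add ..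

instance prod :: (locally_convex_t2_space, locally_convex_t2_space) locally_convex_t2_space
proof
  fix r :: real and a :: "'a \<times> 'b"
  have "((\<lambda>x. (fst x *\<^sub>R fst (snd x), fst x *\<^sub>R snd (snd x))) \<longlongrightarrow>
      (r *\<^sub>R fst a, r *\<^sub>R snd a)) (nhds r \<times>\<^sub>F nhds a)"
    by (intro tendsto_Pair tendsto_scaleR_lcs filterlim_compose[OF tendsto_fst_nhds]
        filterlim_compose[OF tendsto_snd_nhds] filterlim_fst filterlim_snd)
  then show "LIM x (nhds r \<times>\<^sub>F nhds a). fst x *\<^sub>R snd x :> nhds (r *\<^sub>R a)"
    by (simp add: scaleR_prod_def)
next
  fix U :: "('a \<times> 'b) set"
  assume "open U" "0 \<in> U"
  then obtain A B where AB: "open A" "open B" "(0, 0) \<in> A \<times> B" "A \<times> B \<subseteq> U"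
    unfolding zero_prod_def by (rule open_prod_elim)
  obtain V W where V: "open V" "0 \<in> V" "convex V" "V \<subseteq> A"
    and W: "open W" "0 \<in> W" "convex W" "W \<subseteq> B"
    using locally_convex_at_0_convex AB by (metis mem_Sigma_iff)
  have "convex (V \<times> W)" using V W by (simp add: convex_Times)
  moreover have "open (V \<times> W)" "V \<times> W \<subseteq> U" "0 \<in> V \<times> W"
    using V(1,2) W(1,2) Sigma_mono[OF V(4) W(4)] AB(4) by (auto intro: open_Times simp: zero_prod_def)
  ultimately show "\<exists>V. open V \<and> 0 \<in> V \<and> V \<subseteq> U \<and>
      (\<forall>x\<in>V. \<forall>y\<in>V. \<forall>u\<ge>0. \<forall>v\<ge>0. u + v = 1 \<longrightarrow> u *\<^sub>R x + v *\<^sub>R y \<in> V)"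
    unfolding convex_def by (intro exI[of _ "V \<times> W"]) simp
qed

lemma open_translation_lcs:
  fixes U :: "'a::locally_convex_t2_space set"
  assumes "open U"
  shows "open {x. a + r *\<^sub>R x \<in> U}"
proof -
  have "open ((\<lambda>x. a + r *\<^sub>R x) -` U)"
    by (intro open_vimage assms continuous_intros)
  then show ?thesis by (simp add: vimage_def)
qed

section \<open>Hahn--Banach separation and the Krein--Milman theorem\<close>

definition sublinear :: "('a::real_vector \<Rightarrow> real) \<Rightarrow> bool" where
  "sublinear p \<longleftrightarrow> (\<forall>x y. p (x + y) \<le> p x + p y) \<and> (\<forall>x. \<forall>a\<ge>0. p (a *\<^sub>R x) = a * p x)"

lemma sublinear_add: "sublinear p \<Longrightarrow> p (x + y) \<le> p x + p y"
  and sublinear_scale: "sublinear p \<Longrightarrow> 0 \<le> a \<Longrightarrow> p (a *\<^sub>R x) = a * p x"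
  by (simp_all add: sublinear_def)

lemma sublinear_zero: "sublinear p \<Longrightarrow> p 0 = 0"
  using sublinear_scale[of p 0 0] by simp

lemma sublinear_ge: "sublinear p \<Longrightarrow> - p (- x) \<le> p x"
  using sublinear_add[of p x "- x"] sublinear_zero[of p] by simp

text \<open>Hahn--Banach by descent: Zorn's lemma is applied to the sublinear functionals below \<open>p\<close>
  instead of to partial linear functionals.  The functional \<open>q\<close> below shows that a minimal one
  is odd, hence linear; started at the given point \<open>y\<close> it also forces equality there.\<close>

lemma sublinear_directional:
  fixes y :: "'a::real_vector"
  assumes p: "sublinear p"
  defines "q \<equiv> \<lambda>x. INF t\<in>{0..}. p (x + t *\<^sub>R y) - t * p y"
  shows "sublinear q" "q x \<le> p x" "q (- y) \<le> - p y"
proof -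
  \<comment> \<open>The bound is independent of \<open>t\<close>, so the infimum defining
    \<open>q\<close> is a genuine one.\<close>
  have lb: "- p (- x) \<le> p (x + t *\<^sub>R y) - t * p y" if "0 \<le> t" for x t
    using sublinear_add[OF p, of "x + t *\<^sub>R y" "- x"] sublinear_scale[OF p that, of y] by simp
  have bdd: "bdd_below ((\<lambda>t. p (x + t *\<^sub>R y) - t * p y) ` {0..})" for x
    using lb by (intro bdd_belowI2) auto
  have qle: "q x \<le> p (x + t *\<^sub>R y) - t * p y" if "0 \<le> t" for x t
    unfolding q_def using that by (intro cINF_lower bdd) auto
  have qge: "c \<le> q x" if "\<And>t. 0 \<le> t \<Longrightarrow> c \<le> p (x + t *\<^sub>R y) - t * p y" for c x
    unfolding q_def using that by (intro cINF_greatest) auto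
  show "q x \<le> p x" using qle[of 0 x] by simp
  show "q (- y) \<le> - p y" using qle[of 1 "- y"] sublinear_zero[OF p] by simp
  show "sublinear q" unfolding sublinear_def
  proof (intro conjI allI impI)
    fix x z
    have "q (x + z) - (p (z + t *\<^sub>R y) - t * p y) \<le> p (x + s *\<^sub>R y) - s * p y" if "0 \<le> s" "0 \<le> t" for s t
      using sublinear_add[OF p, of "x + s *\<^sub>R y" "z + t *\<^sub>R y"] qle[of "s + t" "x + z"] that
      by (simp add: algebra_simps)
    then have *: "q (x + z) - (p (z + t *\<^sub>R y) - t * p y) \<le> q x" if "0 \<le> t" for t
      using that by (intro qge) auto
    have "q (x + z) - q x \<le> q z"
    proof (rule qge)
      fix t :: real assume "0 \<le> t"
      then show "q (x + z) - q x \<le> p (z + t *\<^sub>R y) - t * p y" using *[of t] by linarith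
    qed
    then show "q (x + z) \<le> q x + q z" by simp
  next
    fix x and a :: real
    assume "0 \<le> a"
    show "q (a *\<^sub>R x) = a * q x"
    proof (cases "a = 0")
      case True
      have "0 \<le> q 0"
        by (intro qge) (simp add: sublinear_scale[OF p])
      moreover have "q 0 \<le> 0"
        using qle[of 0 0] sublinear_zero[OF p] by simp
      ultimately show ?thesis using True by simp
    next
      case False
      then have a: "0 < a" using \<open>0 \<le> a\<close> by simp
      \<comment> \<open>One inequality for every positive factor suffices: used with
        \<open>inverse a\<close> at the point \<open>a *\<^sub>R x\<close> it gives the
        converse.\<close>
      have sc: "b * q x \<le> q (b *\<^sub>R x)" if b: "0 < b" for b x
      proof (rule qge)
        fix t :: real assume t: "0 \<le> t"
        have "b * q x \<le> b * (p (x + (t / b) *\<^sub>R y) - (t / b) * p y)"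
          using b t by (intro mult_left_mono qle) auto
        also have "\<dots> = p (b *\<^sub>R (x + (t / b) *\<^sub>R y)) - t * p y"
          using b by (subst sublinear_scale[OF p]) (auto simp: algebra_simps)
        also have "b *\<^sub>R (x + (t / b) *\<^sub>R y) = b *\<^sub>R x + t *\<^sub>R y"
          using b by (simp add: algebra_simps)
        finally show "b * q x \<le> p (b *\<^sub>R x + t *\<^sub>R y) - t * p y" .
      qed
      have "inverse a * q (a *\<^sub>R x) \<le> q x"
        using sc[of "inverse a" "a *\<^sub>R x"] a by simp
      then have "q (a *\<^sub>R x) \<le> a * q x" using a by (simp add: field_simps)
      then show ?thesis using sc[OF a, of x] by simp
    qed
  qed
qed

lemma minimal_sublinear_linear:
  fixes q :: "'a::real_vector \<Rightarrow> real"
  assumes q: "sublinear q" and min: "\<And>r. sublinear r \<Longrightarrow> (\<And>x. r x \<le> q x) \<Longrightarrow> r = q"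
  shows "linear q"
proof -
  have neg: "q (- y) = - q y" for y
  proof -
    define r where "r = (\<lambda>x. INF t\<in>{0..}. q (x + t *\<^sub>R y) - t * q y)"
    have "r = q"
      unfolding r_def by (rule min) (rule sublinear_directional[OF q])+
    moreover have "r (- y) \<le> - q y"
      unfolding r_def by (rule sublinear_directional(3)[OF q])
    ultimately have "q (- y) \<le> - q y" by simp
    then show ?thesis using sublinear_ge[OF q, of y] by simp
  qed
  show ?thesis
  proof (rule linearI)
    fix x y
    have "q x \<le> q (x + y) + q (- y)" using sublinear_add[OF q, of "x + y" "- y"] by simp
    then show "q (x + y) = q x + q y"
      using neg[of y] sublinear_add[OF q, of x y] by simp
  next
    fix r x
    show "q (r *\<^sub>R x) = r *\<^sub>R q x"
    proof (cases "0 \<le> r")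
      case True then show ?thesis by (simp add: sublinear_scale[OF q])
    next
      case False
      then have "q (r *\<^sub>R x) = - q ((- r) *\<^sub>R x)" using neg[of "(- r) *\<^sub>R x"] by simp
      also have "\<dots> = r * q x" using False by (subst sublinear_scale[OF q]) auto
      finally show ?thesis by simp
    qed
  qed
qed

text \<open>A chain is bounded below by its pointwise infimum, which is finite because every member
  dominates \<open>- p (- x)\<close> at \<open>x\<close>.\<close>

lemma linear_below_sublinear:
  fixes p :: "'a::real_vector \<Rightarrow> real"
  assumes p: "sublinear p"
  obtains f where "linear f" "\<And>x. f x \<le> p x"
proof -
  let ?A = "{q. sublinear q \<and> (\<forall>x. q x \<le> p x)}"
  let ?P = "\<lambda>q r :: 'a \<Rightarrow> real. \<forall>x. r x \<le> q x"
  have "\<exists>m\<in>?A. \<forall>a\<in>?A. ?P m a \<longrightarrow> a = m"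
  proof (rule predicate_Zorn)
    show "partial_order_on ?A (relation_of ?P ?A)"
      by (rule partial_order_on_relation_ofI) (auto simp: fun_eq_iff intro: order_trans antisym)
  next
    fix \<C> assume ch: "\<C> \<in> Chains (relation_of ?P ?A)"
    show "\<exists>u\<in>?A. \<forall>a\<in>\<C>. ?P a u"
    proof (cases "\<C> = {}")
      case True then show ?thesis using p by auto
    next
      case False
      have mem: "sublinear q" "q x \<le> p x" if "q \<in> \<C>" for q x
        using ch that by (auto simp: Chains_def relation_of_def)
      have tot: "(\<forall>x. r x \<le> q x) \<or> (\<forall>x. q x \<le> r x)" if "q \<in> \<C>" "r \<in> \<C>" for q r
        using ch that by (auto simp: Chains_def relation_of_def)
      define u where "u x = (INF q\<in>\<C>. q x)" for x
      have bdd: "bdd_below ((\<lambda>q. q x) ` \<C>)" for x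
      proof (rule bdd_belowI2)
        fix q assume "q \<in> \<C>"
        then show "- p (- x) \<le> q x"
          using sublinear_ge[of q x] mem[of q] by (meson neg_le_iff_le order_trans)
      qed
      have ule: "u x \<le> q x" if "q \<in> \<C>" for q x
        unfolding u_def using that by (intro cINF_lower bdd)
      have uge: "c \<le> u x" if "\<And>q. q \<in> \<C> \<Longrightarrow> c \<le> q x" for c x
        unfolding u_def using that False by (intro cINF_greatest) auto
      have "sublinear u" unfolding sublinear_def
      proof (intro conjI allI impI)
        fix x y
        \<comment> \<open>An infimum of sublinear functionals need not be subadditive; comparability
          of \<open>q\<close> and \<open>r\<close> allows both summands to be bounded with the same
          one of the two.\<close>
        have *: "u (x + y) \<le> q x + r y" if "q \<in> \<C>" "r \<in> \<C>" for q r
        proof -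
          have "u (x + y) \<le> q x + q y" "u (x + y) \<le> r x + r y"
            using ule[OF that(1), of "x + y"] ule[OF that(2), of "x + y"]
              sublinear_add[OF mem(1)[OF that(1)], of x y] sublinear_add[OF mem(1)[OF that(2)], of x y]
            by linarith+
          moreover have "q y \<le> r y \<or> r x \<le> q x" using tot[OF that] by blast
          ultimately show ?thesis by linarith
        qed
        have **: "u (x + y) - q x \<le> u y" if "q \<in> \<C>" for q
        proof (rule uge)
          fix r assume "r \<in> \<C>"
          then show "u (x + y) - q x \<le> r y" using *[OF that] by fastforce
        qed
        have "u (x + y) - u y \<le> u x"
        proof (rule uge)
          fix q assume "q \<in> \<C>"
          then show "u (x + y) - u y \<le> q x" using ** by fastforce
        qed
        then show "u (x + y) \<le> u x + u y" by simp
      next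
        fix x and a :: real
        assume a: "0 \<le> a"
        show "u (a *\<^sub>R x) = a * u x"
        proof (cases "a = 0")
          case True
          have "u 0 = 0" unfolding u_def using False mem(1) by (simp add: sublinear_zero)
          then show ?thesis using True by simp
        next
          case False
          then have a: "0 < a" using a by simp
          have "a * u x \<le> u (a *\<^sub>R x)"
            using a by (intro uge) (simp add: sublinear_scale[OF mem(1)] ule)
          moreover have "u (a *\<^sub>R x) / a \<le> u x"
            using a ule[of _ "a *\<^sub>R x"] by (intro uge) (simp add: sublinear_scale[OF mem(1)] field_simps)
          ultimately show ?thesis using a by (simp add: field_simps)
        qed
      qed
      moreover have "u x \<le> p x" for x
        using False ule mem(2) by (meson all_not_in_conv order_trans)
      ultimately show ?thesis using ule by auto
    qed
  qed
  then obtain m where m: "sublinear m" "\<And>x. m x \<le> p x"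
    and min: "\<And>a. sublinear a \<Longrightarrow> (\<And>x. a x \<le> p x) \<Longrightarrow> (\<And>x. a x \<le> m x) \<Longrightarrow> a = m"
    by auto
  have "linear m"
    using m by (intro minimal_sublinear_linear min) (auto intro: order_trans)
  then show thesis using m(2) by (rule that)
qed

lemma hahn_banach_sublinear:
  fixes p :: "'a::real_vector \<Rightarrow> real"
  assumes p: "sublinear p"
  obtains f where "linear f" "\<And>x. f x \<le> p x" "f y = p y"
proof -
  note q = sublinear_directional[OF p, where y = y]
  obtain f where f: "linear f" "\<And>x. f x \<le> (INF t\<in>{0..}. p (x + t *\<^sub>R y) - t * p y)"
    by (rule linear_below_sublinear[OF q(1)], rule that)
  have le: "f x \<le> p x" for x by (rule order_trans[OF f(2)]) (rule q(2))
  have "f (- y) \<le> - p y" by (rule order_trans[OF f(2)]) (rule q(3))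
  then have "f y = p y" using linear_neg[OF f(1), of y] le[of y] by simp
  then show thesis using that[OF f(1) le] by blast
qed

section \<open>Gauges of open convex neighbourhoods of zero\<close>

text \<open>The Minkowski functional of \<open>U\<close>.\<close>

definition gauge_fun :: "'a::real_vector set \<Rightarrow> 'a \<Rightarrow> real" where
  "gauge_fun U x = Inf {t. 0 < t \<and> x /\<^sub>R t \<in> U}"

context
  fixes U :: "'a::locally_convex_t2_space set"
  assumes U: "open U" "convex U" "0 \<in> U"
begin

text \<open>Multiples \<open>t *\<^sub>R x\<close> tend to 0, hence enter \<open>U\<close>. This
  keeps the infimum in the gauge from being taken over the empty set.\<close>

lemma gauge_fun_absorb: obtains t where "0 < t" "x /\<^sub>R t \<in> U"
proof -
  have "((\<lambda>t. t *\<^sub>R x) \<longlongrightarrow> 0 *\<^sub>R x) (at_right 0)"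
    by (intro tendsto_scaleR_lcs tendsto_ident_at tendsto_const)
  then have "eventually (\<lambda>t. t *\<^sub>R x \<in> U) (at_right (0::real))"
    using U by (auto dest: topological_tendstoD)
  then have "eventually (\<lambda>t. t *\<^sub>R x \<in> U \<and> 0 < t) (at_right (0::real))"
    using eventually_at_right_less by eventually_elim auto
  then obtain t where "t *\<^sub>R x \<in> U" "0 < t"
    using eventually_happens'[OF trivial_limit_at_right_real] by blast
  then show thesis using that[of "inverse t"] by simp
qed

lemma gauge_fun_lower: "0 < t \<Longrightarrow> x /\<^sub>R t \<in> U \<Longrightarrow> gauge_fun U x \<le> t"
  unfolding gauge_fun_def by (intro cInf_lower bdd_belowI[of _ 0]) auto

lemma gauge_fun_greatest: "(\<And>t. 0 < t \<Longrightarrow> x /\<^sub>R t \<in> U \<Longrightarrow> c \<le> t) \<Longrightarrow> c \<le> gauge_fun U x"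
  unfolding gauge_fun_def using gauge_fun_absorb[of x] by (intro cInf_greatest) auto

lemma gauge_fun_sublinear: "sublinear (gauge_fun U)"
  unfolding sublinear_def
proof (intro conjI allI impI)
  fix x y
  have *: "gauge_fun U (x + y) \<le> s + t" if "0 < s" "x /\<^sub>R s \<in> U" "0 < t" "y /\<^sub>R t \<in> U" for s t
  proof (rule gauge_fun_lower)
    \<comment> \<open>With these weights the convex combination of \<open>x /\<^sub>R s\<close> and
      \<open>y /\<^sub>R t\<close> is exactly \<open>(x + y) /\<^sub>R (s + t)\<close>.\<close>
    have "(s / (s + t)) *\<^sub>R (x /\<^sub>R s) + (t / (s + t)) *\<^sub>R (y /\<^sub>R t) \<in> U"
      using that U(2) by (intro convexD) (auto simp: add_divide_distrib[symmetric])
    moreover have "(s / (s + t)) *\<^sub>R (x /\<^sub>R s) = x /\<^sub>R (s + t)"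
      "(t / (s + t)) *\<^sub>R (y /\<^sub>R t) = y /\<^sub>R (s + t)"
      using that by (simp_all add: divide_inverse mult.commute)
    ultimately show "(x + y) /\<^sub>R (s + t) \<in> U" by (simp only: scaleR_add_right)
  qed (use that in auto)
  have **: "gauge_fun U (x + y) - t \<le> gauge_fun U x" if "0 < t" "y /\<^sub>R t \<in> U" for t
  proof (rule gauge_fun_greatest)
    fix s assume "0 < s" "x /\<^sub>R s \<in> U"
    then show "gauge_fun U (x + y) - t \<le> s" using *[of s t] that by linarith
  qed
  have "gauge_fun U (x + y) - gauge_fun U x \<le> gauge_fun U y"
  proof (rule gauge_fun_greatest)
    fix t assume "0 < t" "y /\<^sub>R t \<in> U"
    then show "gauge_fun U (x + y) - gauge_fun U x \<le> t" using **[of t] by linarith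
  qed
  then show "gauge_fun U (x + y) \<le> gauge_fun U x + gauge_fun U y" by simp
next
  fix x and a :: real
  assume "0 \<le> a"
  show "gauge_fun U (a *\<^sub>R x) = a * gauge_fun U x"
  proof (cases "a = 0")
    case True
    have "0 \<le> gauge_fun U 0" by (rule gauge_fun_greatest) simp
    moreover have "gauge_fun U 0 \<le> e" if "0 < e" for e
      using that U(3) by (intro gauge_fun_lower) auto
    ultimately have "gauge_fun U 0 = 0" using dense_ge[of 0 "gauge_fun U 0"] by (intro antisym) auto
    then show ?thesis using True by simp
  next
    case False
    have le: "gauge_fun U (b *\<^sub>R x) / b \<le> gauge_fun U x" if b: "0 < b" for b x
    proof (rule gauge_fun_greatest)
      fix t assume t: "0 < t" "x /\<^sub>R t \<in> U"
      then have "gauge_fun U (b *\<^sub>R x) \<le> b * t"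
        using b by (intro gauge_fun_lower) (auto simp: field_simps)
      then show "gauge_fun U (b *\<^sub>R x) / b \<le> t" using b by (simp add: field_simps)
    qed
    have a: "0 < a" using False \<open>0 \<le> a\<close> by simp
    show ?thesis
      using le[OF a, of x] le[of "inverse a" "a *\<^sub>R x"] a by (simp add: field_simps)
  qed
qed

text \<open>Strictness comes from openness: some multiple of \<open>x\<close> with factor greater
  than 1 still lies in \<open>U\<close>.\<close>

lemma gauge_fun_less_1:
  assumes "x \<in> U" shows "gauge_fun U x < 1"
proof -
  have "((\<lambda>t. t *\<^sub>R x) \<longlongrightarrow> 1 *\<^sub>R x) (at_right 1)"
    by (intro tendsto_scaleR_lcs tendsto_ident_at tendsto_const)
  then have "eventually (\<lambda>t. t *\<^sub>R x \<in> U) (at_right (1::real))"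
    using U assms by (auto dest: topological_tendstoD)
  then have "eventually (\<lambda>t. t *\<^sub>R x \<in> U \<and> 1 < t) (at_right (1::real))"
    using eventually_at_right_less by eventually_elim auto
  then obtain t where t: "t *\<^sub>R x \<in> U" "1 < t"
    using eventually_happens'[OF trivial_limit_at_right_real] by blast
  then have "gauge_fun U x \<le> inverse t" by (intro gauge_fun_lower) auto
  also have "\<dots> < 1" using t by (simp add: inverse_less_1_iff)
  finally show ?thesis .
qed

lemma gauge_fun_ge_1:
  assumes "x \<notin> U" shows "1 \<le> gauge_fun U x"
proof (rule gauge_fun_greatest, rule ccontr)
  fix t assume t: "0 < t" "x /\<^sub>R t \<in> U" "\<not> 1 \<le> t"
  have "t *\<^sub>R (x /\<^sub>R t) + (1 - t) *\<^sub>R 0 \<in> U"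
    using U t by (intro convexD) auto
  then show False using t assms by simp
qed

lemma continuous_linear_if_bounded_above:
  fixes f :: "'a \<Rightarrow> real"
  assumes f: "linear f" and le: "\<And>x. x \<in> U \<Longrightarrow> f x \<le> 1"
  shows "continuous_on UNIV f"
proof -
  have "(f \<longlongrightarrow> f x) (nhds x)" for x
  proof (rule tendstoI)
    fix e :: real assume e: "0 < e"
    \<comment> \<open>A translate of a scaled copy of \<open>U\<close> bounds
      \<open>f y - f x\<close> from one side only; intersecting it with its reflection at
      \<open>x\<close> bounds both sides. The scaling \<open>2 / e\<close> yields the bound
      \<open>e / 2\<close>, hence strictly less than \<open>e\<close>.\<close>
    define V where "V = {y. (- (1 / (e/2)) *\<^sub>R x) + (1 / (e/2)) *\<^sub>R y \<in> U}
      \<inter> {y. ((1 / (e/2)) *\<^sub>R x) + (- (1 / (e/2))) *\<^sub>R y \<in> U}"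
    have "open V" unfolding V_def by (intro open_Int open_translation_lcs U)
    moreover have "x \<in> V" unfolding V_def using U(3) by simp
    ultimately have "eventually (\<lambda>y. y \<in> V) (nhds x)" by (rule eventually_nhds_in_open)
    then show "eventually (\<lambda>y. dist (f y) (f x) < e) (nhds x)"
    proof eventually_elim
      case (elim y)
      have "f ((- (1 / (e/2)) *\<^sub>R x) + (1 / (e/2)) *\<^sub>R y) \<le> 1"
        "f ((1 / (e/2)) *\<^sub>R x + (- (1 / (e/2))) *\<^sub>R y) \<le> 1"
        using elim by (auto simp: V_def intro!: le)
      then have "(f y - f x) \<le> e/2" "(f x - f y) \<le> e/2"
        using e by (simp_all add: linear_add[OF f] linear_scale[OF f] linear_neg[OF f] linear_diff[OF f] field_simps)
      then show ?case using e by (auto simp: dist_real_def)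
    qed
  qed
  then show ?thesis
    by (intro continuous_at_imp_continuous_on) (simp add: isCont_def tendsto_at_iff_tendsto_nhds)
qed

end

section \<open>Separation by continuous linear forms\<close>

lemma continuous_dualD:
  assumes "f \<in> continuous_dual"
  shows "linear f" "continuous_on S f"
  using assms continuous_on_subset by (auto simp: continuous_dual_def)

text \<open>After a translation moving a point \<open>u0\<close> of \<open>U\<close> to 0,
  Hahn--Banach is applied at \<open>x - u0\<close>: there \<open>f\<close> equals the gauge, which
  is at least 1 since \<open>x\<close> lies outside \<open>U\<close>, while \<open>f\<close> stays
  below 1 on the translated set.\<close>

lemma separate_open_convex_point:
  fixes U :: "'a::locally_convex_t2_space set"
  assumes "open U" "convex U" "U \<noteq> {}" "x \<notin> U"
  obtains f where "f \<in> continuous_dual" "\<And>u. u \<in> U \<Longrightarrow> f u < f x"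
proof -
  obtain u0 where u0: "u0 \<in> U" using assms by auto
  define W where "W = {y. u0 + 1 *\<^sub>R y \<in> U}"
  have W_eq: "W = (+) (- u0) ` U"
  proof -
    have "y \<in> (+) (- u0) ` U" if "u0 + y \<in> U" for y
      using that by (intro image_eqI[of _ _ "u0 + y"]) auto
    then show ?thesis by (auto simp: W_def)
  qed
  have W: "open W" "convex W" "0 \<in> W"
    using open_translation_lcs[OF assms(1), of u0 1] u0 convex_translation[OF assms(2), of "- u0"]
    unfolding W_eq[symmetric] by (auto simp: W_def)
  obtain f where f: "linear f" "\<And>y. f y \<le> gauge_fun W y" "f (x - u0) = gauge_fun W (x - u0)"
    by (rule hahn_banach_sublinear[OF gauge_fun_sublinear[OF W], of "x - u0"], rule that)
  have "f y \<le> 1" if "y \<in> W" for y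
    using f(2)[of y] gauge_fun_less_1[OF W that] by simp
  then have "f \<in> continuous_dual"
    unfolding continuous_dual_def using f(1) continuous_linear_if_bounded_above[OF W f(1)] by auto
  moreover have "f u < f x" if "u \<in> U" for u
  proof -
    have "f (u - u0) < 1"
      using f(2)[of "u - u0"] gauge_fun_less_1[OF W, of "u - u0"] that by (simp add: W_def)
    moreover have "1 \<le> f (x - u0)"
      using f(3) gauge_fun_ge_1[OF W, of "x - u0"] assms(4) by (simp add: W_def)
    ultimately show ?thesis by (simp add: linear_diff[OF f(1)])
  qed
  ultimately show thesis by (rule that)
qed

text \<open>Thickening \<open>S\<close> by a convex open \<open>V\<close> reduces this to the open
  case. \<open>V\<close> is chosen so that \<open>x - v\<close> is never in \<open>S\<close>, which
  says that \<open>x\<close> is outside \<open>S + V\<close>.\<close>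

lemma separate_closed_convex_point:
  fixes S :: "'a::locally_convex_t2_space set"
  assumes S: "closed S" "convex S" "S \<noteq> {}" "x \<notin> S"
  obtains f where "f \<in> continuous_dual" "\<And>s. s \<in> S \<Longrightarrow> f s < f x"
proof -
  have "open {y. x + (- 1) *\<^sub>R y \<in> - S}"
    using S by (intro open_translation_lcs) auto
  moreover have "0 \<in> {y. x + (- 1) *\<^sub>R y \<in> - S}" using S by simp
  ultimately obtain V where V: "open V" "0 \<in> V" "convex V" "V \<subseteq> {y. x + (- 1) *\<^sub>R y \<in> - S}"
    using locally_convex_at_0_convex by metis
  define U where "U = (\<Union>s\<in>S. \<Union>v\<in>V. {s + v})"
  have "U = (\<Union>s\<in>S. {y. - s + 1 *\<^sub>R y \<in> V})"
  proof -
    have "\<exists>v\<in>V. y = s + v" if "- s + y \<in> V" for s y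
      using that by (intro bexI[of _ "- s + y"]) auto
    then show ?thesis by (auto simp: U_def)
  qed
  then have "open U" using open_translation_lcs[OF V(1)] by (simp only:) (intro open_UN ballI)
  moreover have "convex U" unfolding U_def by (rule convex_sums[OF S(2) V(3)])
  moreover have "S \<subseteq> U" unfolding U_def using V(2) by force
  moreover have "x \<notin> U" using V(4) by (fastforce simp: U_def)
  ultimately show thesis using separate_open_convex_point[of U x] S(3) that by (metis subset_empty subsetD)
qed

lemma separate_points:
  fixes x y :: "'a::locally_convex_t2_space"
  assumes "x \<noteq> y"
  obtains f where "f \<in> continuous_dual" "f y < f x"
proof -
  obtain f where "f \<in> continuous_dual" "\<And>s. s \<in> {y} \<Longrightarrow> f s < f x"
    by (rule separate_closed_convex_point[of "{y}" x], use assms in simp_all)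
  then show thesis using that by blast
qed

lemma continuous_dual_inject:
  fixes x y :: "'a::locally_convex_t2_space"
  assumes "\<And>f. f \<in> continuous_dual \<Longrightarrow> f x = f y"
  shows "x = y"
proof (rule ccontr)
  assume "x \<noteq> y"
  then obtain f where "f \<in> continuous_dual" "f y < f x" by (rule separate_points)
  then show False using assms[of f] by simp
qed

section \<open>Closed faces and extreme points\<close>

lemma exposed_face:
  fixes f :: "'a::real_vector \<Rightarrow> real"
  assumes f: "linear f" and K: "convex K" and le: "\<And>x. x \<in> K \<Longrightarrow> f x \<le> m"
  shows "{x\<in>K. f x = m} face_of K"
proof -
  have "convex {x\<in>K. f x = m}"
  proof (rule convexI)
    fix x y and u v :: real
    assume *: "x \<in> {x\<in>K. f x = m}" "y \<in> {x\<in>K. f x = m}" "0 \<le> u" "0 \<le> v" "u + v = 1"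
    then have "u * m + v * m = m" by (metis distrib_right mult_1)
    then show "u *\<^sub>R x + v *\<^sub>R y \<in> {x\<in>K. f x = m}"
      using * K by (auto intro: convexD simp: linear_add[OF f] linear_scale[OF f])
  qed
  moreover have "a \<in> {x\<in>K. f x = m} \<and> b \<in> {x\<in>K. f x = m}"
    if ab: "a \<in> K" "b \<in> K" and x: "x \<in> K" "f x = m" "x \<in> open_segment a b" for a b x
  proof -
    obtain u where u: "0 < u" "u < 1" "x = (1 - u) *\<^sub>R a + u *\<^sub>R b"
      using x(3) by (auto simp: in_segment)
    \<comment> \<open>A sum of two nonnegative terms with positive weights is 0, so each end of the
      segment also attains \<open>m\<close>.\<close>
    then have eq: "(1 - u) * (m - f a) + u * (m - f b) = 0"
      using x(2) unfolding u(3) linear_add[OF f] linear_scale[OF f] by (simp add: algebra_simps)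
    have "0 \<le> (1 - u) * (m - f a)" "0 \<le> u * (m - f b)"
      using u le ab by simp_all
    then have "(1 - u) * (m - f a) = 0" "u * (m - f b) = 0" using eq by linarith+
    then show ?thesis using u ab by simp
  qed
  ultimately show ?thesis unfolding face_of_def by blast
qed

text \<open>A minimal closed face is a single point: two of its points would be separated by a
  continuous form, whose maximum over the face is attained on a strictly smaller closed
  face.\<close>

lemma closed_face_extreme_point:
  fixes K :: "'a::locally_convex_t2_space set"
  assumes K: "compact K" and F0: "F0 face_of K" "closed F0" "F0 \<noteq> {}"
  obtains e where "e \<in> F0" "e \<in> Ext K"
proof -
  let ?A = "{F. F face_of K \<and> closed F \<and> F \<noteq> {} \<and> F \<subseteq> F0}"
  have "\<exists>m\<in>?A. \<forall>a\<in>?A. a \<subseteq> m \<longrightarrow> a = m"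
  proof (rule predicate_Zorn)
    show "partial_order_on ?A (relation_of (\<lambda>m a. a \<subseteq> m) ?A)"
      by (rule partial_order_on_relation_ofI) auto
  next
    fix \<C> assume ch: "\<C> \<in> Chains (relation_of (\<lambda>m a. a \<subseteq> m) ?A)"
    show "\<exists>u\<in>?A. \<forall>a\<in>\<C>. u \<subseteq> a"
    proof (cases "\<C> = {}")
      case True then show ?thesis using F0 by auto
    next
      case False
      have mem: "F \<in> ?A" if "F \<in> \<C>" for F
        using ch that by (auto simp: Chains_def relation_of_def)
      have tot: "F \<subseteq> G \<or> G \<subseteq> F" if "F \<in> \<C>" "G \<in> \<C>" for F G
        using ch that by (auto simp: Chains_def relation_of_def)
      have min: "\<exists>F\<in>\<C>. \<forall>G\<in>\<D>. F \<subseteq> G" if "finite \<D>" "\<D> \<subseteq> \<C>" for \<D>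
        using that
      proof (induction)
        case empty then show ?case using False by auto
      next
        case (insert G \<D>)
        then obtain F where "F \<in> \<C>" "\<forall>G\<in>\<D>. F \<subseteq> G" by auto
        moreover have "F \<subseteq> G \<or> G \<subseteq> F" using tot \<open>F \<in> \<C>\<close> insert.prems by blast
        ultimately show ?case using insert.prems by (metis insert_iff insert_subset order_refl order_trans)
      qed
      \<comment> \<open>A finite part of a chain has a smallest member, which is a nonempty subset
        of \<open>K\<close>; compactness passes to the whole chain.\<close>
      have "K \<inter> \<Inter>\<C> \<noteq> {}"
      proof (rule compact_imp_fip[OF K])
        fix \<D> assume D: "finite \<D>" "\<D> \<subseteq> \<C>"
        obtain F where F: "F \<in> \<C>" "\<forall>G\<in>\<D>. F \<subseteq> G" using min[OF D] by blast
        then have "F \<subseteq> K \<inter> \<Inter>\<D>" "F \<noteq> {}" using mem[OF F(1)] face_of_imp_subset by auto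
        then show "K \<inter> \<Inter>\<D> \<noteq> {}" by blast
      qed (use mem in auto)
      moreover have "\<Inter>\<C> face_of K" using False mem by (intro face_of_Inter) auto
      moreover have "closed (\<Inter>\<C>)" using mem by auto
      ultimately have "\<Inter>\<C> \<in> ?A" using False mem by auto
      then show ?thesis by (rule bexI[rotated]) auto
    qed
  qed
  then obtain m where m: "m face_of K" "closed m" "m \<noteq> {}" "m \<subseteq> F0"
    and min': "\<forall>a\<in>?A. a \<subseteq> m \<longrightarrow> a = m"
    by blast
  have min: "a = m" if "a face_of K" "closed a" "a \<noteq> {}" "a \<subseteq> m" for a
    using min' m(4) that by blast
  have cm: "compact m" using m K closed_Int_compact[of m K] face_of_imp_subset[of m K] by (simp add: inf_absorb1)
  obtain e where e: "e \<in> m" using m by auto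
  have "m = {e}"
  proof (rule ccontr)
    assume "m \<noteq> {e}"
    then obtain y where y: "y \<in> m" "e \<noteq> y" using e by auto
    then obtain f where f: "f \<in> continuous_dual" "f y < f e" using separate_points by metis
    note lin = continuous_dualD(1)[OF f(1)]
    obtain z where z: "z \<in> m" "\<And>x. x \<in> m \<Longrightarrow> f x \<le> f z"
      using continuous_attains_sup[OF cm m(3) continuous_dualD(2)[OF f(1)]] by auto
    let ?n = "{x\<in>m. f x = f z}"
    have "?n face_of m"
      using z face_of_imp_convex[OF m(1)] by (intro exposed_face[OF lin]) auto
    then have "?n face_of K" using m(1) face_of_trans by blast
    moreover have "closed ?n"
    proof -
      have "closed {x. f x = f z}"
        by (intro closed_Collect_eq continuous_dualD(2)[OF f(1)] continuous_on_const)
      then have "closed (m \<inter> {x. f x = f z})" using m(2) by auto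
      then show ?thesis by (simp add: Int_def)
    qed
    ultimately have "?n = m" using z(1) by (intro min) auto
    then show False using y(1) e f(2) by (metis (mono_tags, lifting) less_irrefl mem_Collect_eq)
  qed
  then have "{e} face_of K" using m by simp
  then have "e \<in> Ext K" by (simp add: Ext_def face_of_singleton)
  then show thesis using that e m(4) by blast
qed

text \<open>The form with a closed convex superset suits its uses, where \<open>S\<close> is the set
  of points with some property. A form separating a point of \<open>K\<close> from \<open>S\<close>
  attains its maximum over \<open>K\<close> on a closed face, and an extreme point of that face
  cannot lie in \<open>S\<close>.\<close>

lemma krein_milman_subset:
  fixes K :: "'a::locally_convex_t2_space set"
  assumes K: "compact K" "convex K" and S: "closed S" "convex S" "Ext K \<subseteq> S"
  shows "K \<subseteq> S"
proof
  fix x assume x: "x \<in> K"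
  show "x \<in> S"
  proof (rule ccontr)
    assume xS: "x \<notin> S"
    have "K face_of K" using K(2) by (simp add: face_of_refl)
    then obtain e where "e \<in> Ext K"
      using closed_face_extreme_point[OF K(1), of K] x compact_imp_closed[OF K(1)] by blast
    then have "S \<noteq> {}" using S(3) by auto
    then obtain f where f: "f \<in> continuous_dual" "\<And>s. s \<in> S \<Longrightarrow> f s < f x"
      using separate_closed_convex_point[OF S(1,2) _ xS] by blast
    have "K \<noteq> {}" using x by auto
    then obtain z where z: "z \<in> K" "\<And>x. x \<in> K \<Longrightarrow> f x \<le> f z"
      using continuous_attains_sup[OF K(1) _ continuous_dualD(2)[OF f(1)]] by metis
    let ?n = "{x\<in>K. f x = f z}"
    have "?n face_of K" using z K by (intro exposed_face continuous_dualD(1)[OF f(1)]) auto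
    moreover have "closed ?n"
    proof -
      have "closed {x. f x = f z}"
        by (intro closed_Collect_eq continuous_dualD(2)[OF f(1)] continuous_on_const)
      then have "closed (K \<inter> {x. f x = f z})" using compact_imp_closed[OF K(1)] by auto
      then show ?thesis by (simp add: Int_def)
    qed
    ultimately obtain e where "e \<in> ?n" "e \<in> Ext K"
      using closed_face_extreme_point[OF K(1), of ?n] z(1) by blast
    then show False using f(2)[of e] S(3) z(2)[OF x] by auto
  qed
qed

section \<open>States and the Riesz representation theorem\<close>

text \<open>The value 0 outside \<open>C(Z)\<close> keeps the states inside a product of compact intervals, so
  that they are compact for the product topology by Tychonoff's theorem.\<close>

definition states :: "'a::topological_space set \<Rightarrow> (('a \<Rightarrow> real) \<Rightarrow> real) set" where
  "states Z = {\<phi>. (\<forall>h. \<not> continuous_on Z h \<longrightarrow> \<phi> h = 0)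
     \<and> (\<forall>g h. continuous_on Z g \<longrightarrow> continuous_on Z h \<longrightarrow> \<phi> (\<lambda>z. g z + h z) = \<phi> g + \<phi> h)
     \<and> (\<forall>a h. continuous_on Z h \<longrightarrow> \<phi> (\<lambda>z. a * h z) = a * \<phi> h)
     \<and> (\<forall>h. continuous_on Z h \<longrightarrow> (\<forall>z\<in>Z. 0 \<le> h z) \<longrightarrow> 0 \<le> \<phi> h)
     \<and> \<phi> (\<lambda>_. 1) = 1}"

lemma statesI:
  assumes "\<And>h. \<not> continuous_on Z h \<Longrightarrow> \<phi> h = 0"
    and "\<And>g h. continuous_on Z g \<Longrightarrow> continuous_on Z h \<Longrightarrow> \<phi> (\<lambda>z. g z + h z) = \<phi> g + \<phi> h"
    and "\<And>a h. continuous_on Z h \<Longrightarrow> \<phi> (\<lambda>z. a * h z) = a * \<phi> h"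
    and "\<And>h. continuous_on Z h \<Longrightarrow> (\<And>z. z \<in> Z \<Longrightarrow> 0 \<le> h z) \<Longrightarrow> 0 \<le> \<phi> h"
    and "\<phi> (\<lambda>_. 1) = 1"
  shows "\<phi> \<in> states Z"
  using assms by (auto simp: states_def)

context
  fixes Z :: "'a::topological_space set" and \<phi>
  assumes phi: "\<phi> \<in> states Z"
begin

lemma state_off: "\<not> continuous_on Z h \<Longrightarrow> \<phi> h = 0"
  and state_add: "continuous_on Z g \<Longrightarrow> continuous_on Z h \<Longrightarrow> \<phi> (\<lambda>z. g z + h z) = \<phi> g + \<phi> h"
  and state_scale: "continuous_on Z h \<Longrightarrow> \<phi> (\<lambda>z. a * h z) = a * \<phi> h"
  and state_nonneg: "continuous_on Z h \<Longrightarrow> (\<And>z. z \<in> Z \<Longrightarrow> 0 \<le> h z) \<Longrightarrow> 0 \<le> \<phi> h"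
  and state_one: "\<phi> (\<lambda>_. 1) = 1"
  using phi by (auto simp: states_def)

lemma state_const: "\<phi> (\<lambda>_. c) = c"
  using state_scale[of "\<lambda>_. 1" c] state_one by simp

lemma state_diff:
  assumes "continuous_on Z g" "continuous_on Z h"
  shows "\<phi> (\<lambda>z. g z - h z) = \<phi> g - \<phi> h"
proof -
  have "\<phi> (\<lambda>z. g z + (- 1) * h z) = \<phi> g + \<phi> (\<lambda>z. (- 1) * h z)"
    using assms by (intro state_add continuous_intros)
  also have "\<phi> (\<lambda>z. (- 1) * h z) = - \<phi> h" using assms(2) by (subst state_scale) auto
  finally show ?thesis by simp
qed

lemma state_mono:
  assumes "continuous_on Z g" "continuous_on Z h" "\<And>z. z \<in> Z \<Longrightarrow> g z \<le> h z"
  shows "\<phi> g \<le> \<phi> h"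
  using state_nonneg[of "\<lambda>z. h z - g z"] state_diff[of h g] assms
  by (auto intro: continuous_intros)

lemma state_cong:
  assumes "continuous_on Z g" "continuous_on Z h" "\<And>z. z \<in> Z \<Longrightarrow> g z = h z"
  shows "\<phi> g = \<phi> h"
  using state_mono[of g h] state_mono[of h g] assms by fastforce

lemma state_sum:
  assumes "\<And>i. i \<in> I \<Longrightarrow> continuous_on Z (g i)"
  shows "\<phi> (\<lambda>z. \<Sum>i\<in>I. g i z) = (\<Sum>i\<in>I. \<phi> (g i))"
proof (cases "finite I")
  case True
  then show ?thesis using assms
    by (induction I) (simp_all add: state_const state_add continuous_intros)
next
  case False
  then show ?thesis by (simp add: state_const)
qed

lemma state_abs_le:
  assumes "continuous_on Z h" "\<And>z. z \<in> Z \<Longrightarrow> \<bar>h z\<bar> \<le> B"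
  shows "\<bar>\<phi> h\<bar> \<le> B"
  using state_mono[of h "\<lambda>_. B"] state_mono[of "\<lambda>_. - B" h] assms state_const
  by (fastforce simp: abs_le_iff)

end

lemma compact_bound_real:
  fixes h :: "'a::topological_space \<Rightarrow> real"
  assumes "compact Z" "continuous_on Z h"
  obtains B where "0 < B" "\<And>z. z \<in> Z \<Longrightarrow> \<bar>h z\<bar> \<le> B"
proof -
  have "bounded (h ` Z)" using assms compact_continuous_image compact_imp_bounded by blast
  then obtain B where "B > 0" "\<forall>x\<in>h ` Z. norm x \<le> B" unfolding bounded_pos by blast
  then show thesis using that[of B] by auto
qed

lemma closed_states: "closed (states Z)"
proof -
  have ev: "continuous_on UNIV (\<lambda>\<phi> :: ('a \<Rightarrow> real) \<Rightarrow> real. \<phi> h)" for h by simp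
  \<comment> \<open>The premises of the implications do not involve the functional, so as disjuncts
    they are constant conditions; what remains are equations and inequalities between
    coordinates.\<close>
  show ?thesis unfolding states_def imp_conv_disj
    by (intro closed_Collect_conj closed_Collect_all closed_Collect_disj closed_Collect_const
        closed_Collect_eq closed_Collect_le continuous_intros ev)
qed

lemma compact_states:
  assumes Z: "compact Z"
  shows "compact (states Z)"
proof -
  have "\<exists>B. \<forall>\<phi>\<in>states Z. \<bar>\<phi> h\<bar> \<le> B" for h
  proof (cases "continuous_on Z h")
    case True
    then show ?thesis using compact_bound_real[OF Z True] state_abs_le[OF _ True] by metis
  next
    case False
    then show ?thesis using state_off by (intro exI[of _ 0]) auto
  qed
  then obtain B where B: "\<And>h \<phi>. \<phi> \<in> states Z \<Longrightarrow> \<bar>\<phi> h\<bar> \<le> B h" by metis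
  have "compactin (product_topology (\<lambda>i. euclidean) UNIV) (PiE UNIV (\<lambda>h. {- B h..B h}))"
    unfolding compactin_PiE by auto
  then have "compact (PiE UNIV (\<lambda>h. {- B h..B h}))"
    by (simp add: euclidean_product_topology)
  then have "compact (states Z \<inter> PiE UNIV (\<lambda>h. {- B h..B h}))"
    by (rule closed_Int_compact[OF closed_states])
  also have "states Z \<inter> PiE UNIV (\<lambda>h. {- B h..B h}) = states Z"
    using B by (force simp: abs_le_iff)
  finally show ?thesis .
qed

lemma eval_state:
  assumes "e \<in> Z"
  shows "(\<lambda>h. if continuous_on Z h then h e else 0) \<in> states Z"
proof (rule statesI)
  fix a :: real and h :: "'a \<Rightarrow> real"
  assume "continuous_on Z h"
  then have "continuous_on Z (\<lambda>z. a * h z)" by (intro continuous_intros)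
  then show "(if continuous_on Z (\<lambda>z. a * h z) then a * h e else 0) =
      a * (if continuous_on Z h then h e else 0)"
    using \<open>continuous_on Z h\<close> by simp
qed (use assms in \<open>auto intro: continuous_intros\<close>)

lemma convex_state:
  assumes p: "\<phi> \<in> states Z" and q: "\<psi> \<in> states Z" and uv: "0 \<le> u" "0 \<le> v" "u + v = 1"
  shows "(\<lambda>h. u * \<phi> h + v * \<psi> h) \<in> states Z"
  by (rule statesI)
    (use uv in \<open>simp_all add: state_off[OF p] state_off[OF q] state_add[OF p] state_add[OF q]
      state_scale[OF p] state_scale[OF q] state_nonneg[OF p] state_nonneg[OF q]
      state_one[OF p] state_one[OF q] algebra_simps\<close>)

text \<open>The functional counterpart of the normalized measure with density \<open>w\<close>.
  Through it the members of a partition of unity cut a state into states.\<close>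

lemma conditional_state:
  assumes p: "\<phi> \<in> states Z" and w: "continuous_on Z w" "\<And>z. z \<in> Z \<Longrightarrow> 0 \<le> w z" "0 < \<phi> w"
  shows "(\<lambda>h. if continuous_on Z h then \<phi> (\<lambda>z. w z * h z) / \<phi> w else 0) \<in> states Z" (is "?\<psi> \<in> _")
proof (rule statesI)
  fix g h :: "'a \<Rightarrow> real" assume gh: "continuous_on Z g" "continuous_on Z h"
  have "\<phi> (\<lambda>z. w z * (g z + h z)) = \<phi> (\<lambda>z. w z * g z) + \<phi> (\<lambda>z. w z * h z)"
    using state_add[OF p, of "\<lambda>z. w z * g z" "\<lambda>z. w z * h z"] gh w
    by (simp add: continuous_on_mult distrib_left)
  then show "?\<psi> (\<lambda>z. g z + h z) = ?\<psi> g + ?\<psi> h"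
    using gh by (simp add: continuous_on_add add_divide_distrib)
next
  fix a :: real and h :: "'a \<Rightarrow> real" assume h: "continuous_on Z h"
  have "\<phi> (\<lambda>z. w z * (a * h z)) = a * \<phi> (\<lambda>z. w z * h z)"
    using state_scale[OF p, of "\<lambda>z. w z * h z" a] h w
    by (simp add: continuous_on_mult mult.left_commute)
  moreover have "continuous_on Z (\<lambda>z. a * h z)" using h by (intro continuous_intros)
  ultimately show "?\<psi> (\<lambda>z. a * h z) = a * ?\<psi> h" using h by simp
next
  fix h :: "'a \<Rightarrow> real" assume h: "continuous_on Z h" "\<And>z. z \<in> Z \<Longrightarrow> 0 \<le> h z"
  then show "0 \<le> ?\<psi> h"
    using w by (auto intro!: divide_nonneg_pos state_nonneg[OF p] continuous_intros)
qed (use w(3) in auto)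

section \<open>Integrals as states\<close>

lemma integrable_continuous_compact:
  fixes h :: "'a::t2_space \<Rightarrow> real"
  assumes M: "prob_space M" "sets M = sets (restrict_space borel Z)"
    and Z: "compact Z" and h: "continuous_on Z h"
  shows "integrable M h"
proof -
  interpret prob_space M by fact
  have sp: "space M = Z" using sets_eq_imp_space_eq[OF M(2)] by (simp add: space_restrict_space)
  have "h \<in> borel_measurable M"
    using borel_measurable_continuous_on_restrict[OF h] by (simp add: measurable_cong_sets[OF M(2) refl])
  moreover obtain B where "\<And>z. z \<in> Z \<Longrightarrow> \<bar>h z\<bar> \<le> B" using compact_bound_real[OF Z h] by metis
  ultimately show ?thesis by (intro integrable_const_bound[of _ B]) (auto simp: sp)
qed

lemma integral_state:
  fixes Z :: "'a::t2_space set"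
  assumes M: "prob_space M" "sets M = sets (restrict_space borel Z)" and Z: "compact Z"
  shows "(\<lambda>h. if continuous_on Z h then \<integral>z. h z \<partial>M else 0) \<in> states Z" (is "?\<psi> \<in> _")
proof (rule statesI)
  interpret prob_space M by fact
  have sp: "space M = Z" using sets_eq_imp_space_eq[OF M(2)] by (simp add: space_restrict_space)
  note int = integrable_continuous_compact[OF M Z]
  fix g h :: "'a \<Rightarrow> real" assume gh: "continuous_on Z g" "continuous_on Z h"
  then show "?\<psi> (\<lambda>z. g z + h z) = ?\<psi> g + ?\<psi> h"
    by (simp add: continuous_on_add int)
  fix a :: real
  have "continuous_on Z (\<lambda>z. a * h z)" using gh by (intro continuous_intros)
  then show "?\<psi> (\<lambda>z. a * h z) = a * ?\<psi> h" using gh by simp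
  assume "\<And>z. z \<in> Z \<Longrightarrow> 0 \<le> h z"
  then show "0 \<le> ?\<psi> h" using gh by (auto simp: sp intro!: Bochner_Integration.integral_nonneg)
next
  interpret prob_space M by fact
  show "?\<psi> (\<lambda>_. 1) = 1" by (simp add: prob_space)
qed simp

text \<open>A compact metrizable space has this property, and it is all that the construction of
  measures and of partitions of unity needs.\<close>

definition cozero_space :: "'a::topological_space set \<Rightarrow> bool" where
  "cozero_space Z \<longleftrightarrow> (\<forall>U. open U \<longrightarrow>
     (\<exists>u::'a \<Rightarrow> real. continuous_on Z u \<and> (\<forall>z\<in>Z. 0 \<le> u z) \<and> (\<forall>z\<in>Z. z \<in> U \<longleftrightarrow> 0 < u z)))"

definition function_covers :: "'a::topological_space set \<Rightarrow> 'a set \<Rightarrow> (nat \<Rightarrow> 'a \<Rightarrow> real) set" where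
  "function_covers Z A = {g. (\<forall>n. continuous_on Z (g n) \<and> (\<forall>z\<in>Z. 0 \<le> g n z)) \<and>
     (\<forall>z\<in>A. 1 \<le> (\<Sum>n. ennreal (g n z)))}"

text \<open>Covering by sequences of functions, instead of by open sets, makes countable
  subadditivity immediate.\<close>

definition state_outer ::
  "'a::topological_space set \<Rightarrow> (('a \<Rightarrow> real) \<Rightarrow> real) \<Rightarrow> 'a set \<Rightarrow> ennreal" where
  "state_outer Z \<phi> A = (INF g\<in>function_covers Z A. \<Sum>n. ennreal (\<phi> (g n)))"

section \<open>The outer measure of a state\<close>

lemma suminf_ennreal_single:
  "(\<Sum>n. ennreal (if n = 0 then c else 0)) = ennreal c"
proof -
  have "(\<lambda>n. ennreal (if n = 0 then c else 0)) sums ennreal c"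
    using sums_single[of 0 "\<lambda>_. ennreal c"] by (simp add: if_distrib cong: if_cong)
  then show ?thesis by (simp add: sums_iff)
qed

text \<open>A sum equal to 1 may be reached only in the limit; a level below 1 is already exceeded
  by a finite sum.\<close>

lemma partial_sum_gt:
  assumes "1 \<le> (\<Sum>n. ennreal (a n))" "\<And>n. 0 \<le> a n" "c < 1"
  shows "\<exists>N. c < (\<Sum>n<N. a n)"
proof -
  have "ennreal c < (\<Sum>n. ennreal (a n))"
    using assms(1,3) by (metis ennreal_1 ennreal_lessI order_less_le_trans zero_less_one)
  also have "(\<Sum>n. ennreal (a n)) = (SUP N. \<Sum>n<N. ennreal (a n))"
    by (rule suminf_eq_SUP)
  finally obtain N where "ennreal c < (\<Sum>n<N. ennreal (a n))" by (auto simp: less_SUP_iff)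
  then have "ennreal c < ennreal (\<Sum>n<N. a n)" using assms(2) by (simp add: sum_ennreal)
  then have "c < (\<Sum>n<N. a n)" by (meson ennreal_leI not_le)
  then show ?thesis ..
qed

text \<open>Continuity on \<open>Z\<close> yields relatively open sets; \<open>B N\<close> is an
  ambient open set with the same trace, fit for open covers and for outer regularity.\<close>

lemma open_partial_sums:
  fixes g :: "nat \<Rightarrow> 'a::topological_space \<Rightarrow> real"
  assumes "\<And>n. continuous_on Z (g n)"
  obtains B where "\<And>N. open (B N)" "\<And>N z. z \<in> Z \<Longrightarrow> z \<in> B N \<longleftrightarrow> c < (\<Sum>n<N. g n z)"
proof -
  have "\<exists>B. open B \<and> B \<inter> Z = (\<lambda>z. \<Sum>n<N. g n z) -` {c<..} \<inter> Z" for N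
  proof -
    have "continuous_on Z (\<lambda>z. \<Sum>n<N. g n z)" using assms by (intro continuous_intros)
    then show ?thesis unfolding continuous_on_open_invariant by simp
  qed
  then obtain B where "\<And>N. open (B N)" "\<And>N. B N \<inter> Z = (\<lambda>z. \<Sum>n<N. g n z) -` {c<..} \<inter> Z" by metis
  then show thesis by (intro that[of B]) auto
qed

context
  fixes Z :: "'a::t2_space set" and \<phi>
  assumes phi: "\<phi> \<in> states Z" and Z: "compact Z" and coz: "cozero_space Z"
begin

lemma state_outer_le: "g \<in> function_covers Z A \<Longrightarrow> state_outer Z \<phi> A \<le> (\<Sum>n. ennreal (\<phi> (g n)))"
  unfolding state_outer_def by (rule INF_lower)

lemma state_outer_le_single:
  assumes "continuous_on Z h" "\<And>z. z \<in> Z \<Longrightarrow> 0 \<le> h z" "\<And>z. z \<in> A \<Longrightarrow> 1 \<le> h z"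
  shows "state_outer Z \<phi> A \<le> ennreal (\<phi> h)"
proof -
  let ?g = "\<lambda>n::nat. if n = 0 then h else (\<lambda>_. 0)"
  have "(\<Sum>n. ennreal (?g n z)) = ennreal (h z)" for z
    using suminf_ennreal_single[of "h z"] by (simp add: if_distrib if_distribR cong: if_cong)
  moreover have "(\<Sum>n. ennreal (\<phi> (?g n))) = ennreal (\<phi> h)"
    using suminf_ennreal_single[of "\<phi> h"] by (simp add: if_distrib state_const[OF phi] cong: if_cong)
  ultimately show ?thesis
    using assms by (intro state_outer_le[of ?g A, THEN order_trans]) (auto simp: function_covers_def)
qed

lemma state_outer_le_1: "state_outer Z \<phi> A \<le> 1"
  using state_outer_le_single[of "\<lambda>_. 1" A] by (simp add: state_one[OF phi])

lemma state_outer_approx: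
  assumes "0 < e"
  obtains g where "g \<in> function_covers Z A" "(\<Sum>n. ennreal (\<phi> (g n))) \<le> state_outer Z \<phi> A + ennreal e"
proof -
  have "state_outer Z \<phi> A < \<top>" using state_outer_le_1[of A] by (simp add: order_le_less_trans)
  then have "state_outer Z \<phi> A < state_outer Z \<phi> A + ennreal e"
    using assms by (simp add: ennreal_add_left_cancel_less)
  then show thesis using that unfolding state_outer_def INF_less_iff by (metis order_less_imp_le)
qed

lemma function_covers_nonneg: "g \<in> function_covers Z A \<Longrightarrow> 0 \<le> \<phi> (g n)"
  by (auto simp: function_covers_def intro: state_nonneg[OF phi])

lemma outer_measure_space_state_outer: "outer_measure_space (Pow Z) (state_outer Z \<phi>)"
  unfolding outer_measure_space_def
proof (intro conjI)
  have "state_outer Z \<phi> {} \<le> ennreal (\<phi> (\<lambda>_. 0))" by (rule state_outer_le_single) auto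
  then show "positive (Pow Z) (state_outer Z \<phi>)"
    by (simp add: positive_def state_const[OF phi])
  show "increasing (Pow Z) (state_outer Z \<phi>)"
    unfolding increasing_def state_outer_def function_covers_def
    by (auto intro!: INF_superset_mono)
  show "countably_subadditive (Pow Z) (state_outer Z \<phi>)"
    unfolding countably_subadditive_def
  proof (intro allI impI)
    fix A :: "nat \<Rightarrow> 'a set"
    show "state_outer Z \<phi> (\<Union>i. A i) \<le> (\<Sum>i. state_outer Z \<phi> (A i))"
    proof (rule ennreal_le_epsilon)
      fix e :: real assume e: "0 < e"
      \<comment> \<open>The tolerances \<open>e * (1/2) ^ Suc i\<close> add up to \<open>e\<close>;
        the resulting double sequence of functions is then enumerated as a single cover by
        \<open>prod_decode\<close>.\<close>
      have "\<exists>g. g \<in> function_covers Z (A i) \<and>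
          (\<Sum>n. ennreal (\<phi> (g n))) \<le> state_outer Z \<phi> (A i) + ennreal (e * (1/2) ^ Suc i)" for i
        using state_outer_approx[of "e * (1/2) ^ Suc i" "A i"] e by auto
      then obtain g where g: "\<And>i. g i \<in> function_covers Z (A i)"
        and gle: "\<And>i. (\<Sum>n. ennreal (\<phi> (g i n))) \<le> state_outer Z \<phi> (A i) + ennreal (e * (1/2) ^ Suc i)"
        by metis
      define h where "h k = g (fst (prod_decode k)) (snd (prod_decode k))" for k
      have sum_h: "(\<Sum>k. ennreal (F (h k))) = (\<Sum>i. \<Sum>n. ennreal (F (g i n)))" for F :: "('a \<Rightarrow> real) \<Rightarrow> real"
        using suminf_ennreal_2dimen[of "\<lambda>i. \<Sum>n. ennreal (F (g i n))" "\<lambda>p. ennreal (F (g (fst p) (snd p)))"]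
        by (simp add: h_def)
      have "h \<in> function_covers Z (\<Union>i. A i)"
        unfolding function_covers_def
      proof (safe)
        fix k
        show "continuous_on Z (h k)" "\<And>z. z \<in> Z \<Longrightarrow> 0 \<le> h k z"
          using g by (auto simp: h_def function_covers_def)
      next
        fix z i assume "z \<in> A i"
        then have "1 \<le> (\<Sum>n. ennreal (g i n z))" using g by (auto simp: function_covers_def)
        also have "\<dots> = (\<Sum>i\<in>{i}. \<Sum>n. ennreal (g i n z))" by simp
        also have "\<dots> \<le> (\<Sum>i. \<Sum>n. ennreal (g i n z))" by (intro sum_le_suminf) auto
        also have "\<dots> = (\<Sum>k. ennreal (h k z))" using sum_h[of "\<lambda>f. f z"] by simp
        finally show "1 \<le> (\<Sum>k. ennreal (h k z))" .
      qed
      then have "state_outer Z \<phi> (\<Union>i. A i) \<le> (\<Sum>k. ennreal (\<phi> (h k)))" by (rule state_outer_le)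
      also have "\<dots> = (\<Sum>i. \<Sum>n. ennreal (\<phi> (g i n)))" by (rule sum_h)
      also have "\<dots> \<le> (\<Sum>i. state_outer Z \<phi> (A i) + ennreal (e * (1/2) ^ Suc i))"
        by (intro suminf_le gle) auto
      also have "\<dots> = (\<Sum>i. state_outer Z \<phi> (A i)) + (\<Sum>i. ennreal (e * (1/2) ^ Suc i))"
        by (intro suminf_add[symmetric]) auto
      also have "(\<Sum>i. ennreal (e * (1/2) ^ Suc i)) = ennreal e"
      proof (rule suminf_ennreal_eq)
        show "(\<lambda>i. e * (1/2) ^ Suc i) sums e"
          using sums_mult[OF power_half_series, of e] by simp
      qed (use e in auto)
      finally show "state_outer Z \<phi> (\<Union>i. A i) \<le> (\<Sum>i. state_outer Z \<phi> (A i)) + ennreal e" .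
    qed
  qed
qed

text \<open>The inequality of Caratheodory for an open set. A nearly optimal cover \<open>g\<close>
  is divided by the cutoffs \<open>v k\<close>, which increase to the indicator of \<open>U\<close>
  on \<open>Z\<close>. The functions \<open>g n * (1 - v k)\<close> cover the part outside
  \<open>U\<close>, where \<open>v k\<close> vanishes. Inside \<open>U\<close> the functions
  \<open>g n * v k\<close> reach only the value \<open>v k\<close>; the missing
  \<open>1 - v k\<close> is supplied by the telescoping increments of the later cutoffs, and these
  have small total mass when \<open>k\<close> is large.\<close>

lemma state_outer_split:
  assumes U: "open U"
  shows "state_outer Z \<phi> (Z \<inter> A \<inter> U) + state_outer Z \<phi> (Z \<inter> A - U) \<le> state_outer Z \<phi> (Z \<inter> A)"
proof (rule ennreal_le_epsilon)
  fix e :: real assume e: "0 < e"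
  obtain u :: "'a \<Rightarrow> real" where u: "continuous_on Z u" "\<And>z. z \<in> Z \<Longrightarrow> 0 \<le> u z"
    and uU: "\<And>z. z \<in> Z \<Longrightarrow> z \<in> U \<longleftrightarrow> 0 < u z"
    using coz U unfolding cozero_space_def by metis
  define v where "v k z = min 1 (real k * u z)" for k z
  have vc: "continuous_on Z (v k)" for k unfolding v_def by (intro continuous_intros u)
  have v01: "0 \<le> v k z" "v k z \<le> 1" if "z \<in> Z" for k z using u(2)[OF that] by (auto simp: v_def)
  have vmono: "v k z \<le> v l z" if "z \<in> Z" "k \<le> l" for k l z
    using u(2)[OF that(1)] that(2) mult_right_mono[of "real k" "real l" "u z"] by (auto simp: v_def)
  define c where "c k = \<phi> (v k)" for k
  have cmono: "c k \<le> c l" if "k \<le> l" for k l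
    unfolding c_def by (intro state_mono[OF phi] vc vmono that)
  have c1: "c k \<le> 1" for k
    unfolding c_def using state_mono[OF phi vc, of "\<lambda>_. 1"] v01 by (simp add: state_one[OF phi])
  \<comment> \<open>The masses \<open>c k\<close> increase and are bounded by 1, so past an index
    where they are within \<open>e / 2\<close> of their supremum all further increments together
    cost at most \<open>e / 2\<close>.\<close>
  obtain k where k: "\<And>n. c (k + n) - c k \<le> e / 2"
  proof -
    have bdd: "bdd_above (range c)" using c1 by (intro bdd_aboveI2)
    obtain k where "Sup (range c) - e / 2 < c k"
      using less_cSup_iff[OF _ bdd, of "Sup (range c) - e / 2"] e by auto
    moreover have "c (k + n) \<le> Sup (range c)" for n by (intro cSup_upper bdd) auto
    ultimately show thesis by (intro that[of k]) (smt (verit))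
  qed
  obtain g where g: "g \<in> function_covers Z (Z \<inter> A)"
    and gle: "(\<Sum>n. ennreal (\<phi> (g n))) \<le> state_outer Z \<phi> (Z \<inter> A) + ennreal (e / 2)"
    using state_outer_approx[of "e / 2"] e by auto
  have gc: "continuous_on Z (g n)" and g0: "z \<in> Z \<Longrightarrow> 0 \<le> g n z" for n z
    using g by (auto simp: function_covers_def)
  have g1: "1 \<le> (\<Sum>n. ennreal (g n z))" if "z \<in> Z" "z \<in> A" for z
    using g that by (auto simp: function_covers_def)
  have "state_outer Z \<phi> (Z \<inter> A - U) \<le> (\<Sum>n. ennreal (\<phi> (\<lambda>z. g n z * (1 - v k z))))"
  proof (rule state_outer_le, unfold function_covers_def, safe)
    fix n
    show "continuous_on Z (\<lambda>z. g n z * (1 - v k z))" by (intro continuous_intros gc vc)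
    show "0 \<le> g n z * (1 - v k z)" if "z \<in> Z" for z using g0[OF that] v01[OF that] by simp
  next
    fix z assume z: "z \<in> Z" "z \<in> A" "z \<notin> U"
    then have "u z = 0" using uU u(2) by fastforce
    then show "1 \<le> (\<Sum>n. ennreal (g n z * (1 - v k z)))" using g1[OF z(1,2)] by (simp add: v_def)
  qed
  moreover have "state_outer Z \<phi> (Z \<inter> A \<inter> U) \<le>
      (\<Sum>n. ennreal (\<phi> (\<lambda>z. g n z * v k z + (v (k + Suc n) z - v (k + n) z))))"
  proof (rule state_outer_le, unfold function_covers_def, safe)
    fix n
    show "continuous_on Z (\<lambda>z. g n z * v k z + (v (k + Suc n) z - v (k + n) z))"
      by (intro continuous_intros gc vc)
    show "0 \<le> g n z * v k z + (v (k + Suc n) z - v (k + n) z)" if "z \<in> Z" for z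
      using g0[OF that] v01[OF that] vmono[OF that, of "k + n" "k + Suc n"] by simp
  next
    fix z assume z: "z \<in> Z" "z \<in> A" "z \<in> U"
    then have uz: "0 < u z" using uU by simp
    obtain m where m: "1 / u z < real m" using reals_Archimedean2 by blast
    have vm: "v (k + m) z = 1"
    proof -
      have "1 \<le> real m * u z" using m uz by (simp add: field_simps)
      also have "\<dots> \<le> real (k + m) * u z" using uz by (intro mult_right_mono) auto
      finally show ?thesis by (simp add: v_def)
    qed
    have tele: "(\<Sum>n<m. v (k + Suc n) z - v (k + n) z) = v (k + m) z - v k z"
      using sum_lessThan_telescope[of "\<lambda>n. v (k + n) z" m] by simp
    have d0: "0 \<le> v (k + Suc n) z - v (k + n) z" for n using vmono[OF z(1), of "k + n" "k + Suc n"] by simp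
    have "ennreal 1 = ennreal (v k z) + ennreal (\<Sum>n<m. v (k + Suc n) z - v (k + n) z)"
      unfolding tele vm using v01[OF z(1)] by (subst ennreal_plus[symmetric]) auto
    also have "\<dots> \<le> ennreal (v k z) * (\<Sum>n. ennreal (g n z)) + (\<Sum>n. ennreal (v (k + Suc n) z - v (k + n) z))"
    proof (rule add_mono)
      show "ennreal (v k z) \<le> ennreal (v k z) * (\<Sum>n. ennreal (g n z))"
        using mult_left_mono[OF g1[OF z(1,2)], of "ennreal (v k z)"] by simp
      show "ennreal (\<Sum>n<m. v (k + Suc n) z - v (k + n) z) \<le> (\<Sum>n. ennreal (v (k + Suc n) z - v (k + n) z))"
        using sum_le_suminf[of "\<lambda>n. ennreal (v (k + Suc n) z - v (k + n) z)" "{..<m}"] d0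
        by (simp add: sum_ennreal)
    qed
    also have "\<dots> = (\<Sum>n. ennreal (g n z * v k z)) + (\<Sum>n. ennreal (v (k + Suc n) z - v (k + n) z))"
      using v01[OF z(1)] g0[OF z(1)]
      by (simp add: ennreal_suminf_cmult[symmetric] ennreal_mult[symmetric] mult.commute del: ennreal_suminf_cmult)
    also have "\<dots> = (\<Sum>n. ennreal (g n z * v k z) + ennreal (v (k + Suc n) z - v (k + n) z))"
      by (intro suminf_add) auto
    also have "\<dots> = (\<Sum>n. ennreal (g n z * v k z + (v (k + Suc n) z - v (k + n) z)))"
      using d0 v01[OF z(1)] g0[OF z(1)] by (intro suminf_cong) (simp add: ennreal_plus)
    finally show "1 \<le> (\<Sum>n. ennreal (g n z * v k z + (v (k + Suc n) z - v (k + n) z)))" by simp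
  qed
  ultimately have "state_outer Z \<phi> (Z \<inter> A \<inter> U) + state_outer Z \<phi> (Z \<inter> A - U) \<le>
      (\<Sum>n. ennreal (\<phi> (\<lambda>z. g n z * v k z + (v (k + Suc n) z - v (k + n) z)))) +
      (\<Sum>n. ennreal (\<phi> (\<lambda>z. g n z * (1 - v k z))))"
    by (rule add_mono[rotated])
  also have "\<dots> = (\<Sum>n. ennreal (\<phi> (\<lambda>z. g n z * v k z + (v (k + Suc n) z - v (k + n) z))) +
      ennreal (\<phi> (\<lambda>z. g n z * (1 - v k z))))"
    by (intro suminf_add) auto
  also have "\<dots> = (\<Sum>n. ennreal (\<phi> (g n)) + ennreal (c (k + Suc n) - c (k + n)))"
  proof (rule suminf_cong)
    fix n
    let ?a = "\<phi> (\<lambda>z. g n z * v k z)"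
    have eq: "\<phi> (\<lambda>z. g n z * v k z + (v (k + Suc n) z - v (k + n) z)) = ?a + (c (k + Suc n) - c (k + n))"
      unfolding c_def
      by (subst state_add[OF phi] | subst state_diff[OF phi] | intro continuous_intros gc vc refl)+
    have eq': "\<phi> (\<lambda>z. g n z * (1 - v k z)) = \<phi> (g n) - ?a"
      using state_diff[OF phi, of "g n" "\<lambda>z. g n z * v k z"] gc vc
      by (simp add: right_diff_distrib continuous_on_mult)
    have a0: "0 \<le> ?a" by (intro state_nonneg[OF phi] continuous_intros gc vc mult_nonneg_nonneg g0 v01)
    have a1: "?a \<le> \<phi> (g n)"
      by (intro state_mono[OF phi] continuous_intros gc vc) (simp add: mult_left_le g0 v01)
    have cc: "c (k + n) \<le> c (k + Suc n)" by (rule cmono) simp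
    show "ennreal (\<phi> (\<lambda>z. g n z * v k z + (v (k + Suc n) z - v (k + n) z))) +
        ennreal (\<phi> (\<lambda>z. g n z * (1 - v k z))) = ennreal (\<phi> (g n)) + ennreal (c (k + Suc n) - c (k + n))"
      unfolding eq eq' using a0 a1 cc by (simp add: ennreal_plus[symmetric] del: ennreal_plus)
  qed
  also have "\<dots> = (\<Sum>n. ennreal (\<phi> (g n))) + (\<Sum>n. ennreal (c (k + Suc n) - c (k + n)))"
    by (intro suminf_add[symmetric]) auto
  also have "\<dots> \<le> (state_outer Z \<phi> (Z \<inter> A) + ennreal (e / 2)) + ennreal (e / 2)"
  proof (rule add_mono[OF gle])
    have "(\<Sum>n<m. ennreal (c (k + Suc n) - c (k + n))) \<le> ennreal (e / 2)" for m
    proof -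
      have "(\<Sum>n<m. ennreal (c (k + Suc n) - c (k + n))) = ennreal (\<Sum>n<m. c (k + Suc n) - c (k + n))"
        by (rule sum_ennreal) (simp add: cmono)
      also have "(\<Sum>n<m. c (k + Suc n) - c (k + n)) = c (k + m) - c k"
        using sum_lessThan_telescope[of "\<lambda>n. c (k + n)" m] by simp
      finally show ?thesis using k by (simp add: ennreal_leI)
    qed
    then show "(\<Sum>n. ennreal (c (k + Suc n) - c (k + n))) \<le> ennreal (e / 2)"
      by (intro suminf_le_const) auto
  qed
  also have "\<dots> = state_outer Z \<phi> (Z \<inter> A) + ennreal e"
    using e by (simp add: add.assoc ennreal_plus[symmetric] del: ennreal_plus)
  finally show "state_outer Z \<phi> (Z \<inter> A \<inter> U) + state_outer Z \<phi> (Z \<inter> A - U) \<le> state_outer Z \<phi> (Z \<inter> A) + ennreal e" .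
qed

text \<open>For a cover of \<open>Z\<close> and \<open>c < 1\<close>, the open sets where some
  partial sum exceeds \<open>c\<close> cover \<open>Z\<close>. By compactness one partial sum is at
  least \<open>c\<close> on all of \<open>Z\<close>, and positivity of the state gives total mass at
  least \<open>c\<close>.\<close>

lemma state_outer_total: "state_outer Z \<phi> Z = 1"
proof (rule antisym[OF state_outer_le_1])
  show "1 \<le> state_outer Z \<phi> Z"
    unfolding state_outer_def
  proof (rule INF_greatest)
    fix g assume g: "g \<in> function_covers Z Z"
    have gc: "continuous_on Z (g n)" and g0: "z \<in> Z \<Longrightarrow> 0 \<le> g n z" for n z
      using g by (auto simp: function_covers_def)
    have le: "ennreal c \<le> (\<Sum>n. ennreal (\<phi> (g n)))" if c: "c < 1" for c
    proof -
      obtain B where B: "\<And>N. open (B N)" "\<And>N z. z \<in> Z \<Longrightarrow> z \<in> B N \<longleftrightarrow> c < (\<Sum>n<N. g n z)"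
        by (rule open_partial_sums[of Z g c, OF gc], rule that)
      have "Z \<subseteq> (\<Union>N. B N)"
      proof
        fix z assume z: "z \<in> Z"
        then have "1 \<le> (\<Sum>n. ennreal (g n z))" using g by (simp add: function_covers_def)
        then obtain N where "c < (\<Sum>n<N. g n z)"
          using partial_sum_gt[of "\<lambda>n. g n z", OF _ g0[OF z] c] by blast
        then have "z \<in> B N" by (simp add: B(2)[OF z])
        then show "z \<in> (\<Union>N. B N)" by auto
      qed
      then obtain I where I: "finite I" "Z \<subseteq> (\<Union>N\<in>I. B N)"
        using compactE_image[OF Z, of UNIV B] B(1) by auto
      define N where "N = Max (insert 0 I)"
      have "c \<le> (\<Sum>n<N. g n z)" if z: "z \<in> Z" for z
      proof -
        obtain M where M: "M \<in> I" "z \<in> B M" using I z by auto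
        have "c < (\<Sum>n<M. g n z)" using M B(2)[OF z] by simp
        also have "\<dots> \<le> (\<Sum>n<N. g n z)"
          using M I by (intro sum_mono2) (auto simp: N_def g0 z intro: order_less_le_trans Max_ge)
        finally show ?thesis by simp
      qed
      then have "\<phi> (\<lambda>_. c) \<le> \<phi> (\<lambda>z. \<Sum>n<N. g n z)"
        by (intro state_mono[OF phi] continuous_intros gc) auto
      then have "c \<le> (\<Sum>n<N. \<phi> (g n))" by (simp add: state_const[OF phi] state_sum[OF phi] gc)
      then have "ennreal c \<le> (\<Sum>n<N. ennreal (\<phi> (g n)))"
        using function_covers_nonneg[OF g] by (simp add: sum_ennreal ennreal_leI)
      also have "\<dots> \<le> (\<Sum>n. ennreal (\<phi> (g n)))" by (intro sum_le_suminf) auto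
      finally show ?thesis .
    qed
    show "1 \<le> (\<Sum>n. ennreal (\<phi> (g n)))"
    proof (rule ennreal_le_epsilon)
      fix e :: real assume e: "0 < e"
      \<comment> \<open>The maximum with 0 keeps both summands nonnegative, so that
        \<open>ennreal\<close> is additive on them, also for \<open>e > 1\<close>.\<close>
      have "ennreal 1 \<le> ennreal (max 0 (1 - e) + e)" by (rule ennreal_leI) simp
      then have "1 \<le> ennreal (max 0 (1 - e)) + ennreal e"
        using e by (subst (asm) ennreal_plus) auto
      also have "\<dots> \<le> (\<Sum>n. ennreal (\<phi> (g n))) + ennreal e"
        using e by (intro add_mono le) auto
      finally show "1 \<le> (\<Sum>n. ennreal (\<phi> (g n))) + ennreal e" .
    qed
  qed
qed

section \<open>The Radon measure of a state\<close>

definition "state_measure = measure_of Z (sets (restrict_space borel Z)) (state_outer Z \<phi>)"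

text \<open>The traces of open sets are measurable by the splitting inequality, and the measurable
  sets form a sigma-algebra; induction over the generation of the Borel sets does the rest.\<close>

lemma sets_subset_lambda: "sets (restrict_space borel Z) \<subseteq> lambda_system Z (Pow Z) (state_outer Z \<phi>)"
proof -
  interpret sigma_algebra Z "lambda_system Z (Pow Z) (state_outer Z \<phi>)"
    using sigma_algebra.caratheodory_lemma[OF sigma_algebra_Pow outer_measure_space_state_outer]
    by (simp add: measure_space_def)
  have "Z \<inter> B \<in> lambda_system Z (Pow Z) (state_outer Z \<phi>)" if "B \<in> sigma_sets UNIV {S. open S}" for B
    using that
  proof (induction)
    case (Basic U)
    have "state_outer Z \<phi> (x \<inter> (Z \<inter> U)) + state_outer Z \<phi> (x - Z \<inter> U) = state_outer Z \<phi> x" if x: "x \<subseteq> Z" for x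
    proof (rule antisym)
      have *: "Z \<inter> x = x" "x \<inter> (Z \<inter> U) = x \<inter> U" "x - Z \<inter> U = x - U" using x by auto
      show "state_outer Z \<phi> (x \<inter> (Z \<inter> U)) + state_outer Z \<phi> (x - Z \<inter> U) \<le> state_outer Z \<phi> x"
        using state_outer_split[of U x] Basic unfolding * by simp
      have "subadditive (Pow Z) (state_outer Z \<phi>)"
        using outer_measure_space_state_outer ring_of_sets.countably_subadditive_subadditive[OF ring_of_sets_Pow]
        by (auto simp: outer_measure_space_def)
      then have "state_outer Z \<phi> ((x \<inter> U) \<union> (x - U)) \<le> state_outer Z \<phi> (x \<inter> U) + state_outer Z \<phi> (x - U)"
        using x by (intro subadditiveD) auto
      then show "state_outer Z \<phi> x \<le> state_outer Z \<phi> (x \<inter> (Z \<inter> U)) + state_outer Z \<phi> (x - Z \<inter> U)"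
        unfolding * by (simp add: Int_Diff_Un)
    qed
    then show ?case by (simp add: algebra.lambda_system_eq[OF algebra_Pow])
  next
    case Empty
    then show ?case by simp
  next
    case (Compl B)
    have "Z \<inter> (UNIV - B) = Z - Z \<inter> B" by auto
    then show ?case using Compl.IH by auto
  next
    case (Union B)
    have "Z \<inter> (\<Union>i. B i) = (\<Union>i. Z \<inter> B i)" by auto
    moreover have "(\<Union>i. Z \<inter> B i) \<in> lambda_system Z (Pow Z) (state_outer Z \<phi>)"
      using Union.IH by (intro countable_UN) auto
    ultimately show ?case by simp
  qed
  then show ?thesis by (auto simp: sets_restrict_space sets_borel)
qed

lemma sets_state_measure: "sets state_measure = sets (restrict_space borel Z)"
  using sets.space_closed[of "restrict_space borel Z"]
    sets.sigma_sets_eq[of "restrict_space borel Z"]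
  by (simp add: state_measure_def space_restrict_space)

lemma space_state_measure: "space state_measure = Z"
  using sets_eq_imp_space_eq[OF sets_state_measure] by (simp add: space_restrict_space)

lemma emeasure_state_measure:
  assumes "A \<in> sets (restrict_space borel Z)"
  shows "emeasure state_measure A = state_outer Z \<phi> A"
proof (rule emeasure_measure_of[OF state_measure_def])
  have ms: "measure_space Z (lambda_system Z (Pow Z) (state_outer Z \<phi>)) (state_outer Z \<phi>)"
    by (rule sigma_algebra.caratheodory_lemma[OF sigma_algebra_Pow outer_measure_space_state_outer])
  show "sets (restrict_space borel Z) \<subseteq> Pow Z"
    using sets.space_closed[of "restrict_space borel Z"] by (simp add: space_restrict_space)
  show "positive (sets state_measure) (state_outer Z \<phi>)"
    using ms by (simp add: measure_space_def positive_def)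
  show "countably_additive (sets state_measure) (state_outer Z \<phi>)"
    using ms sets_subset_lambda unfolding measure_space_def countably_additive_def sets_state_measure
    by blast
  show "A \<in> sets state_measure" using assms by (simp add: sets_state_measure)
qed

lemma prob_space_state_measure: "prob_space state_measure"
proof
  have "Z \<in> sets (restrict_space borel Z)" using sets.top[of "restrict_space borel Z"] by (simp add: space_restrict_space)
  then show "emeasure state_measure (space state_measure) = 1"
    by (simp add: space_state_measure emeasure_state_measure state_outer_total)
qed

text \<open>A nearly optimal cover \<open>g\<close> of \<open>A\<close>, enlarged by the factor
  \<open>1 + d\<close>, covers all points where some partial sum of \<open>g\<close> exceeds
  \<open>1 / (1 + d)\<close>. These points form the trace of an open set containing
  \<open>A\<close>.\<close>

lemma state_measure_outer_regular:
  assumes A: "A \<in> sets state_measure" and e: "0 < e"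
  obtains U where "open U" "A \<subseteq> U" "emeasure state_measure (Z \<inter> U) \<le> emeasure state_measure A + ennreal e"
proof -
  \<comment> \<open>The excess found below is at most
    \<open>d + (1 + d) * d = 2 * d + d * d\<close>, which is at most \<open>3 * d\<close> because
    \<open>d \<le> 1\<close>.\<close>
  define d where "d = min 1 (e / 3)"
  have d: "0 < d" "d \<le> 1" "d \<le> e / 3" using e by (auto simp: d_def)
  obtain g where g: "g \<in> function_covers Z A"
    and gle: "(\<Sum>n. ennreal (\<phi> (g n))) \<le> state_outer Z \<phi> A + ennreal d"
    using state_outer_approx[OF d(1)] by metis
  have gc: "continuous_on Z (g n)" and g0: "z \<in> Z \<Longrightarrow> 0 \<le> g n z" for n z
    using g by (auto simp: function_covers_def)
  have AZ: "A \<subseteq> Z" using sets.sets_into_space[OF A] by (simp add: space_state_measure)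
  obtain B where B: "\<And>N. open (B N)" "\<And>N z. z \<in> Z \<Longrightarrow> z \<in> B N \<longleftrightarrow> 1 / (1 + d) < (\<Sum>n<N. g n z)"
    by (rule open_partial_sums[of Z g "1 / (1 + d)", OF gc], rule that)
  define U where "U = (\<Union>N. B N)"
  have U: "open U" using B(1) by (auto simp: U_def)
  have "A \<subseteq> U"
  proof
    fix z assume z: "z \<in> A"
    have d1: "1 / (1 + d) < 1" using d by simp
    have zZ: "z \<in> Z" using z AZ by auto
    have "1 \<le> (\<Sum>n. ennreal (g n z))" using g z by (simp add: function_covers_def)
    then obtain N where "1 / (1 + d) < (\<Sum>n<N. g n z)"
      using partial_sum_gt[of "\<lambda>n. g n z", OF _ g0[OF zZ] d1] by blast
    then have "z \<in> B N" using B(2)[of z N] z AZ by auto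
    then show "z \<in> U" by (auto simp: U_def)
  qed
  moreover have "emeasure state_measure (Z \<inter> U) \<le> emeasure state_measure A + ennreal e"
  proof -
    have "Z \<inter> U \<in> sets (restrict_space borel Z)" using U by (auto simp: sets_restrict_space)
    then have "emeasure state_measure (Z \<inter> U) = state_outer Z \<phi> (Z \<inter> U)" by (rule emeasure_state_measure)
    also have "\<dots> \<le> (\<Sum>n. ennreal (\<phi> (\<lambda>z. (1 + d) * g n z)))"
    proof (rule state_outer_le, unfold function_covers_def, safe)
      fix n
      show "continuous_on Z (\<lambda>z. (1 + d) * g n z)" by (intro continuous_intros gc)
      show "0 \<le> (1 + d) * g n z" if "z \<in> Z" for z using g0[OF that] d by simp
    next
      fix z assume z: "z \<in> Z" "z \<in> U"
      then obtain N where "1 / (1 + d) < (\<Sum>n<N. g n z)" using B(2) by (auto simp: U_def)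
      then have "1 \<le> (\<Sum>n<N. (1 + d) * g n z)"
        unfolding sum_distrib_left[symmetric] using d by (simp add: field_simps)
      then have "1 \<le> (\<Sum>n<N. ennreal ((1 + d) * g n z))"
        using d g0[OF z(1)] by (subst sum_ennreal) (auto simp: ennreal_1[symmetric] simp del: ennreal_1 intro!: ennreal_leI)
      also have "\<dots> \<le> (\<Sum>n. ennreal ((1 + d) * g n z))" by (intro sum_le_suminf) auto
      finally show "1 \<le> (\<Sum>n. ennreal ((1 + d) * g n z))" .
    qed
    also have "\<dots> = ennreal (1 + d) * (\<Sum>n. ennreal (\<phi> (g n)))"
      using d function_covers_nonneg[OF g]
      by (simp add: state_scale[OF phi gc] ennreal_mult del: ennreal_plus)
    also have "\<dots> \<le> ennreal (1 + d) * (state_outer Z \<phi> A + ennreal d)"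
      by (intro mult_left_mono gle) auto
    also have "\<dots> = state_outer Z \<phi> A + (ennreal d * state_outer Z \<phi> A + ennreal (1 + d) * ennreal d)"
      using d by (simp add: distrib_left distrib_right add.assoc)
    also have "\<dots> \<le> state_outer Z \<phi> A + ennreal e"
    proof (rule add_left_mono)
      have "ennreal d * state_outer Z \<phi> A + ennreal (1 + d) * ennreal d \<le> ennreal d * 1 + ennreal (1 + d) * ennreal d"
        by (intro add_right_mono mult_left_mono state_outer_le_1) auto
      also have "\<dots> = ennreal (d + (1 + d) * d)"
        using d by (simp add: ennreal_mult[symmetric] ennreal_plus[symmetric] del: ennreal_plus)
      also have "\<dots> \<le> ennreal e"
      proof (rule ennreal_leI)
        have "d * d \<le> d * 1" using d by (intro mult_left_mono) auto
        moreover have "d + (1 + d) * d = 2 * d + d * d" by (simp add: algebra_simps)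
        ultimately show "d + (1 + d) * d \<le> e" using d by linarith
      qed
      finally show "ennreal d * state_outer Z \<phi> A + ennreal (1 + d) * ennreal d \<le> ennreal e" .
    qed
    finally show ?thesis using A by (simp add: emeasure_state_measure sets_state_measure)
  qed
  ultimately show thesis using U that by blast
qed

text \<open>Inner regularity at \<open>A\<close> is outer regularity at \<open>Z - A\<close>: if an
  open \<open>U\<close> contains \<open>Z - A\<close> with little excess, then the compact set
  \<open>Z - U\<close> lies in \<open>A\<close> and misses little of it.\<close>

lemma radon_state_measure: "state_measure \<in> radon_prob Z"
  unfolding radon_prob_def
proof (safe intro!: prob_space_state_measure)
  interpret M: prob_space state_measure by (rule prob_space_state_measure)
  show "A \<in> sets state_measure \<Longrightarrow> A \<in> sets (restrict_space borel Z)"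
    "A \<in> sets (restrict_space borel Z) \<Longrightarrow> A \<in> sets state_measure" for A
    by (simp_all add: sets_state_measure)
  fix A assume A: "A \<in> sets state_measure"
  have AZ: "A \<subseteq> Z" using sets.sets_into_space[OF A] by (simp add: space_state_measure)
  show "emeasure state_measure A = (SUP K\<in>{K. compact K \<and> K \<subseteq> A}. emeasure state_measure K)"
  proof (rule antisym)
    show "(SUP K\<in>{K. compact K \<and> K \<subseteq> A}. emeasure state_measure K) \<le> emeasure state_measure A"
      using A by (intro SUP_least emeasure_mono) auto
    show "emeasure state_measure A \<le> (SUP K\<in>{K. compact K \<and> K \<subseteq> A}. emeasure state_measure K)"
    proof (rule ennreal_le_epsilon)
      fix e :: real assume e: "0 < e"
      have cA: "Z - A \<in> sets state_measure"
        using sets.compl_sets[OF A] by (simp add: space_state_measure)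
      then obtain U where U: "open U" "Z - A \<subseteq> U"
        and le: "emeasure state_measure (Z \<inter> U) \<le> emeasure state_measure (Z - A) + ennreal e"
        using state_measure_outer_regular e by metis
      have ZU: "Z \<inter> U \<in> sets state_measure" using U by (auto simp: sets_state_measure sets_restrict_space)
      have K: "compact (Z - U)" "Z - U \<subseteq> A"
        using Z U by (auto simp: Diff_eq closed_Compl intro: compact_Int_closed)
      have "Z - U = space state_measure - Z \<inter> U" by (auto simp: space_state_measure)
      then have "M.prob (Z - U) = 1 - M.prob (Z \<inter> U)" using M.prob_compl[OF ZU] by simp
      moreover have "M.prob (Z - A) = 1 - M.prob A"
        using M.prob_compl[OF A] by (simp add: space_state_measure)
      moreover have "M.prob (Z \<inter> U) \<le> M.prob (Z - A) + e"
        using le e by (simp add: M.emeasure_eq_measure ennreal_plus[symmetric] del: ennreal_plus)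
      ultimately have "emeasure state_measure A \<le> emeasure state_measure (Z - U) + ennreal e"
        using e by (simp add: M.emeasure_eq_measure ennreal_plus[symmetric] del: ennreal_plus)
      also have "\<dots> \<le> (SUP K\<in>{K. compact K \<and> K \<subseteq> A}. emeasure state_measure K) + ennreal e"
        using K by (intro add_right_mono SUP_upper) auto
      finally show "emeasure state_measure A \<le> (SUP K\<in>{K. compact K \<and> K \<subseteq> A}. emeasure state_measure K) + ennreal e" .
    qed
  qed
qed

text \<open>\<open>h\<close> is cut into horizontal slices \<open>k i\<close> of height
  \<open>1 / n\<close>. Since \<open>real n * k i\<close> is 1 on the superlevel set
  \<open>A i\<close>, it is a cover of that set by a single function, so the measure of
  \<open>A i\<close> is at most \<open>n\<close> times the value of the state at the slice.
  Summation recovers the value at \<open>h\<close> up to \<open>1 / n\<close>.\<close>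

lemma integral_state_measure_le:
  assumes h: "continuous_on Z h" "\<And>z. z \<in> Z \<Longrightarrow> 0 \<le> h z" "\<And>z. z \<in> Z \<Longrightarrow> h z \<le> 1"
  shows "(\<integral>z. h z \<partial>state_measure) \<le> \<phi> h"
proof -
  interpret M: prob_space state_measure by (rule prob_space_state_measure)
  note int = integrable_continuous_compact[OF prob_space_state_measure sets_state_measure Z]
  have bound: "(\<integral>z. h z \<partial>state_measure) \<le> 1 / real n + \<phi> h" if n: "0 < n" for n :: nat
  proof -
    define k where "k i z = min (h z) (real (Suc i) / n) - min (h z) (real i / n)" for i z
    define A where "A i = {z\<in>Z. real (Suc i) / n \<le> h z}" for i
    have kc: "continuous_on Z (k i)" for i unfolding k_def by (intro continuous_intros h)
    have step: "real i / n \<le> real (Suc i) / n" for i using n by (simp add: divide_right_mono)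
    have k0: "0 \<le> k i z" for i z using step[of i] by (auto simp: k_def min_def)
    have sum_k: "(\<Sum>i<n. k i z) = h z" if "z \<in> Z" for z
      using sum_lessThan_telescope[of "\<lambda>i. min (h z) (real i / n)" n] h(2,3)[OF that] n
      by (simp add: k_def)
    have Am: "A i \<in> sets state_measure" for i
    proof -
      have "closedin (top_of_set Z) (Z \<inter> h -` {real (Suc i) / n..})"
        by (rule continuous_closedin_preimage[OF h(1)]) simp
      then obtain T where "closed T" "Z \<inter> h -` {real (Suc i) / n..} = Z \<inter> T" by (auto simp: closedin_closed)
      moreover have "A i = Z \<inter> h -` {real (Suc i) / n..}" by (auto simp: A_def)
      ultimately show ?thesis by (auto simp: sets_state_measure sets_restrict_space)
    qed
    have prob_A: "M.prob (A i) \<le> \<phi> (\<lambda>z. real n * k i z)" for i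
    proof -
      have "emeasure state_measure (A i) = state_outer Z \<phi> (A i)"
        using Am[of i] by (simp add: emeasure_state_measure sets_state_measure)
      also have "\<dots> \<le> ennreal (\<phi> (\<lambda>z. real n * k i z))"
      proof (rule state_outer_le_single)
        fix z assume "z \<in> A i"
        then have "real (Suc i) / n \<le> h z" by (simp add: A_def)
        then have "k i z = 1 / n" using step[of i] n by (simp add: k_def field_simps)
        then show "1 \<le> real n * k i z" using n by simp
      qed (use k0 kc in \<open>auto intro!: continuous_intros\<close>)
      finally show ?thesis
        by (subst (asm) M.emeasure_eq_measure, subst (asm) ennreal_le_iff)
          (auto intro!: state_nonneg[OF phi] continuous_intros kc mult_nonneg_nonneg k0)
    qed
    have pt: "h z \<le> 1 / n + (\<Sum>i<n. (1 / n) * indicator (A i) z)" if z: "z \<in> Z" for z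
    proof -
      obtain m where m: "n = Suc m" using n by (cases n) auto
      \<comment> \<open>Here the index is shifted by one: slice \<open>Suc i\<close> vanishes
        outside \<open>A i\<close>. The lowest slice has no such set and accounts for the extra
        \<open>1 / n\<close>.\<close>
      have k_le: "k (Suc i) z \<le> (1 / n) * indicator (A i) z" for i
      proof (cases "z \<in> A i")
        case True
        have "k (Suc i) z \<le> real (Suc (Suc i)) / n - real (Suc i) / n"
          using step[of "Suc i"] by (auto simp: k_def min_def)
        then show ?thesis using True n by (simp add: field_simps)
      next
        case False
        then have "h z < real (Suc i) / n" using z by (simp add: A_def not_le)
        then show ?thesis using False step[of "Suc i"] by (simp add: k_def)
      qed
      have "h z = (\<Sum>i<Suc m. k i z)" using sum_k[OF z] m by simp
      also have "\<dots> = k 0 z + (\<Sum>i<m. k (Suc i) z)" by (rule sum.lessThan_Suc_shift)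
      also have "\<dots> \<le> 1 / n + (\<Sum>i<m. (1 / n) * indicator (A i) z)"
        using h(2)[OF z] by (intro add_mono sum_mono k_le) (simp add: k_def)
      also have "\<dots> \<le> 1 / n + (\<Sum>i<n. (1 / n) * indicator (A i) z)"
        unfolding m by (intro add_left_mono sum_mono2) auto
      finally show ?thesis .
    qed
    have "(\<integral>z. h z \<partial>state_measure) \<le> (\<integral>z. 1 / n + (\<Sum>i<n. (1 / n) * indicator (A i) z) \<partial>state_measure)"
      using pt Am by (intro integral_mono int[OF h(1)]) (auto simp: space_state_measure M.emeasure_eq_measure)
    also have "\<dots> = 1 / n + (\<Sum>i<n. (1 / n) * M.prob (A i))"
      using Am by (subst Bochner_Integration.integral_add) (auto simp: M.prob_space M.emeasure_eq_measure)
    also have "\<dots> \<le> 1 / n + (\<Sum>i<n. (1 / n) * \<phi> (\<lambda>z. real n * k i z))"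
      using n by (intro add_left_mono sum_mono mult_left_mono prob_A) auto
    also have "\<dots> = 1 / n + (\<Sum>i<n. \<phi> (k i))"
      using n by (simp add: state_scale[OF phi kc])
    also have "(\<Sum>i<n. \<phi> (k i)) = \<phi> (\<lambda>z. \<Sum>i<n. k i z)" by (rule state_sum[OF phi, symmetric]) (rule kc)
    also have "\<dots> = \<phi> h"
      by (intro state_cong[OF phi] h continuous_intros kc) (auto intro: sum_k)
    finally show ?thesis .
  qed
  have "(\<integral>z. h z \<partial>state_measure) - \<phi> h \<le> 1 / real (Suc n)" for n
    using bound[of "Suc n"] by (simp add: algebra_simps del: of_nat_Suc)
  then have "(\<integral>z. h z \<partial>state_measure) - \<phi> h \<le> 0"
    by (intro LIMSEQ_le_const[OF LIMSEQ_inverse_real_of_nat]) (auto simp: inverse_eq_divide)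
  then show ?thesis by simp
qed

text \<open>For functions with values in \<open>[0, 1]\<close> the inequality for \<open>g\<close>
  and for \<open>1 - g\<close> gives equality; the general case is an affine rescaling into that
  interval.\<close>

lemma integral_state_measure:
  assumes h: "continuous_on Z h"
  shows "(\<integral>z. h z \<partial>state_measure) = \<phi> h"
proof -
  interpret M: prob_space state_measure by (rule prob_space_state_measure)
  note int = integrable_continuous_compact[OF prob_space_state_measure sets_state_measure Z]
  have eq: "(\<integral>z. g z \<partial>state_measure) = \<phi> g"
    if g: "continuous_on Z g" "\<And>z. z \<in> Z \<Longrightarrow> 0 \<le> g z" "\<And>z. z \<in> Z \<Longrightarrow> g z \<le> 1" for g
  proof -
    have "(\<integral>z. 1 - g z \<partial>state_measure) \<le> \<phi> (\<lambda>z. 1 - g z)"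
      using g by (intro integral_state_measure_le continuous_intros) auto
    also have "\<phi> (\<lambda>z. 1 - g z) = 1 - \<phi> g"
      using state_diff[OF phi _ g(1), of "\<lambda>_. 1"] by (simp add: state_one[OF phi])
    also have "(\<integral>z. 1 - g z \<partial>state_measure) = 1 - (\<integral>z. g z \<partial>state_measure)"
      using int[OF g(1)] by (simp add: M.prob_space)
    finally show ?thesis using integral_state_measure_le[OF g] by simp
  qed
  obtain B where B: "0 < B" "\<And>z. z \<in> Z \<Longrightarrow> \<bar>h z\<bar> \<le> B" using compact_bound_real[OF Z h] by metis
  define g where "g z = (1 / (2 * B)) * (h z + B)" for z
  have gc: "continuous_on Z g" unfolding g_def by (intro continuous_intros h)
  have "(\<integral>z. g z \<partial>state_measure) = \<phi> g"
    using B by (intro eq gc) (auto simp: g_def abs_le_iff field_simps dest!: B(2))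
  moreover have "(\<integral>z. g z \<partial>state_measure) = (1 / (2 * B)) * ((\<integral>z. h z \<partial>state_measure) + B)"
    unfolding g_def using int[OF h] by (simp add: M.prob_space)
  moreover have "\<phi> g = (1 / (2 * B)) * (\<phi> h + B)"
    unfolding g_def using h
    by (subst state_scale[OF phi] | subst state_add[OF phi] | intro continuous_intros | simp add: state_const[OF phi])+
  ultimately show ?thesis using B(1) by simp
qed

end

theorem state_representation:
  fixes Z :: "'a::t2_space set"
  assumes "compact Z" "cozero_space Z" "\<phi> \<in> states Z"
  obtains M where "M \<in> radon_prob Z" "\<And>h. continuous_on Z h \<Longrightarrow> (\<integral>z. h z \<partial>M) = \<phi> h"
  using radon_state_measure[OF assms(3,1,2)] integral_state_measure[OF assms(3,1,2)] by (rule that)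

section \<open>Barycenters\<close>

text \<open>With \<open>B\<close> bounding \<open>h\<close>, the product lies between multiples of
  \<open>w\<close>. Pieces of a partition of unity that carry no mass can therefore be discarded
  before dividing by their mass.\<close>

lemma state_mult_null:
  assumes phi: "\<phi> \<in> states Z" and Z: "compact Z"
    and w: "continuous_on Z w" "\<And>z. z \<in> Z \<Longrightarrow> 0 \<le> w z" "\<phi> w = 0" and h: "continuous_on Z h"
  shows "\<phi> (\<lambda>z. w z * h z) = 0"
proof -
  obtain B where B: "\<And>z. z \<in> Z \<Longrightarrow> \<bar>h z\<bar> \<le> B" using compact_bound_real[OF Z h] by metis
  have "\<phi> (\<lambda>z. w z * h z) \<le> \<phi> (\<lambda>z. B * w z)"
    using B w by (intro state_mono[OF phi] continuous_intros h)
      (auto simp: abs_le_iff mult.commute[of B] intro!: mult_left_mono)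
  moreover have "\<phi> (\<lambda>z. (- B) * w z) \<le> \<phi> (\<lambda>z. w z * h z)"
  proof (intro state_mono[OF phi] continuous_intros h w)
    fix z assume z: "z \<in> Z"
    have "w z * (- B) \<le> w z * h z" using B[OF z] w(2)[OF z] by (intro mult_left_mono) auto
    then show "- B * w z \<le> w z * h z" by (simp add: mult.commute)
  qed
  ultimately show ?thesis by (simp only: state_scale[OF phi w(1)] w(3) mult_zero_right)
qed

lemma state_eq_0:
  assumes "\<phi> \<in> states Z" "continuous_on Z h" "\<And>z. z \<in> Z \<Longrightarrow> h z = 0"
  shows "\<phi> h = 0"
  using state_cong[OF assms(1,2) continuous_on_const, of 0] assms(3) state_const[OF assms(1)] by simp

lemma partition_of_unity:
  fixes Z :: "'a::topological_space set"
  assumes coz: "cozero_space Z" and I: "finite I"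
    and U: "\<And>i. i \<in> I \<Longrightarrow> open (U i)" "Z \<subseteq> (\<Union>i\<in>I. U i)"
  obtains w :: "'i \<Rightarrow> 'a \<Rightarrow> real" where
    "\<And>i. i \<in> I \<Longrightarrow> continuous_on Z (w i)"
    "\<And>i z. i \<in> I \<Longrightarrow> z \<in> Z \<Longrightarrow> 0 \<le> w i z"
    "\<And>i z. i \<in> I \<Longrightarrow> z \<in> Z \<Longrightarrow> z \<notin> U i \<Longrightarrow> w i z = 0"
    "\<And>z. z \<in> Z \<Longrightarrow> (\<Sum>i\<in>I. w i z) = 1"
proof -
  have "\<exists>u::'a \<Rightarrow> real. i \<in> I \<longrightarrow> continuous_on Z u \<and> (\<forall>z\<in>Z. 0 \<le> u z) \<and> (\<forall>z\<in>Z. z \<in> U i \<longleftrightarrow> 0 < u z)" for i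
    using coz U(1)[of i] unfolding cozero_space_def by metis
  then obtain u :: "'i \<Rightarrow> 'a \<Rightarrow> real" where uc: "\<And>i. i \<in> I \<Longrightarrow> continuous_on Z (u i)"
    and u0: "\<And>i z. i \<in> I \<Longrightarrow> z \<in> Z \<Longrightarrow> 0 \<le> u i z"
    and uU: "\<And>i z. i \<in> I \<Longrightarrow> z \<in> Z \<Longrightarrow> z \<in> U i \<longleftrightarrow> 0 < u i z"
    by metis
  define s where "s z = (\<Sum>i\<in>I. u i z)" for z
  have s: "0 < s z" if z: "z \<in> Z" for z
  proof -
    obtain i where i: "i \<in> I" "z \<in> U i" using U(2) z by auto
    then show ?thesis unfolding s_def using uU z I u0 by (intro sum_pos2[of I i]) auto
  qed
  show thesis
  proof (rule that[of "\<lambda>i z. u i z / s z"])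
    show "continuous_on Z (\<lambda>z. u i z / s z)" if "i \<in> I" for i
      using s that unfolding s_def by (intro continuous_intros uc) force+
    show "0 \<le> u i z / s z" if "i \<in> I" "z \<in> Z" for i z using u0[OF that] s[OF that(2)] by simp
    show "u i z / s z = 0" if "i \<in> I" "z \<in> Z" "z \<notin> U i" for i z
      using u0[of i z] uU[of i z] that by fastforce
    show "(\<Sum>i\<in>I. u i z / s z) = 1" if "z \<in> Z" for z
      using s[OF that] by (simp add: sum_divide_distrib[symmetric] s_def)
  qed
qed

section \<open>Representing states and their barycenters\<close>

lemma continuous_dual_sum:
  assumes "f \<in> continuous_dual"
  shows "f (\<Sum>i\<in>I. a i *\<^sub>R x i) = (\<Sum>i\<in>I. a i * f (x i))"
  using continuous_dualD(1)[OF assms] by (simp add: linear_sum linear_scale)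

definition representing_states ::
  "'a::{real_vector,topological_space} set \<Rightarrow> 'a \<Rightarrow> (('a \<Rightarrow> real) \<Rightarrow> real) set" where
  "representing_states Z x = {\<phi>\<in>states Z. \<forall>f\<in>continuous_dual. \<phi> f = f x}"

lemma representing_statesD:
  assumes "\<phi> \<in> representing_states Z x"
  shows "\<phi> \<in> states Z" "f \<in> continuous_dual \<Longrightarrow> \<phi> f = f x"
  using assms by (auto simp: representing_states_def)

text \<open>The condition \<open>supp\<close> says that the state lives on
  \<open>Z \<inter> W\<close>, which confines the barycenter to a small \<open>S\<close> although
  the state is defined on all of \<open>C(Z)\<close>. For finitely many forms and a tolerance, a
  convex combination of points of \<open>Z \<inter> W\<close> is an approximate barycenter;
  compactness of \<open>S\<close> yields an exact one.\<close>

lemma barycenter_exists: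
  fixes Z :: "'a::locally_convex_t2_space set"
  assumes Z: "compact Z" and coz: "cozero_space Z" and phi: "\<phi> \<in> states Z"
    and supp: "\<And>h. continuous_on Z h \<Longrightarrow> (\<And>z. z \<in> Z \<inter> W \<Longrightarrow> h z = 0) \<Longrightarrow> \<phi> h = 0"
    and S: "compact S" "convex S" "Z \<inter> W \<subseteq> S"
  obtains x where "x \<in> S" "\<phi> \<in> representing_states Z x"
proof -
  have approx: "\<exists>x\<in>S. \<forall>f\<in>I. \<bar>f x - \<phi> f\<bar> \<le> e"
    if I: "finite I" "I \<subseteq> continuous_dual" and e: "0 < e" for I and e :: real
  proof -
    \<comment> \<open>With radius \<open>e / 2\<close> each form in \<open>I\<close> varies by less
      than \<open>e\<close> between any two points of \<open>U a\<close>, as needed for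
      \<open>z\<close> and the later choice \<open>b a\<close>.\<close>
    define U where "U a = (\<Inter>f\<in>I. {z. \<bar>f z - f a\<bar> < e / 2})" for a
    have fc: "continuous_on X f" if "f \<in> I" for f X using I that continuous_dualD(2) by blast
    have Uo: "open (U a)" for a
      unfolding U_def using I(1) by (intro open_INT ballI open_Collect_less continuous_intros fc)
    have "Z \<subseteq> (\<Union>a\<in>Z. U a)" using e by (auto simp: U_def)
    then obtain A where A: "A \<subseteq> Z" "finite A" "Z \<subseteq> (\<Union>a\<in>A. U a)"
      using compactE_image[OF Z, of Z U] Uo by metis
    obtain w where wc: "\<And>a. a \<in> A \<Longrightarrow> continuous_on Z (w a)"
      and w0: "\<And>a z. a \<in> A \<Longrightarrow> z \<in> Z \<Longrightarrow> 0 \<le> w a z"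
      and wU: "\<And>a z. a \<in> A \<Longrightarrow> z \<in> Z \<Longrightarrow> z \<notin> U a \<Longrightarrow> w a z = (0::real)"
      and w1: "\<And>z. z \<in> Z \<Longrightarrow> (\<Sum>a\<in>A. w a z) = 1"
      using partition_of_unity[OF coz A(2), of U] Uo A(3) by metis
    define J where "J = {a\<in>A. \<phi> (w a) \<noteq> 0}"
    \<comment> \<open>A weight of nonzero mass cannot vanish on all of \<open>Z \<inter> W\<close>,
      so a point of \<open>W\<close> is found where the weight is nonzero, hence inside
      \<open>U a\<close>.\<close>
    have "\<exists>b. a \<in> J \<longrightarrow> b \<in> Z \<inter> W \<inter> U a" for a
      using supp[OF wc[of a]] wU[of a] unfolding J_def by fastforce
    then obtain b where b: "\<And>a. a \<in> J \<Longrightarrow> b a \<in> Z \<inter> W \<inter> U a" by metis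
    have fJ: "finite J" "J \<subseteq> A" using A by (auto simp: J_def)
    have phi_w: "0 \<le> \<phi> (w a)" if "a \<in> A" for a using that by (intro state_nonneg[OF phi] wc w0)
    have sumJ: "(\<Sum>a\<in>J. \<phi> (w a)) = 1"
    proof -
      have "(\<Sum>a\<in>J. \<phi> (w a)) = (\<Sum>a\<in>A. \<phi> (w a))"
        using A(2) by (intro sum.mono_neutral_left) (auto simp: J_def)
      also have "\<dots> = \<phi> (\<lambda>z. \<Sum>a\<in>A. w a z)" using wc by (intro state_sum[OF phi, symmetric])
      also have "\<dots> = \<phi> (\<lambda>_. 1)" by (intro state_cong[OF phi] continuous_intros wc w1)
      finally show ?thesis by (simp add: state_one[OF phi])
    qed
    define x where "x = (\<Sum>a\<in>J. \<phi> (w a) *\<^sub>R b a)"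
    have "x \<in> S" unfolding x_def
      using fJ S sumJ phi_w b by (intro convex_sum) auto
    moreover have "\<bar>f x - \<phi> f\<bar> \<le> e" if f: "f \<in> I" for f
    proof -
      have fd: "f \<in> continuous_dual" using f I by auto
      have close: "\<bar>\<phi> (\<lambda>z. w a z * f z) - \<phi> (w a) * f (b a)\<bar> \<le> e * \<phi> (w a)" if a: "a \<in> J" for a
      proof -
        have aA: "a \<in> A" using a fJ by auto
        have ba: "\<bar>f (b a) - f a\<bar> < e / 2" using b[OF a] f by (auto simp: U_def)
        have pt: "w a z * \<bar>f z - f (b a)\<bar> \<le> e * w a z" if z: "z \<in> Z" for z
        proof (cases "z \<in> U a")
          case True
          then have "\<bar>f z - f a\<bar> < e / 2" using f by (auto simp: U_def)
          then have "\<bar>f z - f (b a)\<bar> \<le> e" using ba by linarith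
          then show ?thesis using w0[OF aA z] by (simp add: mult.commute[of e] mult_left_mono)
        next
          case False
          then show ?thesis using wU[OF aA z] by simp
        qed
        have "\<phi> (\<lambda>z. w a z * f z) - \<phi> (w a) * f (b a) = \<phi> (\<lambda>z. w a z * f z) - \<phi> (\<lambda>z. f (b a) * w a z)"
          using state_scale[OF phi wc[OF aA], of "f (b a)"] by simp
        also have "\<dots> = \<phi> (\<lambda>z. w a z * f z - f (b a) * w a z)"
          by (intro state_diff[OF phi, symmetric] continuous_intros wc aA fc f)
        also have "\<dots> = \<phi> (\<lambda>z. w a z * (f z - f (b a)))" by (simp add: algebra_simps)
        finally have eq: "\<phi> (\<lambda>z. w a z * f z) - \<phi> (w a) * f (b a) = \<phi> (\<lambda>z. w a z * (f z - f (b a)))" .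
        have up: "\<phi> (\<lambda>z. w a z * (f z - f (b a))) \<le> \<phi> (\<lambda>z. e * w a z)"
        proof (intro state_mono[OF phi] continuous_intros wc aA fc f)
          fix z assume z: "z \<in> Z"
          have "w a z * (f z - f (b a)) \<le> w a z * \<bar>f z - f (b a)\<bar>"
            using w0[OF aA z] by (intro mult_left_mono) auto
          then show "w a z * (f z - f (b a)) \<le> e * w a z" using pt[OF z] by linarith
        qed
        have lo: "\<phi> (\<lambda>z. (- e) * w a z) \<le> \<phi> (\<lambda>z. w a z * (f z - f (b a)))"
        proof (intro state_mono[OF phi] continuous_intros wc aA fc f)
          fix z assume z: "z \<in> Z"
          have "w a z * (f (b a) - f z) \<le> w a z * \<bar>f z - f (b a)\<bar>"
            using w0[OF aA z] by (intro mult_left_mono) auto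
          then show "- e * w a z \<le> w a z * (f z - f (b a))" using pt[OF z] by (simp add: algebra_simps)
        qed
        show ?thesis using up lo unfolding eq state_scale[OF phi wc[OF aA]] by linarith
      qed
      have "\<phi> f = \<phi> (\<lambda>z. \<Sum>a\<in>A. w a z * f z)"
        by (intro state_cong[OF phi] continuous_intros wc fc f)
          (simp_all add: sum_distrib_right[symmetric] w1)
      also have "\<dots> = (\<Sum>a\<in>A. \<phi> (\<lambda>z. w a z * f z))"
        by (intro state_sum[OF phi] continuous_intros wc fc f)
      also have "\<dots> = (\<Sum>a\<in>J. \<phi> (\<lambda>z. w a z * f z))"
        using A(2) fc[OF f] wc w0
        by (intro sum.mono_neutral_right) (auto simp: J_def intro!: state_mult_null[OF phi Z])
      finally have "\<bar>f x - \<phi> f\<bar> = \<bar>\<Sum>a\<in>J. \<phi> (\<lambda>z. w a z * f z) - \<phi> (w a) * f (b a)\<bar>"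
        unfolding x_def continuous_dual_sum[OF fd] by (simp add: sum_subtractf abs_minus_commute)
      also have "\<dots> \<le> (\<Sum>a\<in>J. e * \<phi> (w a))"
        by (rule order_trans[OF sum_abs]) (intro sum_mono close)
      also have "\<dots> = e" using sumJ by (simp add: sum_distrib_left[symmetric])
      finally show ?thesis .
    qed
    ultimately show ?thesis by blast
  qed
  have "S \<inter> (\<Inter>p\<in>continuous_dual \<times> {0<..}. {x. \<bar>fst p x - \<phi> (fst p)\<bar> \<le> snd p}) \<noteq> {}"
  proof (rule compact_imp_fip_image[OF S(1)])
    fix p :: "('a \<Rightarrow> real) \<times> real" assume "p \<in> continuous_dual \<times> {0<..}"
    then show "closed {x. \<bar>fst p x - \<phi> (fst p)\<bar> \<le> snd p}"
      by (intro closed_Collect_le continuous_intros continuous_dualD(2)) auto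
  next
    fix P :: "(('a \<Rightarrow> real) \<times> real) set" assume P: "finite P" "P \<subseteq> continuous_dual \<times> {0<..}"
    define e where "e = Min (insert 1 (snd ` P))"
    have e: "0 < e" "\<And>p. p \<in> P \<Longrightarrow> e \<le> snd p" using P by (auto simp: e_def)
    have "fst ` P \<subseteq> continuous_dual" using P(2) by auto
    then obtain x where "x \<in> S" "\<forall>f\<in>fst ` P. \<bar>f x - \<phi> f\<bar> \<le> e"
      using approx[of "fst ` P" e] P(1) e(1) by blast
    then have "x \<in> S \<inter> (\<Inter>p\<in>P. {x. \<bar>fst p x - \<phi> (fst p)\<bar> \<le> snd p})" using e(2) by fastforce
    then show "S \<inter> (\<Inter>p\<in>P. {x. \<bar>fst p x - \<phi> (fst p)\<bar> \<le> snd p}) \<noteq> {}" by blast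
  qed
  then obtain x where x: "x \<in> S" "\<And>f e. f \<in> continuous_dual \<Longrightarrow> 0 < e \<Longrightarrow> \<bar>f x - \<phi> f\<bar> \<le> e" by force
  have "\<phi> f = f x" if f: "f \<in> continuous_dual" for f
  proof -
    have "\<bar>f x - \<phi> f\<bar> \<le> 0" by (rule dense_ge) (rule x(2)[OF f])
    then show ?thesis by simp
  qed
  then show thesis using x(1) phi that by (auto simp: representing_states_def)
qed

text \<open>On a compact set the given topology is the weak one: finitely many forms separate
  \<open>e\<close> from \<open>K - U\<close>. The levels \<open>m z\<close> lie halfway between the
  two values, which leaves room for an open intersection of half-spaces around \<open>e\<close>
  inside a closed one.\<close>

lemma compact_convex_neighbourhood:
  fixes K :: "'a::locally_convex_t2_space set"
  assumes K: "compact K" and U: "open U" "e \<in> U"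
  obtains W S where "open W" "e \<in> W" "W \<subseteq> S" "closed S" "convex S" "S \<inter> K \<subseteq> U"
proof -
  have "\<exists>f. z \<in> K - U \<longrightarrow> f \<in> continuous_dual \<and> f e < f z" for z
    using separate_points[of z e] U(2) by (metis DiffD2)
  then obtain f where f: "\<And>z. z \<in> K - U \<Longrightarrow> f z \<in> continuous_dual" "\<And>z. z \<in> K - U \<Longrightarrow> f z e < f z z"
    by metis
  define m where "m z = (f z e + f z z) / 2" for z
  have m: "f z e < m z" "m z < f z z" if "z \<in> K - U" for z using f(2)[OF that] by (auto simp: m_def)
  have "compact (K - U)" using K U(1) by (simp add: compact_diff)
  moreover have "open {w. m z < f z w}" if "z \<in> K - U" for z
    using f(1)[OF that] by (intro open_Collect_less continuous_intros continuous_dualD(2))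
  moreover have "K - U \<subseteq> (\<Union>z\<in>K - U. {w. m z < f z w})" using m(2) by auto
  ultimately obtain I where I: "I \<subseteq> K - U" "finite I" "K - U \<subseteq> (\<Union>z\<in>I. {w. m z < f z w})"
    by (rule compactE_image)
  show thesis
  proof (rule that[of "\<Inter>z\<in>I. {w. f z w < m z}" "\<Inter>z\<in>I. {w. f z w \<le> m z}"])
    show "open (\<Inter>z\<in>I. {w. f z w < m z})"
      using I f(1) by (intro open_INT ballI open_Collect_less continuous_intros continuous_dualD(2)) auto
    show "closed (\<Inter>z\<in>I. {w. f z w \<le> m z})"
      using I f(1) by (intro closed_INT ballI closed_Collect_le continuous_intros continuous_dualD(2)) auto
    show "convex (\<Inter>z\<in>I. {w. f z w \<le> m z})"
    proof (rule convex_INT)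
      fix z assume "z \<in> I"
      then have lin: "linear (f z)" using I f(1) continuous_dualD(1) by blast
      show "convex {w. f z w \<le> m z}"
        using convex_linear_vimage[OF lin convex_real_interval(2)[of "m z"]] by (simp add: vimage_def)
    qed
    show "e \<in> (\<Inter>z\<in>I. {w. f z w < m z})" using m(1) I by auto
    show "(\<Inter>z\<in>I. {w. f z w \<le> m z}) \<inter> K \<subseteq> U" using I(3) by fastforce
    show "(\<Inter>z\<in>I. {w. f z w < m z}) \<subseteq> (\<Inter>z\<in>I. {w. f z w \<le> m z})"
      by (auto intro: less_imp_le)
  qed
qed

text \<open>Conditioning on a weight and on its complement writes \<open>e\<close> as a proper
  convex combination of two barycenters in \<open>K\<close>. By extremality both equal
  \<open>e\<close>, so the state of \<open>w * f\<close> is \<open>f e\<close> times the state of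
  \<open>w\<close>. Hence every form has variance 0, and the state is concentrated at
  \<open>e\<close>.\<close>

lemma representing_state_extreme:
  fixes K :: "'a::locally_convex_t2_space set"
  assumes K: "compact K" "convex K" and Z: "compact Z" "cozero_space Z" "Z \<subseteq> K"
    and e: "e \<in> Ext K" "e \<in> Z" and phi: "\<phi> \<in> representing_states Z e" and h: "continuous_on Z h"
  shows "\<phi> h = h e"
proof -
  note st = representing_statesD(1)[OF phi] and rep = representing_statesD(2)[OF phi]
  have mult: "\<phi> (\<lambda>z. w z * f z) = f e * \<phi> w"
    if f: "f \<in> continuous_dual" and w: "continuous_on Z w" for f w
  proof -
    note fc = continuous_dualD(2)[OF f]
    obtain B where B: "0 < B" "\<And>z. z \<in> Z \<Longrightarrow> \<bar>w z\<bar> \<le> B" using compact_bound_real[OF Z(1) w] by metis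
    text \<open>The affine rescaling keeps the mass of the weight and of its complement positive, so
      that both conditional states exist and \<open>e\<close> is a proper convex combination of
      their barycenters.\<close>
    define v where "v z = 1 / 2 + (1 / (4 * B)) * w z" for z
    have vc: "continuous_on Z v" unfolding v_def by (intro continuous_intros w)
    have v: "1 / 4 \<le> v z" "v z \<le> 3 / 4" if "z \<in> Z" for z
      using B(2)[OF that] B(1) by (auto simp: v_def abs_le_iff field_simps)
    define l where "l = \<phi> v"
    have l: "1 / 4 \<le> l" "l \<le> 3 / 4"
      using state_mono[OF st _ vc, of "\<lambda>_. 1 / 4"] state_mono[OF st vc, of "\<lambda>_. 3 / 4"] v
      by (auto simp: l_def state_const[OF st])
    have l': "\<phi> (\<lambda>z. 1 - v z) = 1 - l"
      using state_diff[OF st _ vc, of "\<lambda>_. 1"] by (simp add: state_one[OF st] l_def)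
    have v0: "0 \<le> v z" "0 \<le> 1 - v z" if "z \<in> Z" for z using v[OF that] by auto
    have cont': "continuous_on Z (\<lambda>z. 1 - v z)" by (intro continuous_intros vc)
    let ?p = "\<lambda>h. if continuous_on Z h then \<phi> (\<lambda>z. v z * h z) / \<phi> v else 0"
    let ?q = "\<lambda>h. if continuous_on Z h then \<phi> (\<lambda>z. (1 - v z) * h z) / \<phi> (\<lambda>z. 1 - v z) else 0"
    have p: "?p \<in> states Z" using l by (intro conditional_state[OF st vc v0(1)]) (auto simp: l_def)
    have q: "?q \<in> states Z" using l l' by (intro conditional_state[OF st cont' v0(2)]) auto
    obtain x where x: "x \<in> K" "?p \<in> representing_states Z x"
      by (rule barycenter_exists[OF Z(1,2) p, of UNIV K])
        (rule state_eq_0[OF p], use K Z(3) in auto)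
    obtain y where y: "y \<in> K" "?q \<in> representing_states Z y"
      by (rule barycenter_exists[OF Z(1,2) q, of UNIV K])
        (rule state_eq_0[OF q], use K Z(3) in auto)
    have gx: "\<phi> (\<lambda>z. v z * g z) = l * g x" and gy: "\<phi> (\<lambda>z. (1 - v z) * g z) = (1 - l) * g y"
      if g: "g \<in> continuous_dual" for g
      using representing_statesD(2)[OF x(2) g] representing_statesD(2)[OF y(2) g] l l'
        continuous_dualD(2)[OF g, of Z] by (auto simp: l_def field_simps)
    have exy: "e = (1 - l) *\<^sub>R y + l *\<^sub>R x"
    proof (rule continuous_dual_inject)
      fix g :: "'a \<Rightarrow> real" assume g: "g \<in> continuous_dual"
      note gc = continuous_dualD(2)[OF g]
      have "g e = \<phi> g" using rep[OF g] by simp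
      also have "\<dots> = \<phi> (\<lambda>z. v z * g z + (1 - v z) * g z)" by (simp add: algebra_simps)
      also have "\<dots> = l * g x + (1 - l) * g y"
        using state_add[OF st, of "\<lambda>z. v z * g z" "\<lambda>z. (1 - v z) * g z"] vc gc gx[OF g] gy[OF g]
        by (simp add: continuous_on_mult cont')
      also have "\<dots> = g ((1 - l) *\<^sub>R y + l *\<^sub>R x)"
        using continuous_dualD(1)[OF g] by (simp add: linear_add linear_scale)
      finally show "g e = g ((1 - l) *\<^sub>R y + l *\<^sub>R x)" .
    qed
    have "y = x"
    proof (rule ccontr)
      assume "y \<noteq> x"
      then have "e \<in> open_segment y x" using exy l unfolding in_segment by (intro conjI exI[of _ l]) auto
      then show False using e(1) x(1) y(1) by (auto simp: Ext_def extreme_point_of_def)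
    qed
    then have "e = x" using exy by (simp add: scaleR_left_distrib[symmetric])
    then have *: "\<phi> (\<lambda>z. v z * f z) = l * f e" using gx[OF f] by simp
    have "\<phi> (\<lambda>z. v z * f z) = \<phi> (\<lambda>z. (1 / 2) * f z + (1 / (4 * B)) * (w z * f z))"
      by (simp add: v_def algebra_simps)
    also have "\<dots> = (1 / 2) * \<phi> f + (1 / (4 * B)) * \<phi> (\<lambda>z. w z * f z)"
      by (subst state_add[OF st] | subst state_scale[OF st] | intro continuous_intros fc w refl)+
    finally have "l * f e = (1 / 2) * f e + (1 / (4 * B)) * \<phi> (\<lambda>z. w z * f z)"
      using * rep[OF f] by simp
    moreover have "l = 1 / 2 + (1 / (4 * B)) * \<phi> w"
      unfolding l_def v_def
      by (subst state_add[OF st] | subst state_scale[OF st] | subst state_const[OF st]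
          | intro continuous_intros w refl)+
    ultimately show ?thesis using B(1) by (simp add: field_simps)
  qed
  \<comment> \<open>The product rule with the weight \<open>f - f e\<close>, whose own value under
    the state is 0.\<close>
  have sq: "\<phi> (\<lambda>z. (f z - f e)\<^sup>2) = 0" if f: "f \<in> continuous_dual" for f
  proof -
    note fc = continuous_dualD(2)[OF f]
    have "\<phi> (\<lambda>z. (f z - f e)\<^sup>2) = \<phi> (\<lambda>z. (f z - f e) * f z - f e * (f z - f e))"
      by (simp add: power2_eq_square algebra_simps)
    also have "\<dots> = \<phi> (\<lambda>z. (f z - f e) * f z) - f e * \<phi> (\<lambda>z. f z - f e)"
      by (subst state_diff[OF st] | subst state_scale[OF st] | intro continuous_intros fc refl)+
    also have "\<dots> = 0" by (subst mult[OF f]) (auto intro!: continuous_intros fc)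
    finally show ?thesis .
  qed
  have le: "\<phi> h \<le> h e" if h: "continuous_on Z h" for h
  proof (rule field_le_epsilon)
    fix r :: real assume r: "0 < r"
    define C where "C = Z \<inter> h -` {h e + r..}"
    have C: "compact C"
    proof -
      have "closedin (top_of_set Z) C" unfolding C_def by (rule continuous_closedin_preimage[OF h]) simp
      then show ?thesis using Z(1) closedin_compact by blast
    qed
    have "\<exists>f. z \<in> C \<longrightarrow> f \<in> continuous_dual \<and> f e < f z" for z
    proof (cases "z = e")
      case True
      then show ?thesis using r by (simp add: C_def)
    next
      case False
      then show ?thesis using separate_points[of z e] by metis
    qed
    then obtain f where f: "\<And>z. z \<in> C \<Longrightarrow> f z \<in> continuous_dual" "\<And>z. z \<in> C \<Longrightarrow> f z e < f z z"
      by metis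
    have "open {w. f z e < f z w}" if "z \<in> C" for z
      using f(1)[OF that] by (intro open_Collect_less continuous_intros continuous_dualD(2))
    moreover have "C \<subseteq> (\<Union>z\<in>C. {w. f z e < f z w})" using f(2) by auto
    ultimately obtain I where I: "I \<subseteq> C" "finite I" "C \<subseteq> (\<Union>z\<in>I. {w. f z e < f z w})"
      by (rule compactE_image[OF C])
    \<comment> \<open>\<open>q\<close> has value 0 under the state but is bounded away from 0 on
      \<open>C\<close>, where \<open>h\<close> exceeds \<open>h e + r\<close>; a multiple of
      \<open>q\<close> absorbs that excess at no cost.\<close>
    define q where "q w = (\<Sum>z\<in>I. (f z w - f z e)\<^sup>2)" for w
    have fc: "continuous_on X (f z)" if "z \<in> I" for z X using f(1) I that continuous_dualD(2) by blast
    have qc: "continuous_on X q" for X unfolding q_def by (intro continuous_intros fc)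
    have q0: "0 \<le> q w" for w unfolding q_def by (intro sum_nonneg) auto
    have qpos: "0 < q w" if w: "w \<in> C" for w
    proof -
      obtain z where z: "z \<in> I" "f z e < f z w" using I(3) w by auto
      then show ?thesis unfolding q_def using I(2) by (intro sum_pos2[of I z]) auto
    qed
    have phi_q: "\<phi> q = 0"
      unfolding q_def using f(1) I(1)
      by (subst state_sum[OF st]) (auto intro!: continuous_intros fc sum.neutral sq)
    obtain m where m: "0 < m" "\<And>w. w \<in> C \<Longrightarrow> m \<le> q w"
    proof (cases "C = {}")
      case True then show thesis using that[of 1] by auto
    next
      case False
      then obtain w where "w \<in> C" "\<And>v. v \<in> C \<Longrightarrow> q w \<le> q v"
        using continuous_attains_inf[OF C False qc] by auto
      then show thesis using that[of "q w"] qpos by auto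
    qed
    obtain B where B: "0 < B" "\<And>z. z \<in> Z \<Longrightarrow> \<bar>h z - h e\<bar> \<le> B"
      by (rule compact_bound_real[OF Z(1) continuous_on_diff[OF h continuous_on_const]], rule that)
    have "\<phi> h \<le> \<phi> (\<lambda>z. (h e + r) + (B / m) * q z)"
    proof (intro state_mono[OF st] continuous_intros h qc)
      fix z assume z: "z \<in> Z"
      show "h z \<le> h e + r + (B / m) * q z"
      proof (cases "z \<in> C")
        case True
        have "B = (B / m) * m" using m by simp
        also have "\<dots> \<le> (B / m) * q z" using m B True by (intro mult_left_mono) auto
        finally show ?thesis using B(2)[OF z] r by linarith
      next
        case False
        then have "h z < h e + r" using z by (auto simp: C_def)
        moreover have "0 \<le> (B / m) * q z" using B m q0 by simp
        ultimately show ?thesis by linarith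
      qed
    qed
    also have "\<dots> = h e + r"
      by (subst state_add[OF st] | subst state_scale[OF st] | subst state_const[OF st]
          | subst phi_q | intro continuous_intros qc refl)+ simp
    finally show "\<phi> h \<le> h e + r" .
  qed
  have "\<phi> (\<lambda>z. (- 1) * h z) \<le> (- 1) * h e" by (intro le continuous_intros h)
  then have "h e \<le> \<phi> h" by (subst (asm) state_scale[OF st h]) simp
  then show ?thesis using le[OF h] by simp
qed

section \<open>Continuity of the minimal cost on a stable compact convex set\<close>

text \<open>Boundedness takes the place of continuity. The defect \<open>h\<close> from the affine
  interpolation along a segment is again midpoint convex, and bounded above.\<close>

lemma midpoint_convex_bounded_convex_on:
  fixes g :: "'a::real_vector \<Rightarrow> real"
  assumes K: "convex K" and B: "\<And>x. x \<in> K \<Longrightarrow> \<bar>g x\<bar> \<le> B"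
    and mid: "\<And>x y. x \<in> K \<Longrightarrow> y \<in> K \<Longrightarrow> g (midpoint x y) \<le> (g x + g y) / 2"
  shows "convex_on K g"
proof (rule convex_onI[OF _ K])
  fix t x y assume t: "0 < t" "t < (1::real)" and xy: "x \<in> K" "y \<in> K"
  define p where "p s = (1 - s) *\<^sub>R x + s *\<^sub>R y" for s
  define h where "h s = g (p s) - ((1 - s) * g x + s * g y)" for s
  have p_eq: "p s = x + s *\<^sub>R (y - x)" for s
    by (simp add: p_def scaleR_diff_left scaleR_diff_right)
  have p: "p s \<in> K" if "0 \<le> s" "s \<le> 1" for s
    using that xy K unfolding p_def by (intro convexD) auto
  have hmid: "h ((r + s) / 2) \<le> (h r + h s) / 2" if "r \<in> {0..1}" "s \<in> {0..1}" for r s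
  proof -
    have "p ((r + s) / 2) = midpoint (p r) (p s)"
    proof -
      have "p r + p s = 2 *\<^sub>R x + (r + s) *\<^sub>R (y - x)"
        by (simp add: p_eq scaleR_2 scaleR_left_distrib)
      then have "midpoint (p r) (p s) = x + ((r + s) / 2) *\<^sub>R (y - x)"
        by (simp add: midpoint_def scaleR_add_right)
      then show ?thesis by (simp add: p_eq)
    qed
    then have "g (p ((r + s) / 2)) \<le> (g (p r) + g (p s)) / 2" using mid p that by simp
    then show ?thesis by (simp add: h_def field_simps)
  qed
  have h01: "h 0 = 0" "h 1 = 0" by (simp_all add: h_def p_def)
  have bdd: "bdd_above (h ` {0..1})"
  proof (rule bdd_aboveI2)
    fix s :: real assume s: "s \<in> {0..1}"
    have "\<bar>(1 - s) * g x\<bar> \<le> 1 * B" "\<bar>s * g y\<bar> \<le> 1 * B"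
      unfolding abs_mult using s B xy by (intro mult_mono; simp)+
    then show "h s \<le> 3 * B" using B[OF p, of s] s by (auto simp: h_def abs_le_iff)
  qed
  define M where "M = Sup (h ` {0..1})"
  have hM: "h s \<le> M" if "s \<in> {0..1}" for s unfolding M_def using that by (intro cSup_upper bdd) auto
  text \<open>Reflecting at the nearer endpoint, where the defect vanishes, halves the supremum.\<close>
  have half: "h s \<le> M / 2" if "s \<in> {0..1}" for s
  proof (cases "s \<le> 1 / 2")
    case True
    then show ?thesis using hmid[of 0 "2 * s"] hM[of "2 * s"] h01 that by auto
  next
    case False
    then show ?thesis using hmid[of "2 * s - 1" 1] hM[of "2 * s - 1"] h01 that by auto
  qed
  have "Sup (h ` {0..1}) \<le> M / 2" by (rule cSup_least) (use half in auto)
  then have "M \<le> M / 2" by (simp add: M_def[symmetric])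
  then have "h t \<le> 0" using hM[of t] t by auto
  then show "g ((1 - t) *\<^sub>R x + t *\<^sub>R y) \<le> (1 - t) * g x + t * g y"
    by (simp add: h_def p_def)
qed

text \<open>The set is the projection of a compact set of pairs of a state and a point, since the
  barycenter condition is closed in the pair. \<open>T\<close> restricts the cost: a lower ray gives
  lower semicontinuity of the minimal cost, an upper ray the bound near extreme points, and
  \<open>UNIV\<close> the existence of representing states.\<close>

lemma closed_representable:
  fixes K :: "'a::locally_convex_t2_space set"
  assumes K: "compact K" and Z: "compact Z" and T: "closed T"
  shows "closed {x\<in>K. \<exists>\<phi>\<in>representing_states Z x. \<phi> c \<in> T}"
proof -
  let ?R = "{q. \<forall>f\<in>continuous_dual. fst q f = f (snd q)} \<inter> {q. fst q c \<in> T} :: ((('a \<Rightarrow> real) \<Rightarrow> real) \<times> 'a) set"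
  have ev: "continuous_on UNIV (\<lambda>q :: (('a \<Rightarrow> real) \<Rightarrow> real) \<times> 'a. fst q h)" for h
    by (rule continuous_on_product_then_coordinatewise[OF continuous_on_fst[OF continuous_on_id]])
  have "closed {q :: (('a \<Rightarrow> real) \<Rightarrow> real) \<times> 'a. f \<in> continuous_dual \<longrightarrow> fst q f = f (snd q)}" for f
  proof (cases "f \<in> continuous_dual")
    case True
    have "continuous_on UNIV (\<lambda>q :: (('a \<Rightarrow> real) \<Rightarrow> real) \<times> 'a. f (snd q))"
      using continuous_on_compose2[OF continuous_dualD(2)[OF True, of UNIV] continuous_on_snd[OF continuous_on_id]]
      by simp
    then show ?thesis using closed_Collect_eq[OF ev] True by simp
  qed simp
  then have "closed {q :: (('a \<Rightarrow> real) \<Rightarrow> real) \<times> 'a. \<forall>f. f \<in> continuous_dual \<longrightarrow> fst q f = f (snd q)}"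
    by (rule closed_Collect_all)
  moreover have "closed {q :: (('a \<Rightarrow> real) \<Rightarrow> real) \<times> 'a. fst q c \<in> T}"
    using closed_vimage[OF T ev[of c]] by (simp add: vimage_def)
  ultimately have "closed ?R" unfolding Ball_def by (rule closed_Int)
  then have "compact (?R \<inter> (states Z \<times> K))"
    by (intro closed_Int_compact compact_Times compact_states Z K)
  then have "compact (snd ` (?R \<inter> (states Z \<times> K)))"
    by (intro compact_continuous_image continuous_on_snd continuous_on_id)
  moreover have "snd ` (?R \<inter> (states Z \<times> K)) = {x\<in>K. \<exists>\<phi>\<in>representing_states Z x. \<phi> c \<in> T}"
  proof (intro equalityI subsetI)
    fix x assume "x \<in> {x\<in>K. \<exists>\<phi>\<in>representing_states Z x. \<phi> c \<in> T}"
    then obtain \<phi> where "x \<in> K" "\<phi> \<in> representing_states Z x" "\<phi> c \<in> T" by blast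
    then have "(\<phi>, x) \<in> ?R \<inter> (states Z \<times> K)" by (simp add: representing_states_def)
    then show "x \<in> snd ` (?R \<inter> (states Z \<times> K))" by (rule image_eqI[rotated]) simp
  qed (auto simp: representing_states_def)
  ultimately show ?thesis by (simp add: compact_imp_closed)
qed

lemma convex_representing_states:
  assumes "\<phi> \<in> representing_states Z x" "\<psi> \<in> representing_states Z y"
    and uv: "0 \<le> u" "0 \<le> v" "u + v = (1::real)"
  shows "(\<lambda>h. u * \<phi> h + v * \<psi> h) \<in> representing_states Z (u *\<^sub>R x + v *\<^sub>R y)"
  using assms convex_state[OF _ _ uv]
  by (auto simp: representing_states_def linear_add[OF continuous_dualD(1)] linear_scale[OF continuous_dualD(1)])

section \<open>Representing states and the minimal cost\<close>

text \<open>The two arguments of \<open>d_star\<close> become a single point of one convex set, so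
  that convexity and stability are those of \<open>K\<close>; the cost is any continuous function on
  its extreme points.\<close>

locale stable_compact =
  fixes K :: "'a::locally_convex_t2_space set" and c :: "'a \<Rightarrow> real"
  assumes K: "compact K" "stable_convex K"
    and Z: "compact (Ext K)" "cozero_space (Ext K)"
    and c: "continuous_on (Ext K) c"
begin

lemma convex_K: "convex K" using K by (simp add: stable_convex_def)

lemma Ext_subset: "Ext K \<subseteq> K" by (auto simp: Ext_def extreme_point_of_def)

lemma eval_representing:
  assumes "e \<in> Ext K"
  shows "(\<lambda>h. if continuous_on (Ext K) h then h e else 0) \<in> representing_states (Ext K) e"
  using eval_state[OF assms] continuous_dualD(2) by (auto simp: representing_states_def)

text \<open>The representable points form a closed convex set, and evaluation represents each
  extreme point; Krein--Milman then reaches all of \<open>K\<close>.\<close>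

lemma representing_states_nonempty:
  assumes "x \<in> K"
  shows "representing_states (Ext K) x \<noteq> {}"
proof -
  let ?S = "{x\<in>K. \<exists>\<phi>\<in>representing_states (Ext K) x. \<phi> c \<in> UNIV}"
  have "closed ?S" by (rule closed_representable[OF K(1) Z(1) closed_UNIV])
  moreover have "convex ?S"
  proof (rule convexI)
    fix x y and u v :: real
    assume *: "x \<in> ?S" "y \<in> ?S" and uv: "0 \<le> u" "0 \<le> v" "u + v = 1"
    then obtain \<phi> \<psi> where "\<phi> \<in> representing_states (Ext K) x" "\<psi> \<in> representing_states (Ext K) y" by auto
    then show "u *\<^sub>R x + v *\<^sub>R y \<in> ?S"
      using convex_representing_states[OF _ _ uv] convexD[OF convex_K _ _ uv] * by blast
  qed
  moreover have "Ext K \<subseteq> ?S" using eval_representing Ext_subset by blast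
  ultimately have "K \<subseteq> ?S" by (rule krein_milman_subset[OF K(1) convex_K])
  then show ?thesis using assms by auto
qed

definition min_cost where "min_cost x = (INF \<phi>\<in>representing_states (Ext K) x. \<phi> c)"

lemma cost_bound: obtains B where "0 < B" "\<And>\<phi> x. \<phi> \<in> representing_states (Ext K) x \<Longrightarrow> \<bar>\<phi> c\<bar> \<le> B"
proof -
  obtain B where "0 < B" "\<And>z. z \<in> Ext K \<Longrightarrow> \<bar>c z\<bar> \<le> B" using compact_bound_real[OF Z(1) c] by metis
  then show thesis using that[of B] state_abs_le[OF _ c] representing_statesD(1) by blast
qed

lemma min_cost_le: "\<phi> \<in> representing_states (Ext K) x \<Longrightarrow> min_cost x \<le> \<phi> c"
proof -
  assume p: "\<phi> \<in> representing_states (Ext K) x"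
  obtain B where B: "\<And>\<phi> x. \<phi> \<in> representing_states (Ext K) x \<Longrightarrow> \<bar>\<phi> c\<bar> \<le> B" using cost_bound by metis
  have "bdd_below ((\<lambda>\<phi>. \<phi> c) ` representing_states (Ext K) x)"
  proof (rule bdd_belowI2)
    fix \<psi> assume "\<psi> \<in> representing_states (Ext K) x"
    then show "- B \<le> \<psi> c" using B[of \<psi> x] by linarith
  qed
  then show ?thesis unfolding min_cost_def using p by (rule cINF_lower)
qed

lemma min_cost_attained:
  assumes "x \<in> K"
  obtains \<phi> where "\<phi> \<in> representing_states (Ext K) x" "\<phi> c = min_cost x"
proof -
  have ev: "continuous_on S (\<lambda>\<phi>. \<phi> h)" for S :: "(('a \<Rightarrow> real) \<Rightarrow> real) set" and h
    by (rule continuous_on_product_then_coordinatewise[OF continuous_on_id])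
  have "closed {\<phi> :: ('a \<Rightarrow> real) \<Rightarrow> real. f \<in> continuous_dual \<longrightarrow> \<phi> f = f x}" for f
    by (cases "f \<in> continuous_dual") (auto intro!: closed_Collect_eq ev continuous_on_const)
  then have "closed {\<phi> :: ('a \<Rightarrow> real) \<Rightarrow> real. \<forall>f. f \<in> continuous_dual \<longrightarrow> \<phi> f = f x}"
    by (rule closed_Collect_all)
  then have "compact ({\<phi>. \<forall>f. f \<in> continuous_dual \<longrightarrow> \<phi> f = f x} \<inter> states (Ext K))"
    by (intro closed_Int_compact compact_states Z)
  moreover have "{\<phi>. \<forall>f. f \<in> continuous_dual \<longrightarrow> \<phi> f = f x} \<inter> states (Ext K) = representing_states (Ext K) x"
    by (auto simp: representing_states_def)
  ultimately have "compact (representing_states (Ext K) x)" by simp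
  then obtain \<phi> where p: "\<phi> \<in> representing_states (Ext K) x"
    and le: "\<And>\<psi>. \<psi> \<in> representing_states (Ext K) x \<Longrightarrow> \<phi> c \<le> \<psi> c"
    using continuous_attains_inf[OF _ representing_states_nonempty[OF assms] ev] by metis
  have "\<phi> c \<le> min_cost x" unfolding min_cost_def by (intro cINF_greatest representing_states_nonempty[OF assms] le)
  then show thesis using that[OF p] min_cost_le[OF p] by simp
qed

lemma closed_min_cost_le: "closed {x\<in>K. min_cost x \<le> t}"
proof -
  have "{x\<in>K. min_cost x \<le> t} = {x\<in>K. \<exists>\<phi>\<in>representing_states (Ext K) x. \<phi> c \<in> {..t}}"
  proof (intro equalityI subsetI)
    fix x assume x: "x \<in> {x\<in>K. min_cost x \<le> t}"
    then obtain \<phi> where "\<phi> \<in> representing_states (Ext K) x" "\<phi> c = min_cost x" using min_cost_attained by blast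
    then show "x \<in> {x\<in>K. \<exists>\<phi>\<in>representing_states (Ext K) x. \<phi> c \<in> {..t}}" using x by (auto intro!: bexI[of _ \<phi>])
  next
    fix x assume "x \<in> {x\<in>K. \<exists>\<phi>\<in>representing_states (Ext K) x. \<phi> c \<in> {..t}}"
    then obtain \<phi> where "x \<in> K" "\<phi> \<in> representing_states (Ext K) x" "\<phi> c \<le> t" by auto
    then show "x \<in> {x\<in>K. min_cost x \<le> t}" using min_cost_le[of \<phi> x] by auto
  qed
  then show ?thesis by (simp only: closed_representable[OF K(1) Z(1) closed_atMost])
qed

lemma min_cost_convex_le:
  assumes "x \<in> K" "y \<in> K" and uv: "0 \<le> u" "0 \<le> v" "u + v = 1"
  shows "min_cost (u *\<^sub>R x + v *\<^sub>R y) \<le> u * min_cost x + v * min_cost y"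
proof -
  obtain \<phi> where "\<phi> \<in> representing_states (Ext K) x" "\<phi> c = min_cost x" by (rule min_cost_attained[OF assms(1)])
  moreover obtain \<psi> where "\<psi> \<in> representing_states (Ext K) y" "\<psi> c = min_cost y" by (rule min_cost_attained[OF assms(2)])
  ultimately show ?thesis using min_cost_le[OF convex_representing_states[OF _ _ uv]] by fastforce
qed

lemma min_cost_extreme: "e \<in> Ext K \<Longrightarrow> min_cost e \<le> c e"
  using min_cost_le[OF eval_representing[of e]] c by simp

text \<open>Every state representing \<open>e\<close> has cost exactly \<open>c e\<close>, so
  \<open>e\<close> avoids the closed set of points admitting some state of cost at least
  \<open>c e + r\<close>. Off this set every representing state is cheaper.\<close>

lemma min_cost_near_extreme:
  assumes e: "e \<in> Ext K" and r: "0 < r"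
  shows "\<exists>U. open U \<and> e \<in> U \<and> (\<forall>x\<in>U \<inter> K. min_cost x \<le> c e + r)"
proof -
  let ?S = "{x\<in>K. \<exists>\<phi>\<in>representing_states (Ext K) x. \<phi> c \<in> {c e + r..}}"
  have "closed ?S" by (rule closed_representable[OF K(1) Z(1) closed_atLeast])
  moreover have "e \<notin> ?S"
    using representing_state_extreme[OF K(1) convex_K Z Ext_subset e e _ c] r by fastforce
  moreover have "min_cost x \<le> c e + r" if x: "x \<in> - ?S \<inter> K" for x
  proof -
    obtain \<phi> where p: "\<phi> \<in> representing_states (Ext K) x" using representing_states_nonempty x by blast
    then have "\<phi> c < c e + r" using x by (auto simp: not_le)
    then show ?thesis using min_cost_le[OF p] by simp
  qed
  ultimately show ?thesis by (intro exI[of _ "- ?S"]) auto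
qed

text \<open>The upper semicontinuous envelope of \<open>min_cost\<close>.  Stability makes it midpoint convex.\<close>

definition upper_cost where "upper_cost x = Inf {t. \<exists>V. open V \<and> x \<in> V \<and> (\<forall>y\<in>V \<inter> K. min_cost y \<le> t)}"

lemma min_cost_bound: obtains B where "0 < B" "\<And>x. x \<in> K \<Longrightarrow> \<bar>min_cost x\<bar> \<le> B"
  using cost_bound min_cost_attained by metis

lemma upper_cost_bdd_below:
  assumes "x \<in> K"
  shows "bdd_below {t. \<exists>V. open V \<and> x \<in> V \<and> (\<forall>y\<in>V \<inter> K. min_cost y \<le> t)}"
  by (rule bdd_belowI[of _ "min_cost x"]) (use assms in auto)

lemma upper_cost_le:
  assumes "x \<in> K" "open V" "x \<in> V" "\<And>y. y \<in> V \<inter> K \<Longrightarrow> min_cost y \<le> t"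
  shows "upper_cost x \<le> t"
  unfolding upper_cost_def using assms by (intro cInf_lower upper_cost_bdd_below) auto

lemma upper_cost_less:
  assumes "x \<in> K" "upper_cost x < t"
  shows "\<exists>V. open V \<and> x \<in> V \<and> (\<forall>y\<in>V \<inter> K. min_cost y \<le> t)"
proof -
  obtain B where B: "\<And>x. x \<in> K \<Longrightarrow> \<bar>min_cost x\<bar> \<le> B" using min_cost_bound by metis
  \<comment> \<open>The neighbourhood \<open>UNIV\<close> and a global bound show that the infimum
    is not over the empty set.\<close>
  have "B \<in> {t. \<exists>V. open V \<and> x \<in> V \<and> (\<forall>y\<in>V \<inter> K. min_cost y \<le> t)}"
    using B by (auto intro!: exI[of _ UNIV] simp: abs_le_iff)
  then have ne: "{t. \<exists>V. open V \<and> x \<in> V \<and> (\<forall>y\<in>V \<inter> K. min_cost y \<le> t)} \<noteq> {}" by blast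
  obtain s where s: "s \<in> {t. \<exists>V. open V \<and> x \<in> V \<and> (\<forall>y\<in>V \<inter> K. min_cost y \<le> t)}" "s < t"
    using cInf_lessD[OF ne assms(2)[unfolded upper_cost_def]] by blast
  then obtain V where V: "open V" "x \<in> V" "\<forall>y\<in>V \<inter> K. min_cost y \<le> s" by blast
  have "min_cost y \<le> t" if "y \<in> V \<inter> K" for y using bspec[OF V(3) that] s(2) by simp
  then show ?thesis using V(1,2) by blast
qed

lemma min_cost_le_upper_cost: "x \<in> K \<Longrightarrow> min_cost x \<le> upper_cost x"
  by (rule dense_ge) (metis upper_cost_less IntI)

lemma upper_cost_midpoint:
  assumes xy: "x \<in> K" "y \<in> K"
  shows "upper_cost (midpoint x y) \<le> (upper_cost x + upper_cost y) / 2"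
proof (rule field_le_epsilon)
  fix r :: real assume r: "0 < r"
  obtain V where V: "open V" "x \<in> V" "\<forall>z\<in>V \<inter> K. min_cost z \<le> upper_cost x + r"
    using upper_cost_less[OF xy(1), of "upper_cost x + r"] r by (metis less_add_same_cancel1)
  obtain W where W: "open W" "y \<in> W" "\<forall>z\<in>W \<inter> K. min_cost z \<le> upper_cost y + r"
    using upper_cost_less[OF xy(2), of "upper_cost y + r"] r by (metis less_add_same_cancel1)
  have "openin (top_of_set (K \<times> K)) ((K \<times> K) \<inter> (V \<times> W))"
    using V(1) W(1) by (intro openin_open_Int open_Times)
  \<comment> \<open>Openness of the midpoint map: all points of \<open>K\<close> near
    \<open>midpoint x y\<close> are midpoints of one point in \<open>V\<close> and one in
    \<open>W\<close>, where \<open>min_cost\<close> is under control.\<close>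
  then have "openin (top_of_set K) ((\<lambda>(x, y). midpoint x y) ` ((K \<times> K) \<inter> (V \<times> W)))"
    using K(2) unfolding stable_convex_def open_map_def by blast
  then obtain T where T: "open T" "(\<lambda>(x, y). midpoint x y) ` ((K \<times> K) \<inter> (V \<times> W)) = K \<inter> T"
    by (auto simp: openin_open)
  have mK: "midpoint x y \<in> K \<inter> T" unfolding T(2)[symmetric] using xy V W by force
  show "upper_cost (midpoint x y) \<le> (upper_cost x + upper_cost y) / 2 + r"
  proof (rule upper_cost_le[OF _ T(1)])
    fix z assume "z \<in> T \<inter> K"
    then have "z \<in> (\<lambda>(x, y). midpoint x y) ` ((K \<times> K) \<inter> (V \<times> W))" using T(2) by auto
    then obtain a b where ab: "a \<in> V \<inter> K" "b \<in> W \<inter> K" "z = midpoint a b" by auto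
    have "min_cost z = min_cost ((1/2) *\<^sub>R a + (1/2) *\<^sub>R b)"
      unfolding ab(3) by (simp add: midpoint_def scaleR_add_right inverse_eq_divide)
    also have "\<dots> \<le> (1/2) * min_cost a + (1/2) * min_cost b" using ab by (intro min_cost_convex_le) auto
    also have "\<dots> \<le> (upper_cost x + upper_cost y) / 2 + r" using bspec[OF V(3) ab(1)] bspec[OF W(3) ab(2)] by (simp add: field_simps)
    finally show "min_cost z \<le> (upper_cost x + upper_cost y) / 2 + r" .
  qed (use mK in auto)
qed

lemma convex_on_upper_cost: "convex_on K upper_cost"
proof -
  obtain B where B: "\<And>x. x \<in> K \<Longrightarrow> \<bar>min_cost x\<bar> \<le> B" using min_cost_bound by metis
  have "\<bar>upper_cost x\<bar> \<le> B" if x: "x \<in> K" for x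
    using min_cost_le_upper_cost[OF x] B[OF x] upper_cost_le[OF x open_UNIV, of B] B by (auto simp: abs_le_iff)
  then show ?thesis by (intro midpoint_convex_bounded_convex_on convex_K upper_cost_midpoint)
qed

text \<open>A partition of unity decomposes the state into pieces whose barycenters lie so close to
  extreme points that \<open>upper_cost\<close> is almost bounded by the cost there; convexity of
  \<open>upper_cost\<close> then reassembles the pieces.\<close>

lemma upper_cost_le_state:
  assumes x: "x \<in> K" and phi: "\<phi> \<in> representing_states (Ext K) x"
  shows "upper_cost x \<le> \<phi> c"
proof (rule field_le_epsilon)
  fix r :: real assume r: "0 < r"
  note st = representing_statesD(1)[OF phi]
  \<comment> \<open>\<open>N e\<close> serves the partition of unity, and the closed convex
    \<open>S e\<close> catches the barycenter of a piece living on \<open>N e\<close>. One half of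
    \<open>r\<close> is spent on \<open>upper_cost\<close> over \<open>S e\<close>, the other on the
    variation of \<open>c\<close> over \<open>N e\<close>.\<close>
  have "\<exists>N S. e \<in> Ext K \<longrightarrow> (open N \<and> e \<in> N \<and> N \<inter> K \<subseteq> S \<and> closed S \<and> convex S
      \<and> (\<forall>y\<in>S \<inter> K. upper_cost y \<le> c e + r / 2) \<and> (\<forall>z\<in>N \<inter> Ext K. c e - r / 2 \<le> c z))" for e
  proof (cases "e \<in> Ext K")
    case True
    obtain U where U: "open U" "e \<in> U" "\<forall>y\<in>U \<inter> K. min_cost y \<le> c e + r / 2"
      using min_cost_near_extreme[OF True half_gt_zero[OF r]] by blast
    have GU: "upper_cost y \<le> c e + r / 2" if "y \<in> U \<inter> K" for y
      using that U by (intro upper_cost_le[of y U]) auto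
    obtain W S where WS: "open W" "e \<in> W" "W \<subseteq> S" "closed S" "convex S" "S \<inter> K \<subseteq> U"
      using compact_convex_neighbourhood[OF K(1) U(1,2)] by metis
    obtain A where A: "open A" "A \<inter> Ext K = c -` {c e - r / 2<..} \<inter> Ext K"
      using c open_greaterThan unfolding continuous_on_open_invariant by metis
    have "e \<in> A" using A(2) True r by auto
    moreover have "c e - r / 2 \<le> c z" if "z \<in> A \<inter> Ext K" for z
    proof -
      have "z \<in> c -` {c e - r / 2<..} \<inter> Ext K" using that unfolding A(2) .
      then show ?thesis by simp
    qed
    ultimately show ?thesis using WS A(1) GU
      by (intro exI[of _ "W \<inter> A"] exI[of _ S]) auto
  qed simp
  then obtain N S where *: "\<forall>e. e \<in> Ext K \<longrightarrow> (open (N e) \<and> e \<in> N e \<and> N e \<inter> K \<subseteq> S e \<and> closed (S e)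
      \<and> convex (S e) \<and> (\<forall>y\<in>S e \<inter> K. upper_cost y \<le> c e + r / 2) \<and> (\<forall>z\<in>N e \<inter> Ext K. c e - r / 2 \<le> c z))"
    by metis
  then have NS: "\<And>e. e \<in> Ext K \<Longrightarrow> open (N e)" "\<And>e. e \<in> Ext K \<Longrightarrow> e \<in> N e"
    "\<And>e. e \<in> Ext K \<Longrightarrow> N e \<inter> K \<subseteq> S e" "\<And>e. e \<in> Ext K \<Longrightarrow> closed (S e)" "\<And>e. e \<in> Ext K \<Longrightarrow> convex (S e)"
    and GS: "\<And>e y. e \<in> Ext K \<Longrightarrow> y \<in> S e \<inter> K \<Longrightarrow> upper_cost y \<le> c e + r / 2"
    and cO: "\<And>e z. e \<in> Ext K \<Longrightarrow> z \<in> N e \<inter> Ext K \<Longrightarrow> c e - r / 2 \<le> c z"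
    by blast+
  have "Ext K \<subseteq> (\<Union>e\<in>Ext K. N e)" using NS(2) by auto
  then obtain I where I: "I \<subseteq> Ext K" "finite I" "Ext K \<subseteq> (\<Union>e\<in>I. N e)"
    using compactE_image[OF Z(1), of "Ext K" N, OF NS(1)] by blast
  obtain w where wc: "\<And>e. e \<in> I \<Longrightarrow> continuous_on (Ext K) (w e)"
    and w0: "\<And>e z. e \<in> I \<Longrightarrow> z \<in> Ext K \<Longrightarrow> 0 \<le> w e z"
    and wO: "\<And>e z. e \<in> I \<Longrightarrow> z \<in> Ext K \<Longrightarrow> z \<notin> N e \<Longrightarrow> w e z = (0::real)"
    and w1: "\<And>z. z \<in> Ext K \<Longrightarrow> (\<Sum>e\<in>I. w e z) = 1"
  proof (rule partition_of_unity[OF Z(2) I(2), of N])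
    show "open (N e)" if "e \<in> I" for e using that I(1) NS(1) by blast
    show "Ext K \<subseteq> (\<Union>e\<in>I. N e)" by (rule I(3))
  qed (rule that)
  define J where "J = {e\<in>I. \<phi> (w e) \<noteq> 0}"
  have J: "finite J" "J \<subseteq> I" using I by (auto simp: J_def)
  have phi_w: "0 \<le> \<phi> (w e)" if "e \<in> I" for e using that by (intro state_nonneg[OF st] wc w0)
  have split: "\<phi> h = (\<Sum>e\<in>J. \<phi> (\<lambda>z. w e z * h z))" if h: "continuous_on (Ext K) h" for h
  proof -
    have "\<phi> h = \<phi> (\<lambda>z. \<Sum>e\<in>I. w e z * h z)"
      by (intro state_cong[OF st] continuous_intros wc h) (simp_all add: sum_distrib_right[symmetric] w1)
    also have "\<dots> = (\<Sum>e\<in>I. \<phi> (\<lambda>z. w e z * h z))"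
      by (intro state_sum[OF st] continuous_intros wc h)
    also have "\<dots> = (\<Sum>e\<in>J. \<phi> (\<lambda>z. w e z * h z))"
      using I(2) wc w0 by (intro sum.mono_neutral_right) (auto simp: J_def intro!: state_mult_null[OF st Z(1)] h)
    finally show ?thesis .
  qed
  have sumJ: "(\<Sum>e\<in>J. \<phi> (w e)) = 1"
    using split[of "\<lambda>_. 1"] state_one[OF st] by simp
  have "\<exists>y. e \<in> J \<longrightarrow> y \<in> K \<inter> S e \<and> (\<forall>f\<in>continuous_dual. \<phi> (\<lambda>z. w e z * f z) = \<phi> (w e) * f y)" for e
  proof (cases "e \<in> J")
    case True
    then have eI: "e \<in> I" and eE: "e \<in> Ext K" using J I by auto
    have pos: "0 < \<phi> (w e)" using phi_w[OF eI] True by (simp add: J_def)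
    let ?p = "\<lambda>h. if continuous_on (Ext K) h then \<phi> (\<lambda>z. w e z * h z) / \<phi> (w e) else 0"
    have p: "?p \<in> states (Ext K)"
      using conditional_state[of \<phi> "Ext K" "w e"] st wc[OF eI] w0[OF eI] pos by blast
    obtain y where y: "y \<in> K \<inter> S e" "?p \<in> representing_states (Ext K) y"
    proof (rule barycenter_exists[OF Z p, of "N e" "K \<inter> S e"])
      fix h :: "'a \<Rightarrow> real"
      assume h: "continuous_on (Ext K) h" "\<And>z. z \<in> Ext K \<inter> N e \<Longrightarrow> h z = 0"
      \<comment> \<open>The piece of the state cut out by \<open>w e\<close> lives on
        \<open>N e\<close>, so its barycenter can be placed in
        \<open>K \<inter> S e\<close>.\<close>
      have "w e z * h z = 0" if "z \<in> Ext K" for z using wO[OF eI that] h(2)[of z] that by auto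
      then have "\<phi> (\<lambda>z. w e z * h z) = 0"
        using wc[OF eI] h(1) by (intro state_eq_0[OF st] continuous_intros)
      then show "?p h = 0" by simp
    next
      show "compact (K \<inter> S e)" using K(1) NS(4)[OF eE] by (rule compact_Int_closed)
      show "convex (K \<inter> S e)" using convex_K NS(5)[OF eE] by (rule convex_Int)
      show "Ext K \<inter> N e \<subseteq> K \<inter> S e" using NS(3)[OF eE] Ext_subset by auto
    qed
    have "\<phi> (\<lambda>z. w e z * f z) = \<phi> (w e) * f y" if f: "f \<in> continuous_dual" for f
      using representing_statesD(2)[OF y(2) f] continuous_dualD(2)[OF f, of "Ext K"] pos
      by (simp add: field_simps)
    then show ?thesis using y(1) by blast
  qed simp
  then obtain y where y: "\<And>e. e \<in> J \<Longrightarrow> y e \<in> K \<inter> S e"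
    and yf: "\<And>e f. e \<in> J \<Longrightarrow> f \<in> continuous_dual \<Longrightarrow> \<phi> (\<lambda>z. w e z * f z) = \<phi> (w e) * f (y e)"
    by metis
  have "x = (\<Sum>e\<in>J. \<phi> (w e) *\<^sub>R y e)"
  proof (rule continuous_dual_inject)
    fix f :: "'a \<Rightarrow> real" assume f: "f \<in> continuous_dual"
    show "f x = f (\<Sum>e\<in>J. \<phi> (w e) *\<^sub>R y e)"
      unfolding continuous_dual_sum[OF f] representing_statesD(2)[OF phi f, symmetric]
      using split[OF continuous_dualD(2)[OF f]] yf[OF _ f] by simp
  qed
  then have "upper_cost x \<le> (\<Sum>e\<in>J. \<phi> (w e) * upper_cost (y e))"
    using convex_on_sum[OF J(1) _ convex_on_upper_cost sumJ, of y] phi_w J y sumJ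
    by (metis (no_types, lifting) IntD1 subsetD sum.empty zero_neq_one)
  also have "\<dots> \<le> (\<Sum>e\<in>J. \<phi> (\<lambda>z. w e z * c z) + r * \<phi> (w e))"
  proof (rule sum_mono)
    fix e assume e: "e \<in> J"
    then have eI: "e \<in> I" and eE: "e \<in> Ext K" using J I by auto
    have "\<phi> (w e) * upper_cost (y e) \<le> \<phi> (w e) * (c e + r / 2)"
      using phi_w[OF eI] GS[OF eE, of "y e"] y[OF e] by (intro mult_left_mono) auto
    \<comment> \<open>Writing \<open>c e + r / 2\<close> as \<open>(c e - r / 2) + r\<close>
      isolates a constant that lies below \<open>c\<close> on \<open>N e\<close>, outside of which
      \<open>w e\<close> vanishes.\<close>
    also have "\<dots> = \<phi> (\<lambda>z. (c e - r / 2) * w e z) + r * \<phi> (w e)"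
      by (simp only: state_scale[OF st wc[OF eI]]) (simp add: field_simps)
    also have "\<phi> (\<lambda>z. (c e - r / 2) * w e z) \<le> \<phi> (\<lambda>z. w e z * c z)"
    proof (intro state_mono[OF st] continuous_intros wc eI c)
      fix z assume z: "z \<in> Ext K"
      show "(c e - r / 2) * w e z \<le> w e z * c z"
      proof (cases "z \<in> N e")
        case True
        then show ?thesis using cO[OF eE, of z] w0[OF eI z] z
          by (subst mult.commute) (intro mult_left_mono; auto)
      next
        case False
        then show ?thesis using wO[OF eI z] by simp
      qed
    qed
    finally show "\<phi> (w e) * upper_cost (y e) \<le> \<phi> (\<lambda>z. w e z * c z) + r * \<phi> (w e)" by simp
  qed
  also have "\<dots> = \<phi> c + r"
    using split[OF c] sumJ by (simp add: sum.distrib sum_distrib_left[symmetric])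
  finally show "upper_cost x \<le> \<phi> c + r" .
qed

theorem continuous_on_min_cost: "continuous_on K min_cost"
  unfolding continuous_on_def
proof (intro ballI order_tendstoI)
  fix x t assume x: "x \<in> K" and t: "t < min_cost x"
  show "eventually (\<lambda>y. t < min_cost y) (at x within K)"
    unfolding eventually_at_topological
    using closed_min_cost_le[of t] x t by (intro exI[of _ "- {x\<in>K. min_cost x \<le> t}"]) auto
next
  fix x t assume x: "x \<in> K" and t: "min_cost x < t"
  obtain \<phi> where "\<phi> \<in> representing_states (Ext K) x" "\<phi> c = min_cost x" by (rule min_cost_attained[OF x])
  then have "upper_cost x \<le> min_cost x" using upper_cost_le_state[OF x] by metis
  \<comment> \<open>An intermediate level is taken because \<open>upper_cost_less\<close> yields
    only a weak inequality on the neighbourhood.\<close>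
  then have "upper_cost x < (min_cost x + t) / 2" using t by simp
  then obtain V where V: "open V" "x \<in> V" "\<forall>y\<in>V \<inter> K. min_cost y \<le> (min_cost x + t) / 2"
    using upper_cost_less[OF x] by blast
  have "min_cost y < t" if "y \<in> V" "y \<in> K" for y
    using bspec[OF V(3), of y] that t by simp
  then show "eventually (\<lambda>y. min_cost y < t) (at x within K)"
    unfolding eventually_at_topological using V(1,2) by blast
qed

end

section \<open>Couplings on the square of the convex set\<close>

text \<open>The function is the distance to \<open>Z - U\<close>. It is continuous in the given
  topology because it is 1-Lipschitz for \<open>D\<close> and each \<open>D z\<close> is continuous,
  and it is positive on \<open>U\<close> because the infimum is attained on the compact set
  \<open>Z - U\<close>.\<close>

lemma cozero_space_of_metric:
  assumes "Metric_space Z D" and Z: "compact Z" and cont: "\<And>z. z \<in> Z \<Longrightarrow> continuous_on Z (D z)"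
  shows "cozero_space Z"
  unfolding cozero_space_def
proof (intro allI impI)
  interpret Metric_space Z D by fact
  fix U :: "'a set" assume U: "open U"
  show "\<exists>u::'a \<Rightarrow> real. continuous_on Z u \<and> (\<forall>z\<in>Z. 0 \<le> u z) \<and> (\<forall>z\<in>Z. z \<in> U \<longleftrightarrow> 0 < u z)"
  \<comment> \<open>If \<open>Z - U\<close> is empty, the distance to it would be an infimum over
    the empty set.\<close>
  proof (cases "Z \<subseteq> U")
    case True
    then show ?thesis by (intro exI[of _ "\<lambda>_. 1"]) auto
  next
    case False
    define u where "u z = (INF w\<in>Z - U. D z w)" for z
    have ne: "Z - U \<noteq> {}" using False by auto
    have cK: "compact (Z - U)" using Z U by (rule compact_diff)
    have le: "u z \<le> D z w" if "w \<in> Z - U" for z w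
      unfolding u_def using that by (intro cINF_lower bdd_belowI2[of _ 0]) auto
    have ge: "a \<le> u z" if "\<And>w. w \<in> Z - U \<Longrightarrow> a \<le> D z w" for a z
      unfolding u_def using that ne by (intro cINF_greatest)
    have lip: "u z - u y \<le> D z y" if "z \<in> Z" "y \<in> Z" for z y
    proof -
      have "u z - D z y \<le> u y"
      proof (rule ge)
        fix w assume w: "w \<in> Z - U"
        then show "u z - D z y \<le> D y w" using le[OF w, of z] triangle[of z y w] that by auto
      qed
      then show ?thesis by simp
    qed
    have "continuous_on Z u"
      unfolding continuous_on_def
    proof
      fix z assume z: "z \<in> Z"
      have "(D z \<longlongrightarrow> D z z) (at z within Z)" using cont[OF z] z unfolding continuous_on_def by blast
      moreover have "D z z = 0" using z by simp
      ultimately have "(D z \<longlongrightarrow> 0) (at z within Z)" by (simp only:)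
      moreover have "eventually (\<lambda>y. norm (u y - u z) \<le> D z y) (at z within Z)"
        unfolding eventually_at_topological
        using lip[OF z] lip[OF _ z] commute by (intro exI[of _ UNIV]) (auto simp: abs_le_iff)
      ultimately have "((\<lambda>y. u y - u z) \<longlongrightarrow> 0) (at z within Z)" by (rule Lim_null_comparison[rotated])
      then show "(u \<longlongrightarrow> u z) (at z within Z)" by (rule LIM_zero_cancel)
    qed
    moreover have "0 \<le> u z" for z by (rule ge) simp
    moreover have "z \<in> U \<longleftrightarrow> 0 < u z" if z: "z \<in> Z" for z
    proof
      assume zU: "z \<in> U"
      obtain w where w: "w \<in> Z - U" "\<forall>v\<in>Z - U. D z w \<le> D z v"
        using continuous_attains_inf[OF cK ne continuous_on_subset[OF cont[OF z]]] by blast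
      have "D z w \<le> u z" using w(2) by (intro ge) auto
      moreover have "D z w \<noteq> 0" using z w(1) zU by auto
      ultimately show "0 < u z" using nonneg[of z w] by linarith
    next
      assume "0 < u z"
      then show "z \<in> U" using le[of z z] z by fastforce
    qed
    ultimately show ?thesis by blast
  qed
qed

section \<open>Extreme points and stability of products\<close>

lemma Ext_Times: "Ext (A \<times> B) = Ext A \<times> Ext B"
proof (intro equalityI subsetI)
  fix w assume w: "w \<in> Ext (A \<times> B)"
  obtain x y where xy: "w = (x, y)" by (cases w)
  have mem: "x \<in> A" "y \<in> B" and ex: "\<And>a b. a \<in> A \<times> B \<Longrightarrow> b \<in> A \<times> B \<Longrightarrow> (x, y) \<notin> open_segment a b"
    using w by (auto simp: xy Ext_def extreme_point_of_def)
  have "x \<notin> open_segment a b" if ab: "a \<in> A" "b \<in> A" for a b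
  proof
    assume "x \<in> open_segment a b"
    then obtain u where u: "a \<noteq> b" "0 < u" "u < 1" "x = (1 - u) *\<^sub>R a + u *\<^sub>R b" by (auto simp: in_segment)
    have "(x, y) = (1 - u) *\<^sub>R (a, y) + u *\<^sub>R (b, y)"
      using u(4) by (simp add: scaleR_left_distrib[symmetric])
    then have "(x, y) \<in> open_segment (a, y) (b, y)" using u unfolding in_segment by blast
    then show False using ex[of "(a, y)" "(b, y)"] mem ab by simp
  qed
  moreover have "y \<notin> open_segment a b" if ab: "a \<in> B" "b \<in> B" for a b
  proof
    assume "y \<in> open_segment a b"
    then obtain u where u: "a \<noteq> b" "0 < u" "u < 1" "y = (1 - u) *\<^sub>R a + u *\<^sub>R b" by (auto simp: in_segment)
    have "(x, y) = (1 - u) *\<^sub>R (x, a) + u *\<^sub>R (x, b)"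
      using u(4) by (simp add: scaleR_left_distrib[symmetric])
    then have "(x, y) \<in> open_segment (x, a) (x, b)" using u unfolding in_segment by blast
    then show False using ex[of "(x, a)" "(x, b)"] mem ab by simp
  qed
  ultimately show "w \<in> Ext A \<times> Ext B" using mem by (simp add: xy Ext_def extreme_point_of_def)
next
  fix w assume w: "w \<in> Ext A \<times> Ext B"
  obtain x y where xy: "w = (x, y)" by (cases w)
  have x: "x \<in> A" "\<And>a b. a \<in> A \<Longrightarrow> b \<in> A \<Longrightarrow> x \<notin> open_segment a b"
    and y: "y \<in> B" "\<And>a b. a \<in> B \<Longrightarrow> b \<in> B \<Longrightarrow> y \<notin> open_segment a b"
    using w by (auto simp: xy Ext_def extreme_point_of_def)
  have "(x, y) \<notin> open_segment p q" if pq: "p \<in> A \<times> B" "q \<in> A \<times> B" for p q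
  proof
    assume "(x, y) \<in> open_segment p q"
    then obtain u where u: "p \<noteq> q" "0 < u" "u < 1" "(x, y) = (1 - u) *\<^sub>R p + u *\<^sub>R q" by (auto simp: in_segment)
    then have "x = (1 - u) *\<^sub>R fst p + u *\<^sub>R fst q" "y = (1 - u) *\<^sub>R snd p + u *\<^sub>R snd q"
      by (metis fst_conv fst_add fst_scaleR, metis snd_conv snd_add snd_scaleR)
    \<comment> \<open>A segment in the product may be constant in one coordinate, but not in both;
      extremality is contradicted in a coordinate where it moves.\<close>
    moreover have "fst p \<noteq> fst q \<or> snd p \<noteq> snd q" using u(1) by (simp add: prod_eq_iff)
    ultimately have "x \<in> open_segment (fst p) (fst q) \<or> y \<in> open_segment (snd p) (snd q)"
      using u(2,3) unfolding in_segment by blast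
    then show False using x(2) y(2) pq by (auto simp: mem_Times_iff)
  qed
  then show "w \<in> Ext (A \<times> B)" using x(1) y(1) by (simp add: xy Ext_def extreme_point_of_def)
qed

lemma midpoint_Pair: "midpoint (a, b) (c, e) = (midpoint a c, midpoint b e)"
  by (simp add: midpoint_def)

text \<open>Up to exchanging the middle coordinates, the midpoint map of the product is the product
  of the midpoint maps. A box neighbourhood \<open>(P \<times> Q) \<times> (R \<times> S)\<close> is
  regrouped as \<open>P \<times> R\<close> in the first factor and \<open>Q \<times> S\<close> in
  the second.\<close>

lemma stable_convex_Times:
  fixes A :: "'a::{real_vector,topological_space} set" and B :: "'b::{real_vector,topological_space} set"
  assumes A: "stable_convex A" and B: "stable_convex B"
  shows "stable_convex (A \<times> B)"
proof -
  have oA: "openin (top_of_set A) ((\<lambda>(x, y). midpoint x y) ` U)"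
    if "openin (top_of_set (A \<times> A)) U" for U
    using A that by (auto simp: stable_convex_def open_map_def)
  have oB: "openin (top_of_set B) ((\<lambda>(x, y). midpoint x y) ` U)"
    if "openin (top_of_set (B \<times> B)) U" for U
    using B that by (auto simp: stable_convex_def open_map_def)
  have "openin (top_of_set (A \<times> B)) ((\<lambda>(x, y). midpoint x y) ` U)"
    if U: "openin (top_of_set ((A \<times> B) \<times> (A \<times> B))) U" for U
  proof (subst openin_subopen, intro ballI)
    fix m assume "m \<in> (\<lambda>(x, y). midpoint x y) ` U"
    then obtain a b c e where p: "((a, b), (c, e)) \<in> U" "m = (midpoint a c, midpoint b e)"
      by (force simp: midpoint_Pair)
    obtain T where T: "open T" "U = ((A \<times> B) \<times> (A \<times> B)) \<inter> T" using U by (auto simp: openin_open)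
    have "((a, b), (c, e)) \<in> T" using p(1) T(2) by simp
    then obtain T1 T2 where T12: "open T1" "open T2" "((a, b), (c, e)) \<in> T1 \<times> T2" "T1 \<times> T2 \<subseteq> T"
      by (rule open_prod_elim[OF T(1)])
    obtain P Q where PQ: "open P" "open Q" "(a, b) \<in> P \<times> Q" "P \<times> Q \<subseteq> T1"
      using open_prod_elim[OF T12(1)] T12(3) by (metis mem_Sigma_iff)
    obtain R S where RS: "open R" "open S" "(c, e) \<in> R \<times> S" "R \<times> S \<subseteq> T2"
      using open_prod_elim[OF T12(2)] T12(3) by (metis mem_Sigma_iff)
    let ?M = "((\<lambda>(x, y). midpoint x y) ` ((A \<times> A) \<inter> (P \<times> R))) \<times> ((\<lambda>(x, y). midpoint x y) ` ((B \<times> B) \<inter> (Q \<times> S)))"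
    have "openin (top_of_set (A \<times> B)) ?M"
      using PQ RS by (intro openin_Times oA oB openin_open_Int open_Times)
    moreover have "m \<in> ?M"
    proof -
      have "(a, c) \<in> (A \<times> A) \<inter> (P \<times> R)" "(b, e) \<in> (B \<times> B) \<inter> (Q \<times> S)"
        using p(1) T(2) PQ(3) RS(3) by auto
      then show ?thesis unfolding p(2) by force
    qed
    moreover have "?M \<subseteq> (\<lambda>(x, y). midpoint x y) ` U"
    proof
      fix w assume "w \<in> ?M"
      then obtain a' c' b' e' where w: "w = (midpoint a' c', midpoint b' e')"
        and "(a', c') \<in> (A \<times> A) \<inter> (P \<times> R)" "(b', e') \<in> (B \<times> B) \<inter> (Q \<times> S)" by auto
      then have "((a', b'), (c', e')) \<in> U" using PQ(4) RS(4) T12(4) T(2) by blast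
      then show "w \<in> (\<lambda>(x, y). midpoint x y) ` U"
        by (rule image_eqI[rotated]) (simp add: w midpoint_Pair)
    qed
    ultimately show "\<exists>T. openin (top_of_set (A \<times> B)) T \<and> m \<in> T \<and> T \<subseteq> (\<lambda>(x, y). midpoint x y) ` U"
      by blast
  qed
  then show ?thesis
    using A B by (simp add: stable_convex_def open_map_def convex_Times)
qed

lemma Ext_eq_not_midpoint:
  assumes C: "convex C"
  shows "Ext C = C - (\<lambda>(x, y). midpoint x y) ` ((C \<times> C) \<inter> {(x, y) |x y. x \<noteq> y})"
proof (intro equalityI subsetI)
  fix x assume x: "x \<in> Ext C"
  have mid: "midpoint a b \<in> open_segment a b" if "a \<noteq> b" for a b :: 'a
    using that unfolding in_segment
    by (auto intro!: exI[of _ "1 / 2"] simp: midpoint_def scaleR_add_right inverse_eq_divide)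
  then show "x \<in> C - (\<lambda>(x, y). midpoint x y) ` ((C \<times> C) \<inter> {(x, y) |x y. x \<noteq> y})"
  proof (intro DiffI notI)
    show "x \<in> C" using x by (simp add: Ext_def extreme_point_of_def)
    assume "x \<in> (\<lambda>(x, y). midpoint x y) ` ((C \<times> C) \<inter> {(x, y) |x y. x \<noteq> y})"
    then obtain a b where "a \<in> C" "b \<in> C" "a \<noteq> b" "x = midpoint a b" by auto
    then show False using x mid[of a b] unfolding Ext_def extreme_point_of_def by blast
  qed
next
  fix x assume x: "x \<in> C - (\<lambda>(x, y). midpoint x y) ` ((C \<times> C) \<inter> {(x, y) |x y. x \<noteq> y})"
  have "x \<notin> open_segment a b" if ab: "a \<in> C" "b \<in> C" for a b
  proof
    assume "x \<in> open_segment a b"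
    then obtain u where u: "a \<noteq> b" "0 < u" "u < 1" "x = (1 - u) *\<^sub>R a + u *\<^sub>R b" by (auto simp: in_segment)
    \<comment> \<open>The largest radius for which both \<open>u - r\<close> and
      \<open>u + r\<close> stay in \<open>[0, 1]\<close>: it recentres the segment so that
      \<open>x\<close> becomes a midpoint.\<close>
    define r where "r = min u (1 - u)"
    define p where "p s = (1 - s) *\<^sub>R a + s *\<^sub>R b" for s
    have p_eq: "p s = a + s *\<^sub>R (b - a)" for s by (simp add: p_def scaleR_diff_left scaleR_diff_right)
    have r: "0 < r" "r \<le> u" "r \<le> 1 - u" using u by (auto simp: r_def)
    have "p (u - r) \<in> C" "p (u + r) \<in> C"
      unfolding p_def using r u ab C by (auto intro!: convexD[OF C])
    moreover have "p (u - r) \<noteq> p (u + r)" using r(1) u(1) by (simp add: p_eq)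
    moreover have "x = midpoint (p (u - r)) (p (u + r))"
    proof -
      have "p (u - r) + p (u + r) = x + x"
        using p_eq[of u] by (simp add: p_eq u(4) p_def[symmetric] scaleR_diff_left scaleR_diff_right scaleR_left_distrib)
      then show ?thesis by (metis midpoint_eq_iff)
    qed
    ultimately show False using x by force
  qed
  then show "x \<in> Ext C" using x by (simp add: Ext_def extreme_point_of_def)
qed

text \<open>The non-extreme points are the image under the open midpoint map of the pairs of
  different points, an open set by the Hausdorff property; so \<open>Ext C\<close> is relatively
  closed.\<close>

lemma compact_Ext:
  fixes C :: "'a::{real_vector,t2_space} set"
  assumes "compact C" "stable_convex C"
  shows "compact (Ext C)"
proof -
  have "openin (top_of_set (C \<times> C)) ((C \<times> C) \<inter> {(x, y) |x y. x \<noteq> y})"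
    by (intro openin_open_Int open_diagonal_complement)
  then have "openin (top_of_set C) ((\<lambda>(x, y). midpoint x y) ` ((C \<times> C) \<inter> {(x, y) |x y. x \<noteq> y}))"
    using assms(2) unfolding stable_convex_def open_map_def by blast
  then obtain T where T: "open T"
    "(\<lambda>(x, y). midpoint x y) ` ((C \<times> C) \<inter> {(x, y) |x y. x \<noteq> y}) = C \<inter> T"
    by (auto simp: openin_open)
  have "Ext C = C - T"
    using Ext_eq_not_midpoint[of C] assms(2) unfolding T(2) stable_convex_def by blast
  then show ?thesis using assms(1) T(1) by (simp add: compact_diff)
qed

section \<open>Couplings as representing states on the square\<close>

lemma continuous_dual_fst:
  fixes f :: "'a::locally_convex_t2_space \<Rightarrow> real"
  assumes f: "f \<in> continuous_dual"
  shows "(\<lambda>w :: 'a \<times> 'b::locally_convex_t2_space. f (fst w)) \<in> continuous_dual"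
  unfolding continuous_dual_def
proof (intro CollectI conjI)
  show "linear (\<lambda>w :: 'a \<times> 'b. f (fst w))"
    using linear_compose[OF linear_fst continuous_dualD(1)[OF f]] unfolding o_def .
  show "continuous_on UNIV (\<lambda>w :: 'a \<times> 'b. f (fst w))"
    by (intro continuous_on_compose2[OF continuous_dualD(2)[OF f, of UNIV]] continuous_intros) auto
qed

lemma continuous_dual_snd:
  fixes f :: "'a::locally_convex_t2_space \<Rightarrow> real"
  assumes f: "f \<in> continuous_dual"
  shows "(\<lambda>w :: 'b::locally_convex_t2_space \<times> 'a. f (snd w)) \<in> continuous_dual"
  unfolding continuous_dual_def
proof (intro CollectI conjI)
  show "linear (\<lambda>w :: 'b \<times> 'a. f (snd w))"
    using linear_compose[OF linear_snd continuous_dualD(1)[OF f]] unfolding o_def .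
  show "continuous_on UNIV (\<lambda>w :: 'b \<times> 'a. f (snd w))"
    by (intro continuous_on_compose2[OF continuous_dualD(2)[OF f, of UNIV]] continuous_intros) auto
qed

lemma continuous_dual_prod_split:
  fixes g :: "'a::locally_convex_t2_space \<times> 'b::locally_convex_t2_space \<Rightarrow> real"
  assumes g: "g \<in> continuous_dual"
  shows "(\<lambda>a. g (a, 0)) \<in> continuous_dual" "(\<lambda>b. g (0, b)) \<in> continuous_dual"
    "g w = g (fst w, 0) + g (0, snd w)"
proof -
  note lin = continuous_dualD(1)[OF g] and cont = continuous_dualD(2)[OF g, of UNIV]
  have "linear (\<lambda>a. g (a, 0))"
    using linear_add[OF lin, of "(_, 0)" "(_, 0)"] linear_scale[OF lin, of _ "(_, 0)"]
    by (intro linearI) simp_all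
  moreover have "linear (\<lambda>b. g (0, b))"
    using linear_add[OF lin, of "(0, _)" "(0, _)"] linear_scale[OF lin, of _ "(0, _)"]
    by (intro linearI) simp_all
  ultimately show "(\<lambda>a. g (a, 0)) \<in> continuous_dual" "(\<lambda>b. g (0, b)) \<in> continuous_dual"
    unfolding continuous_dual_def by (auto intro!: continuous_on_compose2[OF cont] continuous_intros)
  show "g w = g (fst w, 0) + g (0, snd w)"
    using linear_add[OF lin, of "(fst w, 0)" "(0, snd w)"] by simp
qed

text \<open>A continuous form on the product is a sum of forms on the factors, so the two barycenter
  conditions on a coupling are the single condition of representing \<open>(x, y)\<close>.
  Integration leads from couplings to states and the Riesz theorem back; comparing the sets of costs
  is enough for the infimum.\<close>

lemma coupling_integrals:
  fixes C :: "'a::locally_convex_t2_space set"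
  assumes E: "compact (Ext C)" "cozero_space (Ext C \<times> Ext C)"
    and c: "continuous_on (Ext C \<times> Ext C) c"
  shows "(\<lambda>\<pi>. \<integral>w. c w \<partial>\<pi>) ` couplings C x y = (\<lambda>\<phi>. \<phi> c) ` representing_states (Ext C \<times> Ext C) (x, y)"
proof (intro equalityI subsetI)
  let ?Z = "Ext C \<times> Ext C"
  have Z: "compact ?Z" using E(1) by (simp add: compact_Times)
  {
    fix t assume "t \<in> (\<lambda>\<pi>. \<integral>w. c w \<partial>\<pi>) ` couplings C x y"
    then obtain \<pi> where pi: "\<pi> \<in> radon_prob ?Z" "t = (\<integral>w. c w \<partial>\<pi>)"
      and bary: "\<And>f. f \<in> continuous_dual \<Longrightarrow> (\<integral>w. f (fst w) \<partial>\<pi>) = f x"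
        "\<And>f. f \<in> continuous_dual \<Longrightarrow> (\<integral>w. f (snd w) \<partial>\<pi>) = f y"
      by (auto simp: couplings_def)
    have pr: "prob_space \<pi>" "sets \<pi> = sets (restrict_space borel ?Z)" using pi(1) by (auto simp: radon_prob_def)
    let ?p = "\<lambda>h. if continuous_on ?Z h then \<integral>z. h z \<partial>\<pi> else 0"
    have "?p g = g (x, y)" if g: "g \<in> continuous_dual" for g
    proof -
      note s = continuous_dual_prod_split[OF g]
      have "(\<integral>w. g w \<partial>\<pi>) = (\<integral>w. g (fst w, 0) + g (0, snd w) \<partial>\<pi>)" using s(3) by metis
      also have "\<dots> = (\<integral>w. g (fst w, 0) \<partial>\<pi>) + (\<integral>w. g (0, snd w) \<partial>\<pi>)"
        using continuous_dual_fst[OF s(1)] continuous_dual_snd[OF s(2)]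
        by (intro Bochner_Integration.integral_add integrable_continuous_compact[OF pr Z] continuous_dualD(2)) auto
      also have "\<dots> = g (x, y)" using bary(1)[OF s(1)] bary(2)[OF s(2)] s(3)[of "(x, y)"] by simp
      finally show ?thesis using continuous_dualD(2)[OF g] by simp
    qed
    then have "?p \<in> representing_states ?Z (x, y)"
      using integral_state[OF pr Z] by (simp add: representing_states_def)
    moreover have "t = ?p c" using pi(2) c by simp
    ultimately show "t \<in> (\<lambda>\<phi>. \<phi> c) ` representing_states ?Z (x, y)"
      by (intro image_eqI[of t "\<lambda>\<phi>. \<phi> c" ?p])
  next
    fix t assume "t \<in> (\<lambda>\<phi>. \<phi> c) ` representing_states ?Z (x, y)"
    then obtain \<phi> where phi: "\<phi> \<in> representing_states ?Z (x, y)" "t = \<phi> c" by blast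
    obtain M where M: "M \<in> radon_prob ?Z" "\<And>h. continuous_on ?Z h \<Longrightarrow> (\<integral>z. h z \<partial>M) = \<phi> h"
      using state_representation[OF Z E(2) representing_statesD(1)[OF phi(1)]] by blast
    have "(\<integral>w. f (fst w) \<partial>M) = f x \<and> (\<integral>w. f (snd w) \<partial>M) = f y" if f: "f \<in> continuous_dual" for f :: "'a \<Rightarrow> real"
      using representing_statesD(2)[OF phi(1) continuous_dual_fst[OF f]]
        representing_statesD(2)[OF phi(1) continuous_dual_snd[OF f]]
        M(2)[OF continuous_dualD(2)[OF continuous_dual_fst[OF f]]]
        M(2)[OF continuous_dualD(2)[OF continuous_dual_snd[OF f]]] by simp
    then have "M \<in> couplings C x y" using M(1) by (simp add: couplings_def)
    moreover have "t = (\<integral>w. c w \<partial>M)" using M(2)[OF c] phi(2) by simp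
    ultimately show "t \<in> (\<lambda>\<pi>. \<integral>w. c w \<partial>\<pi>) ` couplings C x y" by (rule rev_image_eqI)
  }
qed

section \<open>Chains and the transfer of continuity\<close>

lemma D_chain_le:
  fixes C :: "'a::locally_convex_t2_space set" and N :: nat
  assumes "1 \<le> N" "\<forall>j\<in>{1..N + 1}. z j \<in> C"
  shows "D_chain C d p (z 1) (z (N + 1)) \<le> (\<Sum>j=1..N. d_star C d p (z j) (z (j + 1)))"
  unfolding D_chain_def
proof (rule cInf_lower)
  let ?S = "\<lambda>n. {(\<Sum>j=1..N. d_star C d p (y j) (y (j + 1))) | (N::nat) (y::nat \<Rightarrow> 'a).
     1 \<le> N \<and> y 1 = z 1 \<and> y (N + 1) = z (n + 1) \<and> (\<forall>j\<in>{1..N + 1}. y j \<in> C)}"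
  show "bdd_below (?S N)"
    by (rule bdd_belowI[of _ 0]) (auto simp: d_star_def intro!: sum_nonneg)
  show "(\<Sum>j=1..N. d_star C d p (z j) (z (j + 1))) \<in> ?S N"
    by (rule CollectI, intro exI[of _ N] exI[of _ z]) (use assms in simp)
qed

lemma D_chain_less:
  fixes C :: "'a::locally_convex_t2_space set"
  assumes "x \<in> C" "y \<in> C" and less: "D_chain C d p x y < t"
  obtains N :: nat and z where "1 \<le> N" "z 1 = x" "z (N + 1) = y" "\<forall>j\<in>{1..N + 1}. z j \<in> C"
    "(\<Sum>j=1..N. d_star C d p (z j) (z (j + 1))) < t"
proof -
  let ?S = "{(\<Sum>j=1..N. d_star C d p (z j) (z (j + 1))) | (N::nat) (z::nat \<Rightarrow> 'a).
     1 \<le> N \<and> z 1 = x \<and> z (N + 1) = y \<and> (\<forall>j\<in>{1..N + 1}. z j \<in> C)}"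
  let ?z = "\<lambda>j::nat. if j = 1 then x else y"
  \<comment> \<open>The chain with the single step from \<open>x\<close> to \<open>y\<close> shows
    that there are chains at all.\<close>
  have "(\<Sum>j=1..1. d_star C d p (?z j) (?z (j + 1))) \<in> ?S"
    by (rule CollectI, intro exI[of _ 1] exI[of _ ?z] conjI refl) (use assms in auto)
  then have "?S \<noteq> {}" by blast
  then obtain r where "r \<in> ?S" "r < t"
    using cInf_lessD[of ?S t] less unfolding D_chain_def by blast
  then show thesis using that by blast
qed

lemma D_chain_append:
  assumes "x \<in> C" "y \<in> C" "w \<in> C"
  shows "D_chain C d p x w \<le> D_chain C d p x y + d_star C d p y w"
proof (rule field_le_epsilon)
  fix e :: real assume "0 < e"
  then have "D_chain C d p x y < D_chain C d p x y + e" by simp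
  then obtain N :: nat and z where z: "1 \<le> N" "z 1 = x" "z (N + 1) = y" "\<forall>j\<in>{1..N + 1}. z j \<in> C"
    "(\<Sum>j=1..N. d_star C d p (z j) (z (j + 1))) < D_chain C d p x y + e"
    by (rule D_chain_less[OF assms(1,2)]) (rule that)
  \<comment> \<open>A chain with \<open>N\<close> steps occupies the indices \<open>1\<close> to
    \<open>N + 1\<close>, so the new end point has index \<open>N + 2\<close>.\<close>
  let ?z = "z(N + 2 := w)"
  have "D_chain C d p x w \<le> (\<Sum>j=1..N + 1. d_star C d p (?z j) (?z (j + 1)))"
    using D_chain_le[of "N + 1" ?z C d p] z assms(3) by auto
  also have "\<dots> = (\<Sum>j=1..N. d_star C d p (?z j) (?z (j + 1))) + d_star C d p y w"
    using z(3) by simp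
  also have "(\<Sum>j=1..N. d_star C d p (?z j) (?z (j + 1))) = (\<Sum>j=1..N. d_star C d p (z j) (z (j + 1)))"
    by (intro sum.cong) auto
  finally show "D_chain C d p x w \<le> D_chain C d p x y + d_star C d p y w + e" using z(5) by simp
qed

lemma D_chain_prepend:
  assumes "x \<in> C" "y \<in> C" "w \<in> C"
  shows "D_chain C d p w y \<le> d_star C d p w x + D_chain C d p x y"
proof (rule field_le_epsilon)
  fix e :: real assume "0 < e"
  then have "D_chain C d p x y < D_chain C d p x y + e" by simp
  then obtain N :: nat and z where z: "1 \<le> N" "z 1 = x" "z (N + 1) = y" "\<forall>j\<in>{1..N + 1}. z j \<in> C"
    "(\<Sum>j=1..N. d_star C d p (z j) (z (j + 1))) < D_chain C d p x y + e"
    by (rule D_chain_less[OF assms(1,2)]) (rule that)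
  \<comment> \<open>The old chain moves up by one index; the case \<open>j = 1\<close> is
    intercepted, so \<open>z 0\<close> does not enter the chain.\<close>
  let ?z = "\<lambda>j. if j = 1 then w else z (j - 1)"
  have "\<forall>j\<in>{1..Suc N + 1}. ?z j \<in> C"
  proof
    fix j assume j: "j \<in> {1..Suc N + 1}"
    show "?z j \<in> C"
    proof (cases "j = 1")
      case False
      then have "j - 1 \<in> {1..N + 1}" using j by auto
      then show ?thesis using z(4) False by simp
    qed (use assms(3) in simp)
  qed
  then have "D_chain C d p (?z 1) (?z (Suc N + 1)) \<le> (\<Sum>j=1..Suc N. d_star C d p (?z j) (?z (j + 1)))"
    by (intro D_chain_le) simp_all
  moreover have "?z 1 = w" "?z (Suc N + 1) = y" using z(3) by simp_all
  ultimately have "D_chain C d p w y \<le> (\<Sum>j=1..Suc N. d_star C d p (?z j) (?z (j + 1)))"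
    by (simp only:)
  also have "\<dots> = d_star C d p w x + (\<Sum>j=Suc 1..Suc N. d_star C d p (?z j) (?z (j + 1)))"
    using z(2) by (subst sum.atLeast_Suc_atMost) auto
  also have "(\<Sum>j=Suc 1..Suc N. d_star C d p (?z j) (?z (j + 1))) = (\<Sum>j=1..N. d_star C d p (z j) (z (j + 1)))"
    by (subst sum.shift_bounds_cl_Suc_ivl) (intro sum.cong, auto)
  finally show "D_chain C d p w y \<le> d_star C d p w x + D_chain C d p x y + e" using z(5) by simp
qed

text \<open>Prepending and appending one step changes the ends of a chain from \<open>q\<close> to
  \<open>r\<close> or back, and the two directions use \<open>d_star\<close> with opposite orders of
  arguments. Hence \<open>g\<close>, which vanishes at \<open>q\<close>, contains both orders and
  dominates the change of \<open>D_chain\<close>.\<close>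

lemma continuous_on_D_chain:
  fixes C :: "'a::locally_convex_t2_space set"
  assumes cont: "continuous_on (C \<times> C) (\<lambda>(x, y). d_star C d p x y)"
    and diag: "\<And>x. x \<in> C \<Longrightarrow> d_star C d p x x = 0"
  shows "continuous_on (C \<times> C) (\<lambda>(x, y). D_chain C d p x y)"
  unfolding continuous_on_def
proof
  fix q assume q: "q \<in> C \<times> C"
  let ?s = "\<lambda>x y. d_star C d p x y" and ?D = "\<lambda>r. D_chain C d p (fst r) (snd r)"
  define g where "g r = ?s (fst r) (fst q) + ?s (fst q) (fst r) + ?s (snd r) (snd q) + ?s (snd q) (snd r)" for r
  have comp: "continuous_on (C \<times> C) (\<lambda>r. ?s (u r) (v r))"
    if "continuous_on (C \<times> C) u" "continuous_on (C \<times> C) v" "\<And>r. r \<in> C \<times> C \<Longrightarrow> u r \<in> C \<and> v r \<in> C" for u v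
    using continuous_on_compose2[OF cont continuous_on_Pair[OF that(1,2)]] that(3) by auto
  have "continuous_on (C \<times> C) g"
    unfolding g_def using q by (intro continuous_on_add comp continuous_intros) auto
  then have "(g \<longlongrightarrow> g q) (at q within C \<times> C)" using q unfolding continuous_on_def by blast
  moreover have "g q = 0" using q by (auto simp: g_def diag)
  ultimately have g0: "(g \<longlongrightarrow> 0) (at q within C \<times> C)" by simp
  have "norm (?D r - ?D q) \<le> g r" if r: "r \<in> C \<times> C" for r
  proof -
    have mem: "fst q \<in> C" "snd q \<in> C" "fst r \<in> C" "snd r \<in> C" using q r by auto
    have s0: "0 \<le> ?s x y" for x y by (simp add: d_star_def)
    have "?D r \<le> D_chain C d p (fst r) (snd q) + ?s (snd q) (snd r)"
      "D_chain C d p (fst r) (snd q) \<le> ?s (fst r) (fst q) + ?D q"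
      "?D q \<le> D_chain C d p (fst q) (snd r) + ?s (snd r) (snd q)"
      "D_chain C d p (fst q) (snd r) \<le> ?s (fst q) (fst r) + ?D r"
      using mem by (intro D_chain_append D_chain_prepend; simp)+
    then show ?thesis
      using s0[of "fst r" "fst q"] s0[of "fst q" "fst r"] s0[of "snd r" "snd q"] s0[of "snd q" "snd r"]
      unfolding g_def real_norm_def abs_le_iff by linarith
  qed
  then have "eventually (\<lambda>r. norm (?D r - ?D q) \<le> g r) (at q within C \<times> C)"
    unfolding eventually_at_topological by blast
  then have "((\<lambda>r. ?D r - ?D q) \<longlongrightarrow> 0) (at q within C \<times> C)" using g0 by (rule Lim_null_comparison)
  then have "(?D \<longlongrightarrow> ?D q) (at q within C \<times> C)" by (rule LIM_zero_cancel)
  then show "((\<lambda>(x, y). D_chain C d p x y) \<longlongrightarrow> (case q of (x, y) \<Rightarrow> D_chain C d p x y)) (at q within C \<times> C)"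
    by (simp add: case_prod_unfold)
qed

section \<open>Continuity of the transport cost and of the chain distance\<close>

theorem proposition2p8:
  fixes C :: "'a::locally_convex_t2_space set"
    and d :: "'a \<Rightarrow> 'a \<Rightarrow> real"
    and p :: real
  assumes "C \<noteq> {}" and "compact C" and "stable_convex C"
    and "Metric_space (Ext C) d"
    and "continuous_on (Ext C \<times> Ext C) (\<lambda>(z, w). d z w)"
    and "1 \<le> p"
  shows "continuous_on (C \<times> C) (\<lambda>(x, y). d_star C d p x y)
       \<and> continuous_on (C \<times> C) (\<lambda>(x, y). D_chain C d p x y)"
proof -
  define c where "c w = d (fst w) (snd w) powr p" for w
  let ?Z = "Ext C \<times> Ext C"
  interpret Metric_space "Ext C" d by fact
  have E: "compact (Ext C)" using assms(2,3) by (rule compact_Ext)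
  have Z: "compact ?Z" using E by (simp add: compact_Times)
  have d_cont: "continuous_on S (\<lambda>r. d (u r) (v r))"
    if "continuous_on S u" "continuous_on S v" "\<And>r. r \<in> S \<Longrightarrow> u r \<in> Ext C \<and> v r \<in> Ext C"
    for S :: "('a \<times> 'a) set" and u v
  proof -
    have "(\<lambda>r. (u r, v r)) ` S \<subseteq> ?Z" using that(3) by blast
    then show ?thesis using continuous_on_compose2[OF assms(5) continuous_on_Pair[OF that(1,2)]] by simp
  qed
  \<comment> \<open>The product distance is continuous for the natural topology because
    \<open>d\<close> is, so the square of \<open>Ext C\<close> inherits the positivity
    functions.\<close>
  have coz: "cozero_space ?Z"
  proof (rule cozero_space_of_metric[OF _ Z])
    show "Metric_space ?Z (prod_dist d d)"
      by (intro Metric_space12.prod_metric Metric_space12.intro assms(4))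
    show "continuous_on ?Z (prod_dist d d z)" if "z \<in> ?Z" for z
      unfolding prod_dist_def case_prod_unfold using that
      by (intro continuous_intros d_cont) auto
  qed
  have c_cont: "continuous_on ?Z c"
    unfolding c_def using assms(6) by (intro continuous_on_powr' d_cont continuous_intros) auto
  interpret stable_compact "C \<times> C" c
    using assms(2,3) Z coz c_cont
    by unfold_locales (simp_all add: Ext_Times compact_Times stable_convex_Times)
  have d_star_eq: "d_star C d p x y = min_cost (x, y) powr (1 / p)" for x y
    using coupling_integrals[OF E coz c_cont, of x y]
    by (simp add: d_star_def min_cost_def Ext_Times c_def)
  have min_cost_nonneg: "0 \<le> min_cost q" if q: "q \<in> C \<times> C" for q
  proof -
    obtain \<phi> where phi: "\<phi> \<in> representing_states (Ext (C \<times> C)) q" "\<phi> c = min_cost q" by (rule min_cost_attained[OF q])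
    have "0 \<le> \<phi> c"
      using state_nonneg[OF representing_statesD(1)[OF phi(1)] c] by (simp add: c_def)
    then show ?thesis using phi(2) by simp
  qed
  \<comment> \<open>The exponent is positive, so \<open>powr\<close> is continuous on nonnegative
    bases, including the base 0 that occurs on the diagonal.\<close>
  have "continuous_on (C \<times> C) (\<lambda>q. min_cost q powr (1 / p))"
    using min_cost_nonneg assms(6) by (intro continuous_on_powr' continuous_on_min_cost continuous_intros) auto
  then have cont: "continuous_on (C \<times> C) (\<lambda>(x, y). d_star C d p x y)"
    by (simp add: d_star_eq case_prod_unfold)
  \<comment> \<open>Lower semicontinuity and convexity of \<open>min_cost\<close> make this set
    closed and convex, so only extreme points need checking; there the point mass at
    \<open>(e, e)\<close> has cost \<open>0 powr p = 0\<close>.\<close>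
  have "C \<subseteq> (\<lambda>x. (x, x)) -` {q \<in> C \<times> C. min_cost q \<le> 0}"
  proof (rule krein_milman_subset[OF assms(2)])
    show "convex C" using assms(3) by (simp add: stable_convex_def)
    show "closed ((\<lambda>x. (x, x)) -` {q \<in> C \<times> C. min_cost q \<le> 0})"
      by (intro closed_vimage closed_min_cost_le continuous_intros)
    show "Ext C \<subseteq> (\<lambda>x. (x, x)) -` {q \<in> C \<times> C. min_cost q \<le> 0}"
    proof
      fix e assume e: "e \<in> Ext C"
      then have "min_cost (e, e) \<le> c (e, e)" by (intro min_cost_extreme) (simp add: Ext_Times)
      then show "e \<in> (\<lambda>x. (x, x)) -` {q \<in> C \<times> C. min_cost q \<le> 0}"
        using e by (auto simp: c_def Ext_def extreme_point_of_def)
    qed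
    show "convex ((\<lambda>x. (x, x)) -` {q \<in> C \<times> C. min_cost q \<le> 0})"
    proof (rule convexI)
      fix x y and u v :: real
      assume *: "x \<in> (\<lambda>x. (x, x)) -` {q \<in> C \<times> C. min_cost q \<le> 0}" "y \<in> (\<lambda>x. (x, x)) -` {q \<in> C \<times> C. min_cost q \<le> 0}"
        and uv: "0 \<le> u" "0 \<le> v" "u + v = 1"
      have xy: "(x, x) \<in> C \<times> C" "min_cost (x, x) \<le> 0" "(y, y) \<in> C \<times> C" "min_cost (y, y) \<le> 0" using * by auto
      have "min_cost (u *\<^sub>R (x, x) + v *\<^sub>R (y, y)) \<le> u * min_cost (x, x) + v * min_cost (y, y)"
        by (rule min_cost_convex_le[OF xy(1,3) uv])
      also have "\<dots> \<le> 0" using uv xy by (simp add: add_nonpos_nonpos mult_nonneg_nonpos)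
      finally have "min_cost (u *\<^sub>R (x, x) + v *\<^sub>R (y, y)) \<le> 0" .
      moreover have "u *\<^sub>R (x, x) + v *\<^sub>R (y, y) \<in> C \<times> C" by (rule convexD[OF convex_K xy(1,3) uv])
      ultimately show "u *\<^sub>R x + v *\<^sub>R y \<in> (\<lambda>x. (x, x)) -` {q \<in> C \<times> C. min_cost q \<le> 0}" by simp
    qed
  qed
  then have "min_cost (x, x) = 0" if "x \<in> C" for x using that min_cost_nonneg[of "(x, x)"] by fastforce
  then have "d_star C d p x x = 0" if "x \<in> C" for x using that by (simp add: d_star_eq)
  then show ?thesis using cont continuous_on_D_chain[OF cont] by blast
qed

end
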